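(* Let $P=P_\lambda$ be the Gelfand--Zetlin polytope of a strictly dominant weight $\lambda\in\mathbb{Z}^n$, and let $Q$ be a resolution of $P$ as described in the context. For all $1\le i\le n-1$ and $1\le j\le n-i$ the following linear relation holds in $R_Q$: $$[\Gamma_{i,j}]-[\Gamma^-_{i,j}]-[\Gamma_{i-1,j}]+[\Gamma^-_{i-1,j+1}]=0,$$ where terms whose indices are out of range must be ignored. Moreover, all linear relations between the classes of facets in $R_Q$ are generated by these.
   Context: **Gelfand--Zetlin polytope.** Let $d=n(n-1)/2$, and let $\mathbb{R}^d$ have coordinates $\lambda_{i,j}$, $1\le i\le n-1$, $1\le j\le n-i$. A weight $\lambda=(\lambda_1,\dots,\lambda_n)\in\mathbb{Z}^n$ is strictly dominant if $\lambda_1<\dots<\lambda_n$. Put $\lambda_{0,j}=\lambda_j$. $P_\lambda\subset\mathbb{R}^d$ is given by $\lambda_{i,j}\le\lambda_{i+1,j}\le\lambda_{i,j+1}$ for $0\le i\le n-2$, $1\le j\le n-i-1$. Its facets are $\Gamma_{i,j}=\{\lambda_{i,j}=\lambda_{i+1,j}\}$ ($0\le i\le n-2$, $1\le j\le n-i-1$) and $\Gamma^-_{i,j}=\{\lambda_{i,j}=\lambda_{i+1,j-1}\}$ ($0\le i\le n-2$, $2\le j\le n-i$). **The ring $R_Q$.** $Q$ is a simple integer polytope whose normal fan is a simplicial subdivision of the normal fan of $P$ with the same rays, so facets of $Q$ correspond bijectively to parallel facets of $P$ and are denoted by the same symbols. Two polytopes are analogous if they have the same normal fan; virtual polytopes are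 elements of the Grothendieck group of convex polytopes under Minkowski sum. $V_Q$ is the real vector space of virtual polytopes that are differences of polytopes analogous to $Q$, with coordinates the support numbers $H_\Gamma$, one for each facet $\Gamma$ (with primitive integer outer normal covector $\xi_\Gamma$, the polytope is given by $\xi_\Gamma(x)\le H_\Gamma$). $\Lambda_Q\subset V_Q$ is the lattice generated by all integer polytopes analogous to $Q$; $vol_Q$ is the homogeneous polynomial on $V_Q$ whose value at each convex polytope analogous to $Q$ is its volume. $\mathrm{Sym}(\Lambda_Q)$ acts on polynomials on $V_Q$ by constant-coefficient differential operators and $R_Q=\mathrm{Sym}(\Lambda_Q)/\{D:D\,vol_Q=0\}$. For a facet $\Gamma$, $[\Gamma]\in R_Q$ is the class of $\partial/\partial H_\Gamma$. *)

theory Defs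
  imports
    "HOL-Analysis.Analysis"
    "HOL-Algebra.QuotRing"
    "HOL-Library.Poly_Mapping"
    "HOL-Library.Multiset"
begin

definition convex_polytope :: "'a::euclidean_space set \<Rightarrow> bool" where
  "convex_polytope A \<longleftrightarrow> polytope A \<and> A \<noteq> {}"

definition support_fun :: "'a::euclidean_space set \<Rightarrow> 'a \<Rightarrow> real" where
  "support_fun A u = (SUP x\<in>A. u \<bullet> x)"

text \<open>The usual equivalence relation of the Grothendieck group of the monoid of convex polytopes
  under Minkowski sum; the pair \<open>(A, B)\<close> stands for the formal difference \<open>A - B\<close>.\<close>

definition vp_rel :: "'a::euclidean_space set \<times> 'a set \<Rightarrow> 'a set \<times> 'a set \<Rightarrow> bool" where
  "vp_rel = (\<lambda>(A, B) (C, D). convex_polytope A \<and> convex_polytope B \<and>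
     convex_polytope C \<and> convex_polytope D \<and>
     (\<exists>E. convex_polytope E \<and> A + D + E = C + B + E))"

lemma convex_polytope_singleton [simp]: "convex_polytope {a}"
  by (simp add: convex_polytope_def polytope_sing)

lemma convex_polytope_plus [simp]:
  assumes "convex_polytope A" "convex_polytope B"
  shows "convex_polytope (A + B)"
proof -
  have "polytope ((\<lambda>z. fst z + snd z) ` (A \<times> B))"
    using assms by (intro polytope_linear_image polytope_Times)
      (auto simp: convex_polytope_def intro!: linearI simp: algebra_simps)
  moreover have "(\<lambda>z. fst z + snd z) ` (A \<times> B) = A + B"
    by (force simp: set_plus_def image_iff)
  ultimately show ?thesis using assms
    by (auto simp: convex_polytope_def set_plus_def)
qed

lemma convex_polytope_scaleR [simp]:
  "convex_polytope A \<Longrightarrow> convex_polytope ((*\<^sub>R) c ` A)"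
  by (auto simp: convex_polytope_def intro!: polytope_linear_image linearI simp: algebra_simps)

lemma support_fun_attained:
  assumes "convex_polytope A"
  obtains x where "x \<in> A" "support_fun A u = u \<bullet> x" "\<And>y. y \<in> A \<Longrightarrow> u \<bullet> y \<le> u \<bullet> x"
proof -
  have "compact A" "A \<noteq> {}"
    using assms by (auto simp: convex_polytope_def polytope_imp_compact)
  then obtain x where x: "x \<in> A" "\<forall>y\<in>A. u \<bullet> y \<le> u \<bullet> x"
    using continuous_attains_sup[of A "\<lambda>y. u \<bullet> y"] by (auto simp: continuous_on_inner)
  then have "support_fun A u = u \<bullet> x"
    unfolding support_fun_def by (intro cSup_eq_maximum) auto
  with x that show ?thesis by auto
qed

lemma support_fun_upper:
  assumes "convex_polytope A" "x \<in> A"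
  shows "u \<bullet> x \<le> support_fun A u"
  by (metis assms support_fun_attained)

lemma support_fun_eqI:
  assumes "x \<in> A" "\<And>y. y \<in> A \<Longrightarrow> u \<bullet> y \<le> u \<bullet> x"
  shows "support_fun A u = u \<bullet> x"
  unfolding support_fun_def using assms by (intro cSup_eq_maximum) auto

lemma support_fun_plus:
  assumes "convex_polytope A" "convex_polytope B"
  shows "support_fun (A + B) u = support_fun A u + support_fun B u"
proof -
  obtain x where x: "x \<in> A" "support_fun A u = u \<bullet> x" "\<And>y. y \<in> A \<Longrightarrow> u \<bullet> y \<le> u \<bullet> x"
    using support_fun_attained[OF assms(1)] by metis
  obtain z where z: "z \<in> B" "support_fun B u = u \<bullet> z" "\<And>y. y \<in> B \<Longrightarrow> u \<bullet> y \<le> u \<bullet> z"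
    using support_fun_attained[OF assms(2)] by metis
  have "support_fun (A + B) u = u \<bullet> (x + z)"
    using x z by (intro support_fun_eqI)
      (auto simp: set_plus_def inner_right_distrib intro!: add_mono)
  then show ?thesis using x z by (simp add: inner_right_distrib)
qed

lemma support_fun_scaleR:
  assumes "convex_polytope A" "0 \<le> c"
  shows "support_fun ((*\<^sub>R) c ` A) u = c * support_fun A u"
proof -
  obtain x where x: "x \<in> A" "support_fun A u = u \<bullet> x" "\<And>y. y \<in> A \<Longrightarrow> u \<bullet> y \<le> u \<bullet> x"
    using support_fun_attained[OF assms(1)] by metis
  have "support_fun ((*\<^sub>R) c ` A) u = u \<bullet> (c *\<^sub>R x)"
    using x assms(2) by (intro support_fun_eqI) (auto intro!: mult_left_mono)
  then show ?thesis using x by simp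
qed

lemma support_fun_scaleR_neg:
  assumes "convex_polytope A" "c \<le> 0"
  shows "support_fun ((*\<^sub>R) (- c) ` A) u = - c * support_fun A u"
  using assms by (intro support_fun_scaleR) auto

lemma support_fun_subset:
  assumes "convex_polytope A" "convex_polytope B" "support_fun A = support_fun B"
  shows "A \<subseteq> B"
proof
  fix x assume "x \<in> A"
  show "x \<in> B"
  proof (rule ccontr)
    assume "x \<notin> B"
    moreover have "convex B" "closed B"
      using assms(2) by (auto simp: convex_polytope_def polytope_imp_convex polytope_imp_closed)
    ultimately obtain a b where ab: "a \<bullet> x < b" "\<forall>y\<in>B. b < a \<bullet> y"
      using separating_hyperplane_closed_point[of B x] by blast
    obtain y where "y \<in> B" "support_fun B (-a) = (-a) \<bullet> y"
      using support_fun_attained[OF assms(2)] by metis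
    moreover have "(-a) \<bullet> x \<le> support_fun A (-a)"
      using assms(1) \<open>x \<in> A\<close> by (rule support_fun_upper)
    ultimately show False using ab assms(3) by force
  qed
qed

lemma vp_rel_iff:
  "vp_rel (A, B) (C, D) \<longleftrightarrow> convex_polytope A \<and> convex_polytope B \<and>
     convex_polytope C \<and> convex_polytope D \<and>
     (\<forall>u. support_fun A u - support_fun B u = support_fun C u - support_fun D u)"
proof (cases "convex_polytope A \<and> convex_polytope B \<and> convex_polytope C \<and> convex_polytope D")
  case True
  have "A + D + {0} = C + B + {0}"
    if "\<forall>u. support_fun A u - support_fun B u = support_fun C u - support_fun D u"
  proof -
    have "support_fun (A + D) = support_fun (C + B)"
      using True that by (auto simp: fun_eq_iff support_fun_plus algebra_simps)
    then have "A + D = C + B"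
      using True by (intro equalityI support_fun_subset) auto
    then show ?thesis by simp
  qed
  moreover have "support_fun A u - support_fun B u = support_fun C u - support_fun D u"
    if E: "convex_polytope E" "A + D + E = C + B + E" for E u
  proof -
    have "support_fun (A + D + E) u = support_fun (C + B + E) u" using E by simp
    then show ?thesis using True E(1) by (simp add: support_fun_plus)
  qed
  ultimately show ?thesis using True convex_polytope_singleton[of "0::'a"]
    unfolding vp_rel_def by blast
qed (auto simp: vp_rel_def)

quotient_type (overloaded) 'a virtual_polytope =
  "'a::euclidean_space set \<times> 'a set" / partial: vp_rel
proof (rule part_equivpI)
  show "\<exists>x. vp_rel x x"
    by (rule exI[of _ "({0}, {0})"]) (simp add: vp_rel_iff)
  show "symp vp_rel"
    by (rule sympI) (auto simp: vp_rel_iff)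
  show "transp vp_rel"
    by (rule transpI) (auto simp: vp_rel_iff)
qed

lift_definition vp_support :: "'a::euclidean_space virtual_polytope \<Rightarrow> 'a \<Rightarrow> real" is
  "\<lambda>(A, B) u. support_fun A u - support_fun B u"
  by (auto simp: vp_rel_iff fun_eq_iff)

lemma vp_support_inject: "vp_support v = vp_support w \<Longrightarrow> v = w"
  by transfer (auto simp: vp_rel_iff fun_eq_iff)

instantiation virtual_polytope :: (euclidean_space) real_vector
begin

lift_definition zero_virtual_polytope :: "'a virtual_polytope" is "({0}, {0})"
  by (simp add: vp_rel_iff)

lift_definition plus_virtual_polytope ::
  "'a virtual_polytope \<Rightarrow> 'a virtual_polytope \<Rightarrow> 'a virtual_polytope" is
  "\<lambda>(A, B) (C, D). (A + C, B + D)"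
  by (auto simp: vp_rel_iff support_fun_plus algebra_simps)

lift_definition uminus_virtual_polytope :: "'a virtual_polytope \<Rightarrow> 'a virtual_polytope" is
  "\<lambda>(A, B). (B, A)"
  by (auto simp: vp_rel_iff algebra_simps)

definition minus_virtual_polytope ::
  "'a virtual_polytope \<Rightarrow> 'a virtual_polytope \<Rightarrow> 'a virtual_polytope" where
  "minus_virtual_polytope v w = v + (- w)"

lift_definition scaleR_virtual_polytope :: "real \<Rightarrow> 'a virtual_polytope \<Rightarrow> 'a virtual_polytope" is
  "\<lambda>c (A, B). if 0 \<le> c then ((*\<^sub>R) c ` A, (*\<^sub>R) c ` B) else ((*\<^sub>R) (- c) ` B, (*\<^sub>R) (- c) ` A)"
proof (clarify, unfold vp_rel_iff, goal_cases)
  case (1 c A B C D)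
  then have "c * support_fun A u - c * support_fun B u = c * support_fun C u - c * support_fun D u" for u
    by (metis right_diff_distrib)
  with 1 show ?case
    by (auto simp: vp_rel_iff support_fun_scaleR support_fun_scaleR_neg
      right_diff_distrib simp del: scaleR_minus_left)
qed

lemma vp_support_zero [simp]: "vp_support 0 u = 0"
  by transfer simp

lemma vp_support_plus [simp]: "vp_support (v + w) u = vp_support v u + vp_support w u"
  by transfer (auto simp: vp_rel_iff support_fun_plus)

lemma vp_support_uminus [simp]: "vp_support (- v) u = - vp_support v u"
  by transfer auto

lemma vp_support_scaleR [simp]: "vp_support (c *\<^sub>R v) u = c * vp_support v u"
  by transfer (auto simp: vp_rel_iff support_fun_scaleR support_fun_scaleR_neg
    right_diff_distrib simp del: scaleR_minus_left)

instance
  by standard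
    (auto intro!: vp_support_inject simp: fun_eq_iff minus_virtual_polytope_def algebra_simps)

end

text \<open>The value on sets that are not convex polytopes is a dummy.\<close>

lift_definition vp_of :: "'a::euclidean_space set \<Rightarrow> 'a virtual_polytope" is
  "\<lambda>A. if convex_polytope A then (A, {0}) else ({0}, {0})"
  by (auto simp: vp_rel_iff)

definition integral_vector :: "real^'d \<Rightarrow> bool" where
  "integral_vector u \<longleftrightarrow> (\<forall>k. u $ k \<in> \<int>)"

definition primitive_vector :: "real^'d \<Rightarrow> bool" where
  "primitive_vector u \<longleftrightarrow> integral_vector u \<and> u \<noteq> 0 \<and>
     (\<forall>w (m::nat). integral_vector w \<and> u = real m *\<^sub>R w \<longrightarrow> m = 1)"

definition integer_polytope :: "(real^'d) set \<Rightarrow> bool" where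
  "integer_polytope A \<longleftrightarrow> polytope A \<and> (\<forall>v. v extreme_point_of A \<longrightarrow> integral_vector v)"

definition simple_polytope :: "'a::euclidean_space set \<Rightarrow> bool" where
  "simple_polytope A \<longleftrightarrow> polytope A \<and>
     (\<forall>v. v extreme_point_of A \<longrightarrow> int (card {F. F facet_of A \<and> v \<in> F}) = aff_dim A)"

definition normal_cone :: "'a::euclidean_space set \<Rightarrow> 'a set \<Rightarrow> 'a set" where
  "normal_cone A F = {u. \<forall>x\<in>F. \<forall>y\<in>A. u \<bullet> y \<le> u \<bullet> x}"

definition normal_fan :: "'a::euclidean_space set \<Rightarrow> 'a set set" where
  "normal_fan A = {normal_cone A F | F. F face_of A \<and> F \<noteq> {}}"

definition analogous :: "'a::euclidean_space set \<Rightarrow> 'a set \<Rightarrow> bool" where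
  "analogous A B \<longleftrightarrow> convex_polytope A \<and> convex_polytope B \<and> normal_fan A = normal_fan B"

definition fan_rays :: "'a::euclidean_space set set \<Rightarrow> 'a set set" where
  "fan_rays S = {\<sigma> \<in> S. dim \<sigma> = 1}"

definition simplicial_fan :: "'a::euclidean_space set set \<Rightarrow> bool" where
  "simplicial_fan S \<longleftrightarrow> (\<forall>\<sigma>\<in>S. \<exists>B. independent B \<and> \<sigma> = convex_cone hull B)"

definition subdivides :: "'a::euclidean_space set set \<Rightarrow> 'a set set \<Rightarrow> bool" where
  "subdivides S T \<longleftrightarrow> (\<forall>\<sigma>\<in>S. \<exists>\<tau>\<in>T. \<sigma> \<subseteq> \<tau>) \<and> \<Union>S = \<Union>T"

definition resolution_of :: "(real^'d) set \<Rightarrow> (real^'d) set \<Rightarrow> bool" where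
  "resolution_of Q P \<longleftrightarrow> simple_polytope Q \<and> integer_polytope Q \<and>
     simplicial_fan (normal_fan Q) \<and> subdivides (normal_fan Q) (normal_fan P) \<and>
     fan_rays (normal_fan Q) = fan_rays (normal_fan P)"

text \<open>The primitive integer outer normal covector of a facet of a full-dimensional rational
  polytope; covectors are identified with vectors through the standard inner product.\<close>

definition outer_normal :: "(real^'d) set \<Rightarrow> (real^'d) set \<Rightarrow> real^'d" where
  "outer_normal A F =
     (THE u. primitive_vector u \<and> F = {x \<in> A. \<forall>y\<in>A. u \<bullet> y \<le> u \<bullet> x})"

definition parallel_facet :: "(real^'d) set \<Rightarrow> (real^'d) set \<Rightarrow> (real^'d) set \<Rightarrow> (real^'d) set" where
  "parallel_facet Q P G = (THE F. F facet_of Q \<and> outer_normal Q F = outer_normal P G)"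

definition virtual_space :: "(real^'d) set \<Rightarrow> (real^'d) virtual_polytope set" where
  "virtual_space Q = {vp_of A - vp_of B | A B. analogous A Q \<and> analogous B Q}"

definition virtual_lattice :: "(real^'d) set \<Rightarrow> (real^'d) virtual_polytope set" where
  "virtual_lattice Q = (\<lambda>L. 0 \<in> L \<and> (\<forall>u\<in>L. \<forall>v\<in>L. u - v \<in> L)) hull
     {vp_of A | A. integer_polytope A \<and> analogous A Q}"

definition support_number :: "(real^'d) set \<Rightarrow> (real^'d) set \<Rightarrow> (real^'d) virtual_polytope \<Rightarrow> real" where
  "support_number Q F v = vp_support v (outer_normal Q F)"

text \<open>Homogeneous polynomials in the coordinates of \<open>virtual_space Q\<close>. Such a polynomial
  is also evaluated at virtual polytopes outside \<open>virtual_space Q\<close>, through the same formula.\<close>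

definition homogeneous_polynomial ::
  "(real^'d) set \<Rightarrow> ((real^'d) virtual_polytope \<Rightarrow> real) \<Rightarrow> bool" where
  "homogeneous_polynomial Q f \<longleftrightarrow> (\<exists>k M a. finite (M :: ((real^'d) set \<Rightarrow> nat) set) \<and>
     (\<forall>m\<in>M. (\<Sum>F | F facet_of Q. m F) = k) \<and>
     f = (\<lambda>v. \<Sum>m\<in>M. a m * (\<Prod>F | F facet_of Q. support_number Q F v ^ m F)))"

definition volume_polynomial :: "(real^'d) set \<Rightarrow> (real^'d) virtual_polytope \<Rightarrow> real" where
  "volume_polynomial Q = (THE f. homogeneous_polynomial Q f \<and>
     (\<forall>A. analogous A Q \<longrightarrow> f (vp_of A) = measure lebesgue A))"

text \<open>The polynomial ring over the integers with one variable for each element of \<open>L\<close>,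
  monomials being multisets of variables. Addition of multisets is multiplication of
  monomials, so the product of \<open>\<Rightarrow>\<^sub>0\<close> (convolution) is multiplication of polynomials.\<close>

definition int_poly_ring :: "'v set \<Rightarrow> ('v multiset \<Rightarrow>\<^sub>0 int) ring" where
  "int_poly_ring L = \<lparr>carrier = {p. \<forall>M\<in>Poly_Mapping.keys p. set_mset M \<subseteq> L},
     mult = (*), one = 1, zero = 0, add = (+)\<rparr>"

definition poly_var :: "'v \<Rightarrow> 'v multiset \<Rightarrow>\<^sub>0 int" where
  "poly_var v = Poly_Mapping.single {#v#} 1"

definition sym_ideal :: "'v::ab_group_add set \<Rightarrow> ('v multiset \<Rightarrow>\<^sub>0 int) set" where
  "sym_ideal L = Idl\<^bsub>int_poly_ring L\<^esub>
     {poly_var (u + v) - poly_var u - poly_var v | u v. u \<in> L \<and> v \<in> L}"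

definition sym_alg :: "'v::ab_group_add set \<Rightarrow> ('v multiset \<Rightarrow>\<^sub>0 int) set ring" where
  "sym_alg L = int_poly_ring L Quot sym_ideal L"

definition sym_gen :: "'v::ab_group_add set \<Rightarrow> 'v \<Rightarrow> ('v multiset \<Rightarrow>\<^sub>0 int) set" where
  "sym_gen L v = sym_ideal L +>\<^bsub>int_poly_ring L\<^esub> poly_var v"

definition dir_deriv :: "'v::real_vector \<Rightarrow> ('v \<Rightarrow> real) \<Rightarrow> 'v \<Rightarrow> real" where
  "dir_deriv v f x = deriv (\<lambda>t. f (x + t *\<^sub>R v)) 0"

text \<open>Directional derivatives of polynomials commute, so the chosen order of \<open>M\<close> is irrelevant.\<close>

definition mset_deriv :: "'v::real_vector multiset \<Rightarrow> ('v \<Rightarrow> real) \<Rightarrow> 'v \<Rightarrow> real" where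
  "mset_deriv M f = foldr dir_deriv (SOME vs. mset vs = M) f"

definition diff_op :: "('v::real_vector multiset \<Rightarrow>\<^sub>0 int) \<Rightarrow> ('v \<Rightarrow> real) \<Rightarrow> 'v \<Rightarrow> real" where
  "diff_op p f x = (\<Sum>M\<in>Poly_Mapping.keys p. of_int (Poly_Mapping.lookup p M) * mset_deriv M f x)"

text \<open>An element \<open>D\<close> of the symmetric algebra is a coset of polynomials in the elements of
  \<open>L\<close>; all its members act on a polynomial function \<open>f\<close> in the same way.\<close>

definition annihilator ::
  "'v::real_vector set \<Rightarrow> 'v set \<Rightarrow> ('v \<Rightarrow> real) \<Rightarrow> ('v multiset \<Rightarrow>\<^sub>0 int) set set" where
  "annihilator L V f = {D \<in> carrier (sym_alg L). \<forall>p\<in>D. \<forall>x\<in>V. diff_op p f x = 0}"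

definition vol_annihilator ::
  "(real^'d) set \<Rightarrow> ((real^'d) virtual_polytope multiset \<Rightarrow>\<^sub>0 int) set set" where
  "vol_annihilator Q = annihilator (virtual_lattice Q) (virtual_space Q) (volume_polynomial Q)"

definition polytope_ring ::
  "(real^'d) set \<Rightarrow> ((real^'d) virtual_polytope multiset \<Rightarrow>\<^sub>0 int) set set ring" where
  "polytope_ring Q = sym_alg (virtual_lattice Q) Quot vol_annihilator Q"

text \<open>The operator \<open>\<partial>/\<partial>H\<^sub>F\<close> is the derivative along the vector of \<open>virtual_space Q\<close>
  whose \<open>F\<close>-th coordinate is 1 and whose other coordinates vanish.\<close>

definition coordinate_vector :: "(real^'d) set \<Rightarrow> (real^'d) set \<Rightarrow> (real^'d) virtual_polytope" where
  "coordinate_vector Q F = (THE v. v \<in> virtual_space Q \<and>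
     (\<forall>G. G facet_of Q \<longrightarrow> support_number Q G v = (if G = F then 1 else 0)))"

definition facet_class ::
  "(real^'d) set \<Rightarrow> (real^'d) set \<Rightarrow> ((real^'d) virtual_polytope multiset \<Rightarrow>\<^sub>0 int) set set" where
  "facet_class Q F = vol_annihilator Q
     +>\<^bsub>sym_alg (virtual_lattice Q)\<^esub> sym_gen (virtual_lattice Q) (coordinate_vector Q F)"

text \<open>The coordinates of \<open>real^'d\<close> are labelled by pairs: \<open>c i j\<close> is the index of the
  coordinate \<open>\<lambda>\<^sub>i\<^sub>,\<^sub>j\<close>.\<close>

definition gz_labelling :: "nat \<Rightarrow> (nat \<Rightarrow> nat \<Rightarrow> 'd::finite) \<Rightarrow> bool" where
  "gz_labelling n c \<longleftrightarrow>
     bij_betw (\<lambda>(i, j). c i j) {(i, j). 1 \<le> i \<and> i \<le> n - 1 \<and> 1 \<le> j \<and> j \<le> n - i} UNIV"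

definition gz_entry ::
  "(nat \<Rightarrow> nat \<Rightarrow> 'd::finite) \<Rightarrow> (nat \<Rightarrow> int) \<Rightarrow> real^'d \<Rightarrow> nat \<Rightarrow> nat \<Rightarrow> real" where
  "gz_entry c lam x i j = (if i = 0 then of_int (lam j) else x $ c i j)"

definition gz_polytope ::
  "nat \<Rightarrow> (nat \<Rightarrow> nat \<Rightarrow> 'd::finite) \<Rightarrow> (nat \<Rightarrow> int) \<Rightarrow> (real^'d) set" where
  "gz_polytope n c lam = {x. \<forall>i j. i \<le> n - 2 \<and> 1 \<le> j \<and> j \<le> n - i - 1 \<longrightarrow>
     gz_entry c lam x i j \<le> gz_entry c lam x (i + 1) j \<and>
     gz_entry c lam x (i + 1) j \<le> gz_entry c lam x i (j + 1)}"

text \<open>\<open>GZ i j\<close> and \<open>GZm i j\<close> stand for the symbols \<open>\<Gamma>\<^sub>i\<^sub>,\<^sub>j\<close> and \<open>\<Gamma>\<^sup>-\<^sub>i\<^sub>,\<^sub>j\<close>.\<close>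

datatype gz_symbol = GZ nat nat | GZm nat nat

definition gz_symbols :: "nat \<Rightarrow> gz_symbol set" where
  "gz_symbols n = {GZ i j | i j. i \<le> n - 2 \<and> 1 \<le> j \<and> j \<le> n - i - 1}
     \<union> {GZm i j | i j. i \<le> n - 2 \<and> 2 \<le> j \<and> j \<le> n - i}"

fun gz_facet ::
  "nat \<Rightarrow> (nat \<Rightarrow> nat \<Rightarrow> 'd::finite) \<Rightarrow> (nat \<Rightarrow> int) \<Rightarrow> gz_symbol \<Rightarrow> (real^'d) set" where
  "gz_facet n c lam (GZ i j) =
     {x \<in> gz_polytope n c lam. gz_entry c lam x i j = gz_entry c lam x (i + 1) j}"
| "gz_facet n c lam (GZm i j) =
     {x \<in> gz_polytope n c lam. gz_entry c lam x i j = gz_entry c lam x (i + 1) (j - 1)}"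

definition res_facet ::
  "nat \<Rightarrow> (nat \<Rightarrow> nat \<Rightarrow> 'd::finite) \<Rightarrow> (nat \<Rightarrow> int) \<Rightarrow> (real^'d) set \<Rightarrow> gz_symbol \<Rightarrow> (real^'d) set" where
  "res_facet n c lam Q s = parallel_facet Q (gz_polytope n c lam) (gz_facet n c lam s)"

definition gz_class ::
  "nat \<Rightarrow> (nat \<Rightarrow> nat \<Rightarrow> 'd::finite) \<Rightarrow> (nat \<Rightarrow> int) \<Rightarrow> (real^'d) set \<Rightarrow> gz_symbol \<Rightarrow>
     ((real^'d) virtual_polytope multiset \<Rightarrow>\<^sub>0 int) set set" where
  "gz_class n c lam Q s =
     (if s \<in> gz_symbols n then facet_class Q (res_facet n c lam Q s) else \<zero>\<^bsub>polytope_ring Q\<^esub>)"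

definition gz_indicator ::
  "nat \<Rightarrow> (nat \<Rightarrow> nat \<Rightarrow> 'd::finite) \<Rightarrow> (nat \<Rightarrow> int) \<Rightarrow> (real^'d) set \<Rightarrow> gz_symbol \<Rightarrow> (real^'d) set \<Rightarrow> int" where
  "gz_indicator n c lam Q s F = (if s \<in> gz_symbols n \<and> F = res_facet n c lam Q s then 1 else 0)"

text \<open>The coefficients of \<open>[\<Gamma>\<^sub>i\<^sub>,\<^sub>j] - [\<Gamma>\<^sup>-\<^sub>i\<^sub>,\<^sub>j] - [\<Gamma>\<^sub>i\<^sub>-\<^sub>1\<^sub>,\<^sub>j] + [\<Gamma>\<^sup>-\<^sub>i\<^sub>-\<^sub>1\<^sub>,\<^sub>j\<^sub>+\<^sub>1]\<close> as a formal integer combination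
  of the facets of \<open>Q\<close>.\<close>

definition gz_relation ::
  "nat \<Rightarrow> (nat \<Rightarrow> nat \<Rightarrow> 'd::finite) \<Rightarrow> (nat \<Rightarrow> int) \<Rightarrow> (real^'d) set \<Rightarrow> nat \<Rightarrow> nat \<Rightarrow> (real^'d) set \<Rightarrow> int" where
  "gz_relation n c lam Q i j F =
     gz_indicator n c lam Q (GZ i j) F - gz_indicator n c lam Q (GZm i j) F
     - gz_indicator n c lam Q (GZ (i - 1) j) F + gz_indicator n c lam Q (GZm (i - 1) (j + 1)) F"

end

theory Submission
  imports Defs
begin

text \<open>Let \<open>g H\<close> be the volume of the polytope with support numbers \<open>H\<close>. A mixed finite difference of \<open>g\<close>
  in the directions of distinct facets is the volume of the set of points between the two positions
  of each of them, so it vanishes locally unless these facets meet. As \<open>g\<close> is invariant under translations,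
  a repeated direction can be traded for directions of other facets, and since at most \<open>d\<close> facets of a simple
  polytope meet, all differences of order \<open>d + 1\<close> vanish: \<open>g\<close> is a polynomial. A linear relation between
  facet classes is a direction along which \<open>g\<close> is constant. Translations are such directions, and there are no
  others: the mixed difference over the facets containing an edge depends only on the support numbers of
  these facets and of the two facets cutting off the edge, so that the deformed polytope is displaced by the same vector at
  both end points of the edge; hence by the same vector at all vertices. Finally, the translation
  by the coordinate vector of \<open>\<lambda>\<^sub>i\<^sub>,\<^sub>j\<close> is the given relation, and translation vectors with
  integer support numbers are integral because the facet normals are totally unimodular.\<close>

subsection \<open>Polynomial functions\<close>

text \<open>Finite differences stand in for partial derivatives because nothing is known in advance
  about the smoothness of the volume; the only regularity at hand is that the volume grows with each
  support number. Every \<open>H\<close> has a volume, but polynomiality is claimed only on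
  \<open>type_cone\<close>, the open convex cone of support numbers whose polytope has the fan of
  \<open>Q\<close>. Hence the arguments are local, with small steps, and their results are then
  spread over this cone. A mixed difference over the facets through an edge plays the part of the
  length of that edge, which is what links the deformations at its two ends. On the algebraic side,
  \<open>polytope_ring\<close> is a double quotient of a polynomial ring, and a combination of facet
  classes is zero exactly when one directional derivative of the volume polynomial vanishes
  identically. Unimodularity has a second use: it gives polytopes of the fan with integer support
  numbers integral vertices, so that the vectors with a single coordinate 1 belong to the lattice
  and the facet classes really are classes of operators over it.\<close>

inductive_set poly_functions :: "('v \<Rightarrow> real) set \<Rightarrow> ('v \<Rightarrow> real) set" for L where
  const: "(\<lambda>_. c) \<in> poly_functions L"
| gen: "l \<in> L \<Longrightarrow> l \<in> poly_functions L"
| add: "p \<in> poly_functions L \<Longrightarrow> q \<in> poly_functions L \<Longrightarrow> (\<lambda>x. p x + q x) \<in> poly_functions L"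
| mult: "p \<in> poly_functions L \<Longrightarrow> q \<in> poly_functions L \<Longrightarrow> (\<lambda>x. p x * q x) \<in> poly_functions L"

lemma poly_functions_comp:
  assumes "p \<in> poly_functions L" "\<And>l. l \<in> L \<Longrightarrow> (\<lambda>x. l (s x)) \<in> poly_functions L'"
  shows "(\<lambda>x. p (s x)) \<in> poly_functions L'"
  using assms(1) by induction (auto intro: poly_functions.intros assms(2))

lemma poly_functions_poly:
  assumes "p \<in> poly_functions L"
  shows "(\<lambda>x. poly q (p x)) \<in> poly_functions L"
proof (induction q)
  case (pCons a q)
  then show ?case
    using poly_functions.add[OF poly_functions.const[of a] poly_functions.mult[OF assms pCons.IH]]
    by simp
qed (simp add: poly_functions.const)

lemma poly_functions_sum:
  assumes "finite A" "\<And>a. a \<in> A \<Longrightarrow> p a \<in> poly_functions L"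
  shows "(\<lambda>x. \<Sum>a\<in>A. p a x) \<in> poly_functions L"
  using assms by (induction A) (auto intro: poly_functions.intros)

lemma poly_functions_prod:
  assumes "finite A" "\<And>a. a \<in> A \<Longrightarrow> p a \<in> poly_functions L"
  shows "(\<lambda>x. \<Prod>a\<in>A. p a x) \<in> poly_functions L"
  using assms by (induction A) (auto intro: poly_functions.intros)

lemma poly_functions_power:
  assumes "p \<in> poly_functions L"
  shows "(\<lambda>x. p x ^ k) \<in> poly_functions L"
  by (induction k) (auto intro: poly_functions.intros assms)

text \<open>Along lines this reduces identities between multivariate polynomial functions to the
  finiteness of the root set of a univariate polynomial.\<close>

lemma poly_functions_along_curve:
  assumes "p \<in> poly_functions L" "\<And>l. l \<in> L \<Longrightarrow> \<exists>q. \<forall>t. l (c t) = poly q t"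
  shows "\<exists>q. \<forall>t. p (c t) = poly q t"
  using assms(1)
proof induction
  case (const a)
  show ?case by (rule exI[of _ "[:a:]"]) simp
next
  case (add p q)
  then obtain a b where "\<forall>t. p (c t) = poly a t" "\<forall>t. q (c t) = poly b t" by blast
  then show ?case by (intro exI[of _ "a + b"]) simp
next
  case (mult p q)
  then obtain a b where "\<forall>t. p (c t) = poly a t" "\<forall>t. q (c t) = poly b t" by blast
  then show ?case by (intro exI[of _ "a * b"]) simp
qed (rule assms(2))

text \<open>A polynomial function sees its argument only through the generators. This lets
  coordinates outside \<open>I\<close> be changed freely, and virtual polytopes be exchanged when
  their support numbers agree.\<close>

lemma poly_functions_cong:
  assumes "p \<in> poly_functions L" "\<And>l. l \<in> L \<Longrightarrow> l x = l y"
  shows "p x = p y"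
  using assms(1) by induction (auto simp: assms(2))

definition coords :: "'i set \<Rightarrow> (('i \<Rightarrow> real) \<Rightarrow> real) set" where
  "coords I = (\<lambda>i H. H i) ` I"

lemma poly_functions_coords_line:
  assumes "p \<in> poly_functions (coords I)"
  obtains q where "\<And>t. p (\<lambda>i. a i + t * b i) = poly q t"
proof -
  have "\<exists>q. \<forall>t. p (\<lambda>i. a i + t * b i) = poly q t"
    by (rule poly_functions_along_curve[OF assms])
      (force simp: coords_def intro: exI[of _ "[:a i, b i:]" for i])
  then show ?thesis using that by blast
qed

definition monomial_value :: "'i set \<Rightarrow> ('i \<Rightarrow> 'v \<Rightarrow> real) \<Rightarrow> ('i \<Rightarrow> nat) \<Rightarrow> 'v \<Rightarrow> real" where
  "monomial_value I f m v = (\<Prod>i\<in>I. f i v ^ m i)"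

lemma monomial_combination_add:
  assumes "finite M" "finite N"
  shows "\<exists>K c. finite K \<and> (\<forall>v. (\<Sum>m\<in>M. a m * monomial_value I f m v)
    + (\<Sum>m\<in>N. b m * monomial_value I f m v) = (\<Sum>m\<in>K. c m * monomial_value I f m v))"
proof -
  have 1: "(\<Sum>m\<in>M. a m * monomial_value I f m v)
      = (\<Sum>m\<in>M\<union>N. (if m \<in> M then a m else 0) * monomial_value I f m v)" for v
    using assms by (intro sum.mono_neutral_cong_left) auto
  have 2: "(\<Sum>m\<in>N. b m * monomial_value I f m v)
      = (\<Sum>m\<in>M\<union>N. (if m \<in> N then b m else 0) * monomial_value I f m v)" for v
    using assms by (intro sum.mono_neutral_cong_left) auto
  show ?thesis
    using assms by (intro exI[of _ "M \<union> N"]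
        exI[of _ "\<lambda>m. (if m \<in> M then a m else 0) + (if m \<in> N then b m else 0)"])
      (auto simp: 1 2 sum.distrib distrib_right)
qed

lemma monomial_combination_mult_gen:
  assumes "finite I" "i \<in> I" "finite M"
  shows "\<exists>K c. finite K \<and> (\<forall>v. f i v * (\<Sum>m\<in>M. a m * monomial_value I f m v)
    = (\<Sum>m\<in>K. c m * monomial_value I f m v))"
proof -
  \<comment> \<open>Raising the exponent of \<open>i\<close> by one is injective on exponent
    vectors, so no two monomials of \<open>M\<close> merge and the coefficients are carried over by
    the inverse.\<close>
  define s :: "('a \<Rightarrow> nat) \<Rightarrow> ('a \<Rightarrow> nat)" where "s m = m(i := Suc (m i))" for m
  have inj: "inj s"
    by (rule injI) (metis s_def fun_upd_same fun_upd_triv fun_upd_upd nat.inject)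
  have val: "monomial_value I f (s m) v = f i v * monomial_value I f m v" for m v
  proof -
    have "monomial_value I f (s m) v = f i v ^ Suc (m i) * (\<Prod>j\<in>I - {i}. f j v ^ m j)"
      unfolding monomial_value_def using assms by (subst prod.remove[of I i]) (auto simp: s_def)
    also have "\<dots> = f i v * monomial_value I f m v"
      unfolding monomial_value_def using assms
      by (simp add: prod.remove[of I i "\<lambda>j. f j v ^ m j"])
    finally show ?thesis .
  qed
  have "f i v * (\<Sum>m\<in>M. a m * monomial_value I f m v)
      = (\<Sum>m\<in>s ` M. a (inv_into UNIV s m) * monomial_value I f m v)" for v
    using inj by (subst sum.reindex)
      (auto simp: inj_on_def inj_def val sum_distrib_left inv_f_f algebra_simps)
  then show ?thesis using assms(3) by (intro exI[of _ "s ` M"] exI[of _ "\<lambda>m. a (inv_into UNIV s m)"]) auto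
qed

lemma poly_functions_monomials:
  assumes "p \<in> poly_functions (f ` I)" "finite I"
  shows "\<exists>M a. finite M \<and> (\<forall>v. p v = (\<Sum>m\<in>M. a m * monomial_value I f m v))"
proof -
  define N where "N r \<longleftrightarrow> (\<exists>M a. finite M \<and> (\<forall>v. r v = (\<Sum>m\<in>M. a m * monomial_value I f m v)))"
    for r
  have N_add: "N (\<lambda>v. r v + s v)" if rs: "N r" "N s" for r s
  proof -
    obtain M a where M: "finite M" "\<And>v. r v = (\<Sum>m\<in>M. a m * monomial_value I f m v)"
      using rs unfolding N_def by metis
    obtain K b where K: "finite K" "\<And>v. s v = (\<Sum>m\<in>K. b m * monomial_value I f m v)"
      using rs unfolding N_def by metis
    show ?thesis unfolding N_def M K by (rule monomial_combination_add[OF M(1) K(1)])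
  qed
  have N_gen: "N (\<lambda>v. f i v * r v)" if rs: "N r" "i \<in> I" for r i
  proof -
    obtain M a where M: "finite M" "\<And>v. r v = (\<Sum>m\<in>M. a m * monomial_value I f m v)"
      using rs unfolding N_def by metis
    show ?thesis unfolding N_def M by (rule monomial_combination_mult_gen[OF assms(2) rs(2) M(1)])
  qed
  have N_const: "N (\<lambda>v. c * r v)" if rs: "N r" for c r
  proof -
    obtain M a where M: "finite M" "\<And>v. r v = (\<Sum>m\<in>M. a m * monomial_value I f m v)"
      using rs unfolding N_def by metis
    show ?thesis unfolding N_def M
      using M(1) by (intro exI[of _ M] exI[of _ "\<lambda>m. c * a m"]) (auto simp: sum_distrib_left algebra_simps)
  qed
  \<comment> \<open>Strengthened to multiplication by \<open>p\<close>, so that the product case is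
    a composition of the two induction hypotheses; \<open>p\<close> itself is recovered by
    multiplying the constant 1.\<close>
  have N_mult: "N (\<lambda>v. p v * r v)" if "N r" for r
    using assms(1) that
  proof (induction arbitrary: r)
    case (add p q)
    then show ?case unfolding distrib_right by (intro N_add)
  next
    case (mult p q)
    then show ?case by (simp add: mult.assoc)
  qed (auto intro: N_const N_gen)
  have "N (\<lambda>v. 1)"
    unfolding N_def
    by (rule exI[of _ "{\<lambda>_. 0}"], rule exI[of _ "\<lambda>_. 1"]) (simp add: monomial_value_def)
  from N_mult[OF this] show ?thesis unfolding N_def by simp
qed

subsection \<open>Finite differences in one variable\<close>

definition seq_diff :: "(nat \<Rightarrow> real) \<Rightarrow> nat \<Rightarrow> real" where
  "seq_diff b m = b (Suc m) - b m"

text \<open>Vanishing \<open>k\<close>-th differences are a recurrence of order \<open>k\<close>, so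
  the first \<open>k\<close> values determine the sequence. The induction passes to the first
  difference, whose range is shorter by one.\<close>

lemma seq_diff_power_eq_zero:
  assumes "\<And>m. m + k \<le> N \<Longrightarrow> (seq_diff ^^ k) b m = 0" "\<And>j. j < k \<Longrightarrow> b j = 0" "m \<le> N"
  shows "b m = 0"
  using assms
proof (induction k arbitrary: b N m)
  case (Suc k)
  have *: "seq_diff b n = 0" if n: "n < N" for n
  proof (rule Suc.IH[where N = "N - 1"])
    show "(seq_diff ^^ k) (seq_diff b) m = 0" if "m + k \<le> N - 1" for m
      using Suc.prems(1)[of m] that n by (simp add: funpow_swap1)
    show "seq_diff b j = 0" if "j < k" for j
      using Suc.prems(2)[of j] Suc.prems(2)[of "Suc j"] that by (simp add: seq_diff_def)
  qed (use n in auto)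
  have "b m = 0" if "m \<le> N" for m
    using that
  proof (induction m)
    case (Suc m)
    then show ?case using *[of m] by (simp add: seq_diff_def)
  qed (simp add: Suc.prems(2))
  then show ?case using Suc.prems(3) .
qed simp

lemma seq_diff_power_minus:
  "(seq_diff ^^ k) (\<lambda>m. a m - b m) m = (seq_diff ^^ k) a m - (seq_diff ^^ k) b m"
  by (induction k arbitrary: m) (auto simp: seq_diff_def)

text \<open>Shifting the argument preserves the leading coefficient, so each difference lowers the
  degree.\<close>

lemma seq_diff_poly:
  fixes q :: "real poly"
  assumes "degree q < k \<or> q = 0"
  shows "(seq_diff ^^ k) (\<lambda>m. poly q (x + real m * s)) m = 0"
  using assms
proof (induction k arbitrary: q m)
  case (Suc k)
  define r where "r = pcompose q [:s, 1:] - q"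
  have "degree r < k \<or> r = 0"
  proof (cases "degree q = 0")
    case True
    then show ?thesis by (auto simp: r_def elim!: degree_eq_zeroE simp: pcompose_pCons)
  next
    case False
    have deg: "degree (pcompose q [:s, 1:]) = degree q"
      by (simp add: degree_pcompose)
    have "lead_coeff (pcompose q [:s, 1:]) = lead_coeff q"
      by (subst lead_coeff_comp) auto
    then have "coeff r (degree q) = 0"
      by (simp add: r_def deg)
    moreover have "degree r \<le> degree q"
      using degree_diff_le_max[of "pcompose q [:s, 1:]" q] by (simp add: r_def deg)
    ultimately have "degree r < degree q \<or> r = 0"
      using False leading_coeff_0_iff le_neq_implies_less by metis
    then show ?thesis using Suc.prems by auto
  qed
  moreover have "seq_diff (\<lambda>m. poly q (x + real m * s)) = (\<lambda>m. poly r (x + real m * s))"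
    by (auto simp: fun_eq_iff seq_diff_def r_def poly_pcompose algebra_simps)
  ultimately show ?case
    using Suc.IH[of r m] by (simp add: funpow_swap1)
qed auto

lemma poly_interpolation:
  fixes y :: "nat \<Rightarrow> real"
  assumes "inj_on x {..<k}"
  shows "\<exists>q :: real poly. (degree q < k \<or> q = 0) \<and> (\<forall>j<k. poly q (x j) = y j)"
  using assms
proof (induction k)
  case (Suc k)
  have inj: "inj_on x {..<k}" using Suc.prems by (auto simp: inj_on_def)
  obtain q where q: "degree q < k \<or> q = 0" "\<And>j. j < k \<Longrightarrow> poly q (x j) = y j"
    using Suc.IH[OF inj] by blast
  define r where "r = (\<Prod>j<k. [:- x j, 1:])"
  have dr: "degree r = k" unfolding r_def
    by (subst degree_prod_eq_sum_degree) auto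
  have r0: "poly r (x j) = 0" if "j < k" for j
    unfolding r_def poly_prod using that by (auto intro!: prod_zero)
  have rk: "poly r (x k) \<noteq> 0"
  proof -
    have "x k \<noteq> x j" if "j < k" for j
      using inj_onD[OF Suc.prems, of k j] that by auto
    then show ?thesis by (auto simp: r_def poly_prod)
  qed
  define p where "p = q + smult ((y k - poly q (x k)) / poly r (x k)) r"
  have "degree p \<le> k"
    unfolding p_def using q(1) dr by (auto intro!: degree_add_le)
  moreover have "poly p (x j) = y j" if "j < Suc k" for j
    using that q(2)[of j] r0[of j] rk by (cases "j = k") (auto simp: p_def)
  ultimately show ?case by (intro exI[of _ p]) auto
qed auto

lemma poly_eqI_nodes:
  fixes p q :: "real poly"
  assumes "degree p < k \<or> p = 0" "degree q < k \<or> q = 0" "inj_on x {..<k}"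
    "\<And>j. j < k \<Longrightarrow> poly p (x j) = poly q (x j)"
  shows "p = q"
proof (rule ccontr)
  assume "p \<noteq> q"
  then have nz: "p - q \<noteq> 0" by simp
  have "x ` {..<k} \<subseteq> {t. poly (p - q) t = 0}" using assms(4) by auto
  then have "card (x ` {..<k}) \<le> card {t. poly (p - q) t = 0}"
    by (rule card_mono[OF poly_roots_finite[OF nz]])
  also have "\<dots> \<le> degree (p - q)" by (rule card_poly_roots_bound[OF nz])
  finally have "k \<le> degree (p - q)" using assms(3) by (simp add: card_image)
  moreover have "k > 0" using nz assms(1,2) by auto
  then have "degree (p - q) < k"
    using assms(1,2) by (intro degree_diff_less) auto
  ultimately show False by simp
qed

lemma poly_eqI_infinite:
  fixes p q :: "real poly"
  assumes "infinite A" "\<And>t. t \<in> A \<Longrightarrow> poly p t = poly q t"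
  shows "p = q"
proof (rule ccontr)
  assume "p \<noteq> q"
  then have "finite {t. poly (p - q) t = 0}" by (intro poly_roots_finite) simp
  moreover have "A \<subseteq> {t. poly (p - q) t = 0}" using assms(2) by auto
  ultimately show False using assms(1) finite_subset by blast
qed

text \<open>A monotone solution of Frechet's equation is a polynomial: interpolation on ever finer grids
  yields one and the same polynomial, and monotonicity then bridges the gaps of the grids.\<close>

lemma monotone_differences_imp_poly_unit:
  assumes mono: "\<And>x y. 0 \<le> x \<Longrightarrow> x \<le> y \<Longrightarrow> y \<le> 1 \<Longrightarrow> h x \<le> (h y :: real)"
    and diff: "\<And>N m. N0 \<le> N \<Longrightarrow> m + k \<le> N \<Longrightarrow> (seq_diff ^^ k) (\<lambda>j. h (real j / real N)) m = 0"
  shows "\<exists>q :: real poly. (degree q < k \<or> q = 0) \<and> (\<forall>x. 0 \<le> x \<and> x \<le> 1 \<longrightarrow> h x = poly q x)"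
proof -
  have grid: "\<exists>q :: real poly. (degree q < k \<or> q = 0) \<and> (\<forall>j\<le>N. h (real j / real N) = poly q (real j / real N))"
    if N: "N \<ge> N0" "N > 0" for N
  proof -
    have "inj_on (\<lambda>j. real j / real N) {..<k}" using N by (auto simp: inj_on_def)
    then obtain q :: "real poly" where q: "degree q < k \<or> q = 0"
        "\<And>j. j < k \<Longrightarrow> poly q (real j / real N) = h (real j / real N)"
      using poly_interpolation[of "\<lambda>j. real j / real N" k "\<lambda>j. h (real j / real N)"] by blast
    have q0: "(seq_diff ^^ k) (\<lambda>j. poly q (real j / real N)) m = 0" for m
      using seq_diff_poly[OF q(1), of 0 "1 / real N" m] by simp
    have "h (real j / real N) - poly q (real j / real N) = 0" if "j \<le> N" for j
      by (rule seq_diff_power_eq_zero[where N = N and k = k])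
        (use that q(2) diff[OF N(1)] q0 in \<open>auto simp: seq_diff_power_minus\<close>)
    then show ?thesis using q(1) by auto
  qed
  \<comment> \<open>More than \<open>k\<close> grid points, so that a polynomial of degree below
    \<open>k\<close> is determined by its values on this coarse grid.\<close>
  define N where "N = N0 + k + 1"
  obtain q :: "real poly" where q: "degree q < k \<or> q = 0"
      "\<And>j. j \<le> N \<Longrightarrow> h (real j / real N) = poly q (real j / real N)"
    using grid[of N] by (auto simp: N_def)
  \<comment> \<open>A grid refined by an integer factor contains the coarse grid, so its
    interpolating polynomial agrees with \<open>q\<close> at \<open>k\<close> points and is equal to
    \<open>q\<close>.\<close>
  have fine: "h (real j / real (N * M)) = poly q (real j / real (N * M))" if M: "M > 0" "j \<le> N * M" for j M
  proof -
    have "N0 \<le> N * 1" "0 < N" by (auto simp: N_def)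
    moreover have "N * 1 \<le> N * M" using that by (intro mult_le_mono2) auto
    ultimately have "N0 \<le> N * M" "0 < N" by linarith+
    then obtain r :: "real poly" where r: "degree r < k \<or> r = 0"
        "\<And>j. j \<le> N * M \<Longrightarrow> h (real j / real (N * M)) = poly r (real j / real (N * M))"
      using grid[of "N * M"] M(1) by (metis nat_0_less_mult_iff)
    have "r = q"
    proof (rule poly_eqI_nodes[OF r(1) q(1), where x = "\<lambda>j. real j / real N"])
      show "inj_on (\<lambda>j. real j / real N) {..<k}" by (auto simp: inj_on_def N_def)
      fix i assume "i < k"
      then have i: "i \<le> N" by (simp add: N_def)
      have e: "real (i * M) / real (N * M) = real i / real N" using that by simp
      show "poly r (real i / real N) = poly q (real i / real N)"
        using r(2)[of "i * M"] q(2)[of i] i unfolding e by simp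
    qed
    then show ?thesis using r(2) that by auto
  qed
  have "h x = poly q x" if x: "0 \<le> x" "x \<le> 1" for x
  proof (cases "x = 0 \<or> x = 1")
    case True
    then show ?thesis using q(2)[of 0] q(2)[of N] by (auto simp: N_def)
  next
    case False
    \<comment> \<open>Grid points on either side of \<open>x\<close>, the upper one cut off at 1 to
      stay in the interval. Both tend to \<open>x\<close> under refinement, and \<open>h x\<close>
      is squeezed between the values of \<open>q\<close> there.\<close>
    define lo where "lo M = real (nat \<lfloor>x * real (N * Suc M)\<rfloor>) / real (N * Suc M)" for M
    define up where "up M = min 1 (real (Suc (nat \<lfloor>x * real (N * Suc M)\<rfloor>)) / real (N * Suc M))" for M
    have pos: "real (N * Suc M) > 0" for M
      by (simp only: of_nat_0_less_iff) (simp add: N_def)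
    have fl: "real (nat \<lfloor>x * real (N * Suc M)\<rfloor>) \<le> x * real (N * Suc M)"
      "x * real (N * Suc M) \<le> real (Suc (nat \<lfloor>x * real (N * Suc M)\<rfloor>))" for M
      using x by (simp_all add: of_nat_nat) linarith+
    have lo: "lo M \<le> x" "x - 1 / real (Suc M) \<le> lo M" "0 \<le> lo M" "h (lo M) = poly q (lo M)" for M
    proof -
      show "lo M \<le> x" unfolding lo_def using fl(1)[of M] pos[of M] by (simp only: divide_le_eq if_True)
      have "x \<le> real (Suc (nat \<lfloor>x * real (N * Suc M)\<rfloor>)) / real (N * Suc M)"
        using fl(2)[of M] pos[of M] by (simp only: le_divide_eq if_True)
      also have "\<dots> = lo M + 1 / real (N * Suc M)" unfolding lo_def by (simp add: add_divide_distrib)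
      also have "1 / real (N * Suc M) \<le> 1 / real (Suc M)"
        by (intro frac_le) (auto simp del: of_nat_mult of_nat_Suc simp: N_def)
      finally show "x - 1 / real (Suc M) \<le> lo M" by simp
      show "0 \<le> lo M" by (simp add: lo_def)
      have "real (nat \<lfloor>x * real (N * Suc M)\<rfloor>) \<le> 1 * real (N * Suc M)"
        using fl(1)[of M] mult_right_mono[OF x(2), of "real (N * Suc M)"] by linarith
      then have "nat \<lfloor>x * real (N * Suc M)\<rfloor> \<le> N * Suc M"
        by (simp only: mult_1 of_nat_le_iff)
      then show "h (lo M) = poly q (lo M)" unfolding lo_def by (intro fine) auto
    qed
    have up: "x \<le> up M" "up M \<le> x + 1 / real (Suc M)" "up M \<le> 1" "h (up M) = poly q (up M)" for M
    proof -
      have "x \<le> real (Suc (nat \<lfloor>x * real (N * Suc M)\<rfloor>)) / real (N * Suc M)"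
        using fl(2)[of M] pos[of M] by (simp only: le_divide_eq if_True)
      then show "x \<le> up M" unfolding up_def using x by simp
      have "up M \<le> lo M + 1 / real (N * Suc M)"
        unfolding lo_def up_def by (simp add: add_divide_distrib)
      also have "1 / real (N * Suc M) \<le> 1 / real (Suc M)"
        by (intro frac_le) (auto simp del: of_nat_mult of_nat_Suc simp: N_def)
      finally show "up M \<le> x + 1 / real (Suc M)" using lo(1)[of M] by simp
      show "up M \<le> 1" by (simp add: up_def)
      show "h (up M) = poly q (up M)"
      proof (cases "Suc (nat \<lfloor>x * real (N * Suc M)\<rfloor>) \<le> N * Suc M")
        case True
        then have "real (Suc (nat \<lfloor>x * real (N * Suc M)\<rfloor>)) \<le> real (N * Suc M)"
          by (simp only: of_nat_le_iff)
        then have "up M = real (Suc (nat \<lfloor>x * real (N * Suc M)\<rfloor>)) / real (N * Suc M)"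
          unfolding up_def using pos[of M] by (simp only: min_def) (auto simp: divide_simps)
        then show ?thesis using fine[OF _ True] by simp
      next
        case False
        then have "real (N * Suc M) \<le> real (Suc (nat \<lfloor>x * real (N * Suc M)\<rfloor>))"
          by (simp only: of_nat_le_iff)
        then have "1 \<le> real (Suc (nat \<lfloor>x * real (N * Suc M)\<rfloor>)) / real (N * Suc M)"
          using pos[of M] by (simp only: le_divide_eq if_True mult_1)
        then have "up M = 1" unfolding up_def by (rule min_absorb1)
        then show ?thesis using q(2)[of N] by (auto simp: N_def)
      qed
    qed
    have inv: "(\<lambda>M. 1 / real (Suc M)) \<longlonglongrightarrow> 0"
      using LIMSEQ_inverse_real_of_nat by (simp add: inverse_eq_divide)
    have "lo \<longlonglongrightarrow> x"
    proof (rule tendsto_sandwich[OF _ _ _ tendsto_const])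
      show "(\<lambda>M. x - 1 / real (Suc M)) \<longlonglongrightarrow> x" using tendsto_diff[OF tendsto_const inv, of x] by simp
    qed (use lo in auto)
    then have l: "(\<lambda>M. poly q (lo M)) \<longlonglongrightarrow> poly q x" by (intro tendsto_intros)
    have "up \<longlonglongrightarrow> x"
    proof (rule tendsto_sandwich[OF _ _ tendsto_const])
      show "(\<lambda>M. x + 1 / real (Suc M)) \<longlonglongrightarrow> x" using tendsto_add[OF tendsto_const inv, of x] by simp
    qed (use up in auto)
    then have u: "(\<lambda>M. poly q (up M)) \<longlonglongrightarrow> poly q x" by (intro tendsto_intros)
    have "poly q (lo M) \<le> h x" for M using mono[of "lo M" x] lo[of M] x by simp
    then have "poly q x \<le> h x" by (intro LIMSEQ_le_const2[OF l]) auto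
    moreover have "h x \<le> poly q (up M)" for M using mono[of x "up M"] up[of M] x by simp
    then have "h x \<le> poly q x" by (intro LIMSEQ_le_const[OF u]) auto
    ultimately show ?thesis by simp
  qed
  then show ?thesis using q(1) by blast
qed

text \<open>The case of the unit interval, rescaled. Only steps below \<open>e\<close> are
  controlled, and \<open>N0\<close> is the number of subdivisions from which on the spacing is that
  small.\<close>

lemma monotone_differences_imp_poly:
  fixes h :: "real \<Rightarrow> real"
  assumes ab: "a < b" and mono: "\<And>x y. a \<le> x \<Longrightarrow> x \<le> y \<Longrightarrow> y \<le> b \<Longrightarrow> h x \<le> h y"
    and e: "0 < e"
    and diff: "\<And>x s. a \<le> x \<Longrightarrow> x \<le> b \<Longrightarrow> 0 < s \<Longrightarrow> s < e \<Longrightarrow> (seq_diff ^^ k) (\<lambda>j. h (x + real j * s)) 0 = 0"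
  shows "\<exists>q :: real poly. (degree q < k \<or> q = 0) \<and> (\<forall>x. a \<le> x \<and> x \<le> b \<longrightarrow> h x = poly q x)"
proof -
  define g where "g t = h (a + t * (b - a))" for t
  obtain N0 where N0: "(b - a) / e < real N0" using reals_Archimedean2 by blast
  have shift: "(seq_diff ^^ k) c m = (seq_diff ^^ k) (\<lambda>j. c (j + m)) 0" for c m
  proof (induction k arbitrary: c)
    case (Suc k)
    have "(seq_diff ^^ Suc k) c m = (seq_diff ^^ k) (seq_diff c) m" by (simp add: funpow_swap1)
    also have "\<dots> = (seq_diff ^^ k) (\<lambda>j. seq_diff c (j + m)) 0" by (rule Suc)
    also have "(\<lambda>j. seq_diff c (j + m)) = seq_diff (\<lambda>j. c (j + m))" by (auto simp: seq_diff_def)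
    finally show ?case by (simp add: funpow_swap1)
  qed simp
  have "\<exists>q :: real poly. (degree q < k \<or> q = 0) \<and> (\<forall>x. 0 \<le> x \<and> x \<le> 1 \<longrightarrow> g x = poly q x)"
  proof (rule monotone_differences_imp_poly_unit[where ?N0.0 = "max N0 1"])
    fix x y :: real assume "0 \<le> x" "x \<le> y" "y \<le> 1"
    have "y * (b - a) \<le> 1 * (b - a)" using \<open>y \<le> 1\<close> ab by (intro mult_right_mono) auto
    then have "a + y * (b - a) \<le> b" by simp
    with \<open>0 \<le> x\<close> \<open>x \<le> y\<close> show "g x \<le> g y"
      unfolding g_def using ab by (intro mono) (auto intro!: mult_right_mono)
  next
    fix N m :: nat assume N: "max N0 1 \<le> N" "m + k \<le> N"
    define s where "s = (b - a) / real N"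
    have N': "real N > 0" "real N0 \<le> real N" using N by auto
    have s: "0 < s" "s < e"
    proof -
      show "0 < s" using ab N' by (simp add: s_def)
      have "(b - a) / e < real N" using N0 N' by linarith
      then show "s < e" using e N' by (simp add: s_def field_simps)
    qed
    have gs: "g (real j / real N) = h (a + real j * s)" for j
      by (simp add: g_def s_def)
    have "real m * s \<le> real N * s" using N s by (intro mult_right_mono) auto
    also have "\<dots> = b - a" using N' by (simp add: s_def)
    finally have m: "a + real m * s \<le> b" by simp
    have "(seq_diff ^^ k) (\<lambda>j. h (a + real m * s + real j * s)) 0 = 0"
      using s ab m by (intro diff) auto
    then show "(seq_diff ^^ k) (\<lambda>j. g (real j / real N)) m = 0"
      unfolding gs by (subst shift) (simp add: algebra_simps)
  qed
  then obtain q :: "real poly" where q: "degree q < k \<or> q = 0"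
    "\<And>x. 0 \<le> x \<Longrightarrow> x \<le> 1 \<Longrightarrow> g x = poly q x" by blast
  define r where "r = pcompose q [:- a / (b - a), 1 / (b - a):]"
  have "degree r < k \<or> r = 0"
    using q(1) ab by (auto simp: r_def degree_pcompose)
  moreover have "h x = poly r x" if "a \<le> x" "x \<le> b" for x
  proof -
    have "g ((x - a) / (b - a)) = poly q ((x - a) / (b - a))" using that ab by (intro q(2)) auto
    moreover have "g ((x - a) / (b - a)) = h x" using ab by (simp add: g_def)
    moreover have "poly r x = poly q ((x - a) / (b - a))"
      by (simp add: r_def poly_pcompose diff_divide_distrib)
    ultimately show ?thesis by simp
  qed
  ultimately show ?thesis by blast
qed

lemma separately_poly_imp_poly:
  fixes G :: "('i \<Rightarrow> real) \<Rightarrow> real"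
  assumes "finite J" "J \<subseteq> I" "0 < r"
    and sep: "\<And>H i. i \<in> I \<Longrightarrow> (\<And>j. j \<in> I \<Longrightarrow> \<bar>H j - H0 j\<bar> \<le> r) \<Longrightarrow>
      \<exists>q :: real poly. (degree q < k \<or> q = 0) \<and> (\<forall>x. \<bar>x - H0 i\<bar> \<le> r \<longrightarrow> G (H(i := x)) = poly q x)"
    and H1: "\<And>j. j \<in> I \<Longrightarrow> \<bar>H1 j - H0 j\<bar> \<le> r"
  shows "\<exists>p\<in>poly_functions (coords J).
    \<forall>H. (\<forall>j\<in>I. \<bar>H j - H0 j\<bar> \<le> r) \<and> (\<forall>j. j \<notin> J \<longrightarrow> H j = H1 j) \<longrightarrow> G H = p H"
  using assms(1,2) H1
proof (induction J arbitrary: H1 rule: finite_induct)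
  case empty
  have "H = H1" if "\<forall>j. H j = H1 j" for H using that by auto
  then show ?case by (intro bexI[of _ "\<lambda>_. G H1"]) (auto intro: poly_functions.const)
next
  case (insert i J)
  then have i: "i \<in> I" by auto
  \<comment> \<open>Distinct nodes within distance \<open>r\<close> of \<open>H0 i\<close>.\<close>
  define y where "y m = H0 i + r * real m / real (Suc k)" for m
  have inj: "inj_on y {..<k}" using \<open>0 < r\<close> by (auto simp: inj_on_def y_def)
  have y: "\<bar>y m - H0 i\<bar> \<le> r" if "m < k" for m
  proof -
    have "r * real m \<le> r * real (Suc k)" using that \<open>0 < r\<close> by (intro mult_left_mono) auto
    then show ?thesis using \<open>0 < r\<close> by (simp add: y_def divide_le_eq)
  qed
  have "\<exists>l :: real poly. (degree l < k \<or> l = 0) \<and> (\<forall>n<k. poly l (y n) = (if n = m then 1 else 0))" for m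
    by (rule poly_interpolation[OF inj])
  then obtain l :: "nat \<Rightarrow> real poly" where l: "\<And>m. degree (l m) < k \<or> l m = 0"
      "\<And>m n. n < k \<Longrightarrow> poly (l m) (y n) = (if n = m then 1 else 0)" by metis
  have "\<exists>p\<in>poly_functions (coords J). \<forall>H. (\<forall>j\<in>I. \<bar>H j - H0 j\<bar> \<le> r) \<and>
      (\<forall>j. j \<notin> J \<longrightarrow> H j = (H1(i := y m)) j) \<longrightarrow> G H = p H" if "m < k" for m
    using insert.prems y[OF that] by (intro insert.IH[of "H1(i := y m)"]) auto
  then obtain p where p: "\<And>m. m < k \<Longrightarrow> p m \<in> poly_functions (coords J)"
    "\<And>m H. m < k \<Longrightarrow> (\<forall>j\<in>I. \<bar>H j - H0 j\<bar> \<le> r) \<Longrightarrow> (\<And>j. j \<notin> J \<Longrightarrow> H j = (H1(i := y m)) j) \<Longrightarrow> G H = p m H"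
    by metis
  \<comment> \<open>Lagrange's interpolation formula in the variable \<open>i\<close>.\<close>
  define P where "P H = (\<Sum>m<k. poly (l m) (H i) * p m (H(i := y m)))" for H
  have "P \<in> poly_functions (coords (insert i J))"
    unfolding P_def
  proof (intro poly_functions_sum poly_functions.mult)
    fix m assume m: "m \<in> {..<k}"
    show "(\<lambda>H. poly (l m) (H i)) \<in> poly_functions (coords (insert i J))"
      by (intro poly_functions_poly poly_functions.gen) (auto simp: coords_def)
    show "(\<lambda>H. p m (H(i := y m))) \<in> poly_functions (coords (insert i J))"
    proof (rule poly_functions_comp[where L = "coords J" and s = "\<lambda>H. H(i := y m)"])
      show "p m \<in> poly_functions (coords J)" using p m by auto
      fix l assume "l \<in> coords J"
      then obtain j where j: "j \<in> J" "l = (\<lambda>H. H j)" by (auto simp: coords_def)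
      then have "j \<noteq> i" using insert.hyps by auto
      then show "(\<lambda>H. l (H(i := y m))) \<in> poly_functions (coords (insert i J))"
        using j by (auto simp: coords_def intro!: poly_functions.gen)
    qed
  qed simp
  moreover have "G H = P H"
    if H: "\<forall>j\<in>I. \<bar>H j - H0 j\<bar> \<le> r" "\<forall>j. j \<notin> insert i J \<longrightarrow> H j = H1 j" for H
  proof -
    obtain q :: "real poly" where q: "degree q < k \<or> q = 0"
        "\<And>x. \<bar>x - H0 i\<bar> \<le> r \<Longrightarrow> G (H(i := x)) = poly q x"
      using sep[OF i, of H] H(1) by blast
    define q' where "q' = (\<Sum>m<k. smult (poly q (y m)) (l m))"
    have "q = q'"
    proof (rule poly_eqI_nodes[OF q(1) _ inj])
      show "degree q' < k \<or> q' = 0"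
      proof (cases "k = 0")
        case False
        have "degree (smult (poly q (y m)) (l m)) < k" for m
          using l(1)[of m] False degree_smult_le[of "poly q (y m)" "l m"] by auto
        then show ?thesis unfolding q'_def using False by (intro disjI1 degree_sum_less) auto
      qed (simp add: q'_def)
      show "poly q (y j) = poly q' (y j)" if "j < k" for j
        using that by (simp add: q'_def poly_sum l(2) if_distrib[of "\<lambda>x. _ * x"] sum.delta cong: if_cong)
    qed
    have "G H = poly q (H i)" using q(2)[of "H i"] H(1) i by simp
    also have "\<dots> = poly q' (H i)" using \<open>q = q'\<close> by simp
    also have "\<dots> = P H"
      unfolding q'_def P_def poly_sum
    proof (rule sum.cong)
      fix m assume "m \<in> {..<k}"
      then have m: "m < k" by simp
      have "poly q (y m) = G (H(i := y m))" using q(2)[OF y[OF m]] by simp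
      also have "\<dots> = p m (H(i := y m))" using H y[OF m] by (intro p(2)[OF m]) auto
      finally show "poly (smult (poly q (y m)) (l m)) (H i) = poly (l m) (H i) * p m (H(i := y m))" by simp
    qed simp
    finally show ?thesis .
  qed
  ultimately show ?case by blast
qed

subsection \<open>Finite differences in several variables\<close>

definition fin_diff :: "'i \<Rightarrow> real \<Rightarrow> (('i \<Rightarrow> real) \<Rightarrow> real) \<Rightarrow> ('i \<Rightarrow> real) \<Rightarrow> real" where
  "fin_diff i s G H = G (H(i := H i + s)) - G H"

definition fin_diffs :: "('i \<times> real) list \<Rightarrow> (('i \<Rightarrow> real) \<Rightarrow> real) \<Rightarrow> ('i \<Rightarrow> real) \<Rightarrow> real" where
  "fin_diffs l G = foldr (\<lambda>(i, s). fin_diff i s) l G"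

lemma fin_diffs_Nil [simp]: "fin_diffs [] G = G"
  and fin_diffs_Cons [simp]: "fin_diffs ((i, s) # l) G = fin_diff i s (fin_diffs l G)"
  by (auto simp: fin_diffs_def)

lemma fin_diff_commute: "fin_diff i s (fin_diff j t G) = fin_diff j t (fin_diff i s G)"
  by (cases "i = j") (auto simp: fin_diff_def fun_eq_iff fun_upd_twist algebra_simps)

lemma fin_diffs_remove1: "x \<in> set l \<Longrightarrow> fin_diffs l G = fin_diffs (x # remove1 x l) G"
proof (induction l)
  case (Cons y l)
  show ?case
  proof (cases "x = y")
    case False
    then have "fin_diffs l G = fin_diffs (x # remove1 x l) G" using Cons by auto
    then show ?thesis using False
      by (cases x; cases y) (auto simp: fin_diff_commute)
  qed auto
qed auto

lemma fin_diffs_perm: "mset l = mset l' \<Longrightarrow> fin_diffs l G = fin_diffs l' G"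
proof (induction l arbitrary: l')
  case (Cons x l)
  then have "x \<in> set l'" by (metis list.set_intros(1) mset_eq_setD)
  then have "fin_diffs l' G = fin_diffs (x # remove1 x l') G" by (rule fin_diffs_remove1)
  moreover have "mset l = mset (remove1 x l')" using Cons.prems by (metis mset.simps(2) mset_remove1 add_mset_remove_trivial)
  then have "fin_diffs l G = fin_diffs (remove1 x l') G" by (rule Cons.IH)
  ultimately show ?case by (cases x) auto
qed auto

text \<open>Repeating one direction gives the differences of a sequence, which links mixed
  differences to Frechet's equation in one variable.\<close>

lemma fin_diffs_replicate:
  "fin_diffs (replicate k (i, s)) G (H(i := x)) = (seq_diff ^^ k) (\<lambda>j. G (H(i := x + real j * s))) 0"
proof -
  have "fin_diffs (replicate k (i, s)) G (H(i := x + real m * s)) = (seq_diff ^^ k) (\<lambda>j. G (H(i := x + real j * s))) m" for m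
  proof (induction k arbitrary: m)
    case (Suc k)
    have "(H(i := x + real m * s))(i := (H(i := x + real m * s)) i + s) = H(i := x + real (Suc m) * s)"
      by (simp add: algebra_simps)
    then show ?case using Suc[of m] Suc[of "Suc m"]
      by (simp only: replicate_Suc fin_diffs_Cons fin_diff_def funpow.simps o_apply seq_diff_def)
  qed simp
  from this[of 0] show ?thesis by simp
qed

text \<open>The indicator of an orthant is a product over the coordinates. As the directions are
  distinct, each difference acts on its own factor and leaves the others as they are.\<close>

lemma fin_diffs_indicator:
  assumes "distinct (map fst l)"
  shows "fin_diffs l (\<lambda>H. of_bool (\<forall>i\<in>I. y i \<le> H i)) H =
    (\<Prod>(i, s)\<leftarrow>l. if i \<in> I then of_bool (y i \<le> H i + s) - of_bool (y i \<le> H i) else 0)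
      * of_bool (\<forall>i\<in>I - fst ` set l. y i \<le> H i)"
  using assms
proof (induction l arbitrary: H)
  case (Cons a l)
  obtain i s where a: "a = (i, s)" by (cases a)
  have il: "i \<notin> fst ` set l" using Cons.prems by (auto simp: a)
  define c where "c = (\<Prod>(i, s)\<leftarrow>l. if i \<in> I then of_bool (y i \<le> H i + s) - of_bool (y i \<le> H i) else (0::real))"
  have upd: "(\<Prod>(j, t)\<leftarrow>l. if j \<in> I then of_bool (y j \<le> (H(i := z)) j + t) - of_bool (y j \<le> (H(i := z)) j) else (0::real)) = c" for z
    unfolding c_def using il by (intro arg_cong[of _ _ prod_list] map_cong) (auto simp: image_iff)
  have rest: "(\<forall>j\<in>I - fst ` set l. y j \<le> (H(i := z)) j)
     \<longleftrightarrow> (i \<in> I \<longrightarrow> y i \<le> z) \<and> (\<forall>j\<in>I - insert i (fst ` set l). y j \<le> H j)" for z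
    using il by auto
  define B where "B \<longleftrightarrow> (\<forall>j\<in>I - insert i (fst ` set l). y j \<le> H j)"
  have d: "distinct (map fst l)" using Cons.prems by simp
  have IH: "fin_diffs l (\<lambda>H. of_bool (\<forall>i\<in>I. y i \<le> H i)) (H(i := z)) =
      c * of_bool ((i \<in> I \<longrightarrow> y i \<le> z) \<and> B)" for z
    using Cons.IH[OF d, of "H(i := z)"] unfolding upd rest B_def .
  have "fin_diffs (a # l) (\<lambda>H. of_bool (\<forall>i\<in>I. y i \<le> H i)) H =
      c * of_bool ((i \<in> I \<longrightarrow> y i \<le> H i + s) \<and> B) - c * of_bool ((i \<in> I \<longrightarrow> y i \<le> H i) \<and> B)"
    unfolding a fin_diffs_Cons fin_diff_def IH[symmetric] by simp
  also have "\<dots> = (if i \<in> I then of_bool (y i \<le> H i + s) - of_bool (y i \<le> H i) else 0) * c * of_bool B"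
    by (cases B) (simp_all add: algebra_simps)
  also have "(if i \<in> I then of_bool (y i \<le> H i + s) - of_bool (y i \<le> H i) else 0) * c =
      (\<Prod>(i, s)\<leftarrow>a # l. if i \<in> I then of_bool (y i \<le> H i + s) - of_bool (y i \<le> H i) else (0::real))"
    by (simp only: a c_def list.map prod_list.Cons prod.case)
  also have "B \<longleftrightarrow> (\<forall>i\<in>I - fst ` set (a # l). y i \<le> H i)"
    by (simp only: B_def a list.set image_insert fst_conv)
  finally show ?case .
qed simp

subsection \<open>Complete simplicial fans and their polytopes\<close>

text \<open>A cone is encoded by the set of indices of its rays; \<open>solvable\<close> expresses that the rays of a
  cone are linearly independent.\<close>

locale simplicial_complete_fan =
  fixes I :: "'i set" and u :: "'i \<Rightarrow> 'a::euclidean_space" and S :: "'i set set"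
  assumes finite_I: "finite I"
    and cone_subset: "r \<in> S \<Longrightarrow> r \<subseteq> I"
    and down: "r \<in> S \<Longrightarrow> q \<subseteq> r \<Longrightarrow> q \<in> S"
    and solvable: "r \<in> S \<Longrightarrow> \<exists>w. \<forall>i\<in>r. u i \<bullet> w = f i"
    and complete: "\<exists>r\<in>S. \<exists>k. (\<forall>i\<in>r. 0 < k i) \<and> c = (\<Sum>i\<in>r. k i *\<^sub>R u i)"
    and ray: "i \<in> I \<Longrightarrow> {i} \<in> S"
begin

section \<open>Support numbers and the type cone\<close>

definition hpoly :: "('i \<Rightarrow> real) \<Rightarrow> 'a set" where
  "hpoly H = {x. \<forall>i\<in>I. u i \<bullet> x \<le> H i}"

definition active :: "('i \<Rightarrow> real) \<Rightarrow> 'a \<Rightarrow> 'i set" where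
  "active H x = {i \<in> I. u i \<bullet> x = H i}"

text \<open>The support numbers of the polytopes with exactly this normal fan. The witness
  \<open>x\<close> is a point in the relative interior of the face that belongs to the cone
  \<open>r\<close>.\<close>

definition type_cone :: "('i \<Rightarrow> real) set" where
  "type_cone = {H. \<forall>r\<in>S. \<exists>x. (\<forall>i\<in>r. u i \<bullet> x = H i) \<and> (\<forall>i\<in>I - r. u i \<bullet> x < H i)}"

lemma finite_cone: "r \<in> S \<Longrightarrow> finite r"
  using cone_subset finite_I finite_subset by blast

lemma finite_S: "finite S"
  using cone_subset finite_I by (metis Pow_iff finite_Pow_iff finite_subset subsetI)

lemma type_coneE:
  assumes "H \<in> type_cone" "r \<in> S"
  obtains x where "x \<in> hpoly H" "active H x = r"
proof -
  obtain x where x: "\<forall>i\<in>r. u i \<bullet> x = H i" "\<forall>i\<in>I - r. u i \<bullet> x < H i"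
    using assms unfolding type_cone_def by blast
  have "u i \<bullet> x \<le> H i" if "i \<in> I" for i
    using x that by (cases "i \<in> r") (auto intro: less_imp_le)
  then have "x \<in> hpoly H" unfolding hpoly_def by blast
  moreover have "active H x = r" using x cone_subset[OF assms(2)] unfolding active_def by force
  ultimately show ?thesis using that by blast
qed

lemma type_cone_cong: "H \<in> type_cone \<Longrightarrow> (\<And>i. i \<in> I \<Longrightarrow> H i = H' i) \<Longrightarrow> H' \<in> type_cone"
  unfolding type_cone_def
proof clarify
  fix r assume H: "\<forall>r\<in>S. \<exists>x. (\<forall>i\<in>r. u i \<bullet> x = H i) \<and> (\<forall>i\<in>I - r. u i \<bullet> x < H i)"
    and eq: "\<And>i. i \<in> I \<Longrightarrow> H i = H' i" and r: "r \<in> S"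
  then obtain x where "\<forall>i\<in>r. u i \<bullet> x = H i" "\<forall>i\<in>I - r. u i \<bullet> x < H i" by blast
  then show "\<exists>x. (\<forall>i\<in>r. u i \<bullet> x = H' i) \<and> (\<forall>i\<in>I - r. u i \<bullet> x < H' i)"
    using eq cone_subset[OF r] by (intro exI[of _ x]) (auto simp: subset_iff)
qed

lemma type_cone_scale:
  assumes "H \<in> type_cone" "0 < c" shows "(\<lambda>i. c * H i) \<in> type_cone"
  unfolding type_cone_def
proof clarify
  fix r assume "r \<in> S"
  then obtain x where x: "\<forall>i\<in>r. u i \<bullet> x = H i" "\<forall>i\<in>I - r. u i \<bullet> x < H i"
    using assms unfolding type_cone_def by blast
  then show "\<exists>x. (\<forall>i\<in>r. u i \<bullet> x = c * H i) \<and> (\<forall>i\<in>I - r. u i \<bullet> x < c * H i)"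
    using assms by (intro exI[of _ "c *\<^sub>R x"]) auto
qed

lemma type_cone_add:
  assumes "H \<in> type_cone" "H' \<in> type_cone" shows "(\<lambda>i. H i + H' i) \<in> type_cone"
  unfolding type_cone_def
proof (intro CollectI ballI)
  fix r assume "r \<in> S"
  obtain x where x: "\<forall>i\<in>r. u i \<bullet> x = H i" "\<forall>i\<in>I - r. u i \<bullet> x < H i"
    using assms(1) \<open>r \<in> S\<close> unfolding type_cone_def by blast
  obtain y where y: "\<forall>i\<in>r. u i \<bullet> y = H' i" "\<forall>i\<in>I - r. u i \<bullet> y < H' i"
    using assms(2) \<open>r \<in> S\<close> unfolding type_cone_def by blast
  from x y show "\<exists>x. (\<forall>i\<in>r. u i \<bullet> x = H i + H' i) \<and> (\<forall>i\<in>I - r. u i \<bullet> x < H i + H' i)"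
    by (intro exI[of _ "x + y"]) (auto simp: inner_right_distrib intro!: add_strict_mono)
qed

lemma type_cone_segment:
  assumes "H \<in> type_cone" "H' \<in> type_cone" "0 \<le> t" "t \<le> 1"
  shows "(\<lambda>i. H i + t * (H' i - H i)) \<in> type_cone"
proof (cases "t = 0 \<or> t = 1")
  case True
  then show ?thesis using assms by auto
next
  case False
  then have "(\<lambda>i. (1 - t) * H i + t * H' i) \<in> type_cone"
    using assms by (intro type_cone_add type_cone_scale) auto
  then show ?thesis by (rule type_cone_cong) (simp add: algebra_simps)
qed

lemma dual_vectors:
  assumes "r \<in> S"
  obtains w where "\<And>i j. i \<in> r \<Longrightarrow> j \<in> r \<Longrightarrow> u j \<bullet> w i = (if i = j then 1 else 0)"
proof -
  have "\<exists>w. \<forall>j\<in>r. u j \<bullet> w = (if i = j then 1 else 0)" for i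
    by (rule solvable[OF assms])
  then show ?thesis using that by metis
qed

text \<open>The witness for a cone is corrected by the vectors dual to its rays, which restores the
  equalities; the strict inequalities survive a small correction, and there are finitely many
  cones.\<close>

lemma type_cone_open:
  assumes "H \<in> type_cone"
  shows "\<exists>e>0. \<forall>H'. (\<forall>i\<in>I. \<bar>H' i - H i\<bar> < e) \<longrightarrow> H' \<in> type_cone"
proof -
  have "\<exists>e>0. \<forall>H'. (\<forall>i\<in>I. \<bar>H' i - H i\<bar> < e) \<longrightarrow>
      (\<exists>x. (\<forall>i\<in>r. u i \<bullet> x = H' i) \<and> (\<forall>i\<in>I - r. u i \<bullet> x < H' i))" if r: "r \<in> S" for r
  proof -
    obtain x where x: "\<forall>i\<in>r. u i \<bullet> x = H i" "\<forall>i\<in>I - r. u i \<bullet> x < H i"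
      using assms r unfolding type_cone_def by blast
    obtain w where w: "\<And>i j. i \<in> r \<Longrightarrow> j \<in> r \<Longrightarrow> u j \<bullet> w i = (if i = j then 1 else 0)"
      using dual_vectors[OF r] by metis
    \<comment> \<open>The summand 1 pays for the change of \<open>H' j\<close> itself: a
      perturbation below \<open>d / C\<close> moves \<open>u j \<bullet> y\<close> up by at most
      \<open>d - d / C\<close> and the bound by less than \<open>d / C\<close>.\<close>
    define C where "C = 1 + (\<Sum>j\<in>I. \<Sum>i\<in>r. \<bar>u j \<bullet> w i\<bar>)"
    have C: "C > 0" unfolding C_def by (intro add_pos_nonneg sum_nonneg) auto
    have Cj: "1 + (\<Sum>i\<in>r. \<bar>u j \<bullet> w i\<bar>) \<le> C" if "j \<in> I" for j
      unfolding C_def using finite_I that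
      by (simp add: member_le_sum[of j I "\<lambda>j. \<Sum>i\<in>r. \<bar>u j \<bullet> w i\<bar>"] sum_nonneg)
    define d where "d = Min (insert 1 ((\<lambda>j. H j - u j \<bullet> x) ` (I - r)))"
    have d: "d > 0" unfolding d_def using x finite_I by (subst Min_gr_iff) auto
    have dj: "d \<le> H j - u j \<bullet> x" if "j \<in> I - r" for j
      unfolding d_def using finite_I that by (intro Min_le) auto
    show ?thesis
    proof (intro exI conjI allI impI)
      show "d / C > 0" using C d by simp
      fix H' assume H': "\<forall>i\<in>I. \<bar>H' i - H i\<bar> < d / C"
      define y where "y = x + (\<Sum>i\<in>r. (H' i - H i) *\<^sub>R w i)"
      have uy: "u j \<bullet> y = u j \<bullet> x + (\<Sum>i\<in>r. (H' i - H i) * (u j \<bullet> w i))" for j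
        by (simp add: y_def inner_right_distrib inner_sum_right)
      show "(\<forall>i\<in>r. u i \<bullet> y = H' i)"
      proof
        fix j assume j: "j \<in> r"
        have "(\<Sum>i\<in>r. (H' i - H i) * (u j \<bullet> w i)) = (\<Sum>i\<in>r. if i = j then H' i - H i else 0)"
          using j by (intro sum.cong) (auto simp: w)
        then show "u j \<bullet> y = H' j" using x j finite_cone[OF r] by (simp add: uy)
      qed
      show "\<forall>j\<in>I - r. u j \<bullet> y < H' j"
      proof
        fix j assume j: "j \<in> I - r"
        have "(\<Sum>i\<in>r. (H' i - H i) * (u j \<bullet> w i)) \<le> (\<Sum>i\<in>r. d / C * \<bar>u j \<bullet> w i\<bar>)"
        proof (rule sum_mono)
          fix i assume "i \<in> r"
          then have "\<bar>H' i - H i\<bar> \<le> d / C" using H' cone_subset[OF r] by force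
          then have "\<bar>H' i - H i\<bar> * \<bar>u j \<bullet> w i\<bar> \<le> d / C * \<bar>u j \<bullet> w i\<bar>" by (intro mult_right_mono) auto
          then show "(H' i - H i) * (u j \<bullet> w i) \<le> d / C * \<bar>u j \<bullet> w i\<bar>"
            by (metis abs_ge_self abs_mult order_trans)
        qed
        also have "\<dots> = d / C * (\<Sum>i\<in>r. \<bar>u j \<bullet> w i\<bar>)" by (simp add: sum_distrib_left)
        also have "\<dots> = d / C * (1 + (\<Sum>i\<in>r. \<bar>u j \<bullet> w i\<bar>)) - d / C" by (simp add: algebra_simps)
        also have "\<dots> \<le> d / C * C - d / C" using C d Cj[of j] j by (intro diff_right_mono mult_left_mono) auto
        also have "\<dots> = d - d / C" using C by simp
        finally have "u j \<bullet> y \<le> u j \<bullet> x + d - d / C" by (simp add: uy)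
        moreover have "\<bar>H' j - H j\<bar> < d / C" using H' j by auto
        ultimately show "u j \<bullet> y < H' j" using dj[OF j] by linarith
      qed
    qed
  qed
  then obtain e where e: "\<And>r. r \<in> S \<Longrightarrow> e r > 0"
    "\<And>r H'. r \<in> S \<Longrightarrow> (\<forall>i\<in>I. \<bar>H' i - H i\<bar> < e r) \<Longrightarrow>
      (\<exists>x. (\<forall>i\<in>r. u i \<bullet> x = H' i) \<and> (\<forall>i\<in>I - r. u i \<bullet> x < H' i))" by metis
  define m where "m = Min (insert 1 (e ` S))"
  have m: "m > 0" unfolding m_def using e finite_S by (subst Min_gr_iff) auto
  have me: "m \<le> e r" if "r \<in> S" for r
    unfolding m_def using finite_S that by (intro Min_le) auto
  show ?thesis
  proof (intro exI conjI allI impI)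
    fix H' assume H': "\<forall>i\<in>I. \<bar>H' i - H i\<bar> < m"
    show "H' \<in> type_cone" unfolding type_cone_def
    proof clarify
      fix r assume r: "r \<in> S"
      show "\<exists>x. (\<forall>i\<in>r. u i \<bullet> x = H' i) \<and> (\<forall>i\<in>I - r. u i \<bullet> x < H' i)"
        using H' me[OF r] by (intro e(2)[OF r]) force
    qed
  qed (rule m)
qed

text \<open>The sum of the active normals is a positive combination of the rays of some cone
  \<open>r\<close>, hence maximal over the polytope at the point \<open>y\<close> of
  \<open>r\<close>. Its value at \<open>x\<close> is the sum of the active support numbers, so all
  of these inequalities are tight at \<open>y\<close> as well, and the active set is contained in
  \<open>r\<close>.\<close>

lemma active_in_S:
  assumes "H \<in> type_cone" "x \<in> hpoly H" shows "active H x \<in> S"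
proof -
  define a where "a = active H x"
  have fin: "finite a" unfolding a_def active_def using finite_I by auto
  obtain r k where r: "r \<in> S" "\<forall>i\<in>r. 0 < k i" "(\<Sum>i\<in>a. u i) = (\<Sum>i\<in>r. k i *\<^sub>R u i)"
    using complete by metis
  obtain y where y: "y \<in> hpoly H" "active H y = r" using type_coneE[OF assms(1) r(1)] .
  have "(\<Sum>i\<in>a. H i) = (\<Sum>i\<in>a. u i) \<bullet> x"
    by (simp add: inner_sum_left a_def active_def)
  also have "\<dots> = (\<Sum>i\<in>r. k i * (u i \<bullet> x))" by (simp add: r inner_sum_left)
  also have "\<dots> \<le> (\<Sum>i\<in>r. k i * H i)"
    using assms(2) r cone_subset by (intro sum_mono mult_left_mono) (auto simp: hpoly_def less_imp_le)
  also have "\<dots> = (\<Sum>i\<in>a. u i) \<bullet> y"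
    unfolding r inner_sum_left using y(2) by (intro sum.cong) (auto simp: active_def)
  finally have le: "(\<Sum>i\<in>a. H i) \<le> (\<Sum>i\<in>a. u i \<bullet> y)" by (simp add: inner_sum_left)
  have "a \<subseteq> r"
  proof
    fix i assume i: "i \<in> a"
    have "u j \<bullet> y \<le> H j" if "j \<in> a" for j
      using y(1) that by (auto simp: hpoly_def a_def active_def)
    then have "u i \<bullet> y = H i"
      using le fin i sum_strict_mono_ex1[of a "\<lambda>i. u i \<bullet> y" H] by (metis linorder_not_less order_le_less)
    then show "i \<in> r" using y(2) i by (auto simp: active_def a_def)
  qed
  then show ?thesis using down[OF r(1)] by (simp add: a_def)
qed

text \<open>That distinct cones have disjoint relative interiors follows from the existence of one
  polytope with this fan: a common interior vector is maximal at the points of both cones, so these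
  points lie on the same facets.\<close>

lemma cone_unique:
  assumes "type_cone \<noteq> {}" "r \<in> S" "q \<in> S" "\<And>i. i \<in> r \<Longrightarrow> 0 < k i" "\<And>i. i \<in> q \<Longrightarrow> 0 < l i"
    and eq: "(\<Sum>i\<in>r. k i *\<^sub>R u i) = (\<Sum>i\<in>q. l i *\<^sub>R u i)"
  shows "r = q"
proof -
  have "r \<subseteq> q" if "r \<in> S" "q \<in> S" "\<And>i. i \<in> r \<Longrightarrow> 0 < k i" "\<And>i. i \<in> q \<Longrightarrow> 0 < l i"
    and eq: "(\<Sum>i\<in>r. k i *\<^sub>R u i) = (\<Sum>i\<in>q. l i *\<^sub>R u i)" for r q k l
  proof -
    obtain H where H: "H \<in> type_cone" using assms(1) by auto
    obtain x where x: "x \<in> hpoly H" "active H x = r" using type_coneE[OF H \<open>r \<in> S\<close>] .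
    obtain y where y: "y \<in> hpoly H" "active H y = q" using type_coneE[OF H \<open>q \<in> S\<close>] .
    have "(\<Sum>i\<in>r. k i * H i) = (\<Sum>i\<in>r. k i *\<^sub>R u i) \<bullet> x"
      unfolding inner_sum_left using x(2) by (intro sum.cong) (auto simp: active_def)
    also have "\<dots> = (\<Sum>i\<in>q. l i * (u i \<bullet> x))" by (simp add: eq inner_sum_left)
    also have "\<dots> \<le> (\<Sum>i\<in>q. l i * H i)"
      using x(1) that(4) cone_subset[OF \<open>q \<in> S\<close>] by (intro sum_mono mult_left_mono) (auto simp: hpoly_def less_imp_le)
    also have "\<dots> = (\<Sum>i\<in>q. l i *\<^sub>R u i) \<bullet> y"
      unfolding inner_sum_left using y(2) by (intro sum.cong) (auto simp: active_def)
    also have "\<dots> = (\<Sum>i\<in>r. k i * (u i \<bullet> y))" by (simp add: eq[symmetric] inner_sum_left)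
    finally have le: "(\<Sum>i\<in>r. k i * H i) \<le> (\<Sum>i\<in>r. k i * (u i \<bullet> y))" .
    show "r \<subseteq> q"
    proof
      fix i assume i: "i \<in> r"
      have yi: "u j \<bullet> y \<le> H j" if "j \<in> r" for j
        using y(1) that cone_subset[OF \<open>r \<in> S\<close>] by (auto simp: hpoly_def)
      have "u i \<bullet> y = H i"
      proof (rule ccontr)
        assume "u i \<bullet> y \<noteq> H i"
        then have "k i * (u i \<bullet> y) < k i * H i" using yi[OF i] that(3)[OF i] by simp
        then have "(\<Sum>i\<in>r. k i * (u i \<bullet> y)) < (\<Sum>i\<in>r. k i * H i)"
          using i yi that(3) finite_cone[OF \<open>r \<in> S\<close>]
          by (intro sum_strict_mono_ex1) (auto simp: less_imp_le)
        then show False using le by simp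
      qed
      then show "i \<in> q" using y(2) i cone_subset[OF \<open>r \<in> S\<close>] by (auto simp: active_def)
    qed
  qed
  from this[OF assms(2-6)] this[OF assms(3,2,5,4) eq[symmetric]] show ?thesis by blast
qed

definition cone_of :: "'i set \<Rightarrow> 'a set" where
  "cone_of r = {\<Sum>i\<in>r. k i *\<^sub>R u i | k. \<forall>i\<in>r. 0 \<le> k i}"

lemma ray_in_cone_iff:
  assumes "type_cone \<noteq> {}" "r \<in> S" "i \<in> I"
  shows "u i \<in> cone_of r \<longleftrightarrow> i \<in> r"
proof
  assume "u i \<in> cone_of r"
  then obtain k where k: "\<forall>j\<in>r. 0 \<le> k j" "u i = (\<Sum>j\<in>r. k j *\<^sub>R u j)" by (auto simp: cone_of_def)
  define q where "q = {j \<in> r. k j \<noteq> 0}"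
  have "q \<in> S" using down[OF assms(2)] by (auto simp: q_def)
  have "(\<Sum>j\<in>r. k j *\<^sub>R u j) = (\<Sum>j\<in>q. k j *\<^sub>R u j)"
    unfolding q_def using finite_cone[OF assms(2)] by (intro sum.mono_neutral_right) auto
  then have "(\<Sum>j\<in>{i}. 1 *\<^sub>R u j) = (\<Sum>j\<in>q. k j *\<^sub>R u j)" using k by simp
  then have "{i} = q"
    using k by (intro cone_unique[OF assms(1) ray[OF assms(3)] \<open>q \<in> S\<close>, of "\<lambda>_. 1" k])
      (auto simp: q_def order_less_le)
  then show "i \<in> r" by (auto simp: q_def)
next
  assume "i \<in> r"
  then have "u i = (\<Sum>j\<in>r. (if j = i then 1 else 0) *\<^sub>R u j)"
    using finite_cone[OF assms(2)] by (simp add: if_distrib[of "\<lambda>x. x *\<^sub>R _"] cong: if_cong)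
  then show "u i \<in> cone_of r" unfolding cone_of_def by (intro CollectI exI[of _ "\<lambda>j. if j = i then 1 else 0"]) auto
qed

text \<open>By completeness every linear functional is a nonnegative combination of the normals and
  therefore bounded above.\<close>

lemma bounded_hpoly: "bounded (hpoly H)"
proof -
  have "\<exists>B. \<forall>x\<in>hpoly H. c \<bullet> x \<le> B" for c
  proof -
    obtain r k where r: "r \<in> S" "\<forall>i\<in>r. 0 < k i" "c = (\<Sum>i\<in>r. k i *\<^sub>R u i)" using complete by metis
    have "c \<bullet> x \<le> (\<Sum>i\<in>r. k i * H i)" if "x \<in> hpoly H" for x
      unfolding r(3) inner_sum_left inner_scaleR_left using that r(2) cone_subset[OF r(1)]
      by (intro sum_mono mult_left_mono) (auto simp: hpoly_def less_imp_le)
    then show ?thesis by blast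
  qed
  then obtain B where B: "\<And>c x. x \<in> hpoly H \<Longrightarrow> c \<bullet> x \<le> B c" by metis
  have "norm x \<le> (\<Sum>b\<in>Basis. max (B b) (B (- b)))" if "x \<in> hpoly H" for x
  proof -
    have "norm x \<le> (\<Sum>b\<in>Basis. \<bar>x \<bullet> b\<bar>)" by (rule norm_le_l1)
    also have "\<dots> \<le> (\<Sum>b\<in>Basis. max (B b) (B (- b)))"
    proof (rule sum_mono)
      fix b :: 'a
      show "\<bar>x \<bullet> b\<bar> \<le> max (B b) (B (- b))"
        using B[OF that, of b] B[OF that, of "- b"] by (auto simp: inner_commute abs_le_iff)
    qed
    finally show ?thesis .
  qed
  then show ?thesis unfolding bounded_iff by blast
qed

lemma hpoly_eq_Inter: "hpoly H = (\<Inter>i\<in>I. {x. u i \<bullet> x \<le> H i})"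
  by (auto simp: hpoly_def)

lemma polyhedron_hpoly: "polyhedron (hpoly H)"
  unfolding hpoly_eq_Inter using finite_I by (intro polyhedron_Inter) (auto simp: polyhedron_halfspace_le)

lemma polytope_hpoly: "polytope (hpoly H)"
  using polyhedron_hpoly bounded_hpoly by (simp add: polytope_eq_bounded_polyhedron)

lemma compact_hpoly: "compact (hpoly H)"
  using polytope_hpoly polytope_imp_compact by blast

lemma convex_polytope_hpoly: "H \<in> type_cone \<Longrightarrow> convex_polytope (hpoly H)"
  using type_coneE[of H "{}"] polytope_hpoly[of H] complete[of 0] down
  unfolding convex_polytope_def by (metis empty_iff empty_subsetI)

end

subsection \<open>Normal fans\<close>

text \<open>A nonempty face has the normal cone of any of its relative interior points, and a point
  has the normal cone of the smallest face containing it. Fans can thus be computed pointwise,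
  without a description of the faces.\<close>

lemma normal_fan_points:
  assumes "convex A"
  shows "normal_fan A = {normal_cone A {x} | x. x \<in> A}"
proof (intro equalityI subsetI)
  fix \<sigma> assume "\<sigma> \<in> normal_fan A"
  then obtain F where F: "F face_of A" "F \<noteq> {}" "\<sigma> = normal_cone A F" by (auto simp: normal_fan_def)
  have FA: "F \<subseteq> A" using F(1) face_of_imp_subset by blast
  have "convex F" using F(1) face_of_imp_convex assms by blast
  then obtain x where x: "x \<in> rel_interior F" using F(2) rel_interior_eq_empty by blast
  have xF: "x \<in> F" using x rel_interior_subset by blast
  have "normal_cone A {x} \<subseteq> normal_cone A F"
    unfolding normal_cone_def
  proof clarify
    fix c z y assume c: "\<forall>x\<in>{x}. \<forall>y\<in>A. c \<bullet> y \<le> c \<bullet> x" and z: "z \<in> F" and y: "y \<in> A"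
    have "c \<bullet> z = c \<bullet> x"
    proof (cases "z = x")
      case False
      obtain e where e: "e > 1" "(1 - e) *\<^sub>R z + e *\<^sub>R x \<in> F"
        using convex_rel_interior_iff[OF \<open>convex F\<close> F(2), of x] x z by blast
      then have "c \<bullet> ((1 - e) *\<^sub>R z + e *\<^sub>R x) \<le> c \<bullet> x" using c FA by auto
      then have "(e - 1) * (c \<bullet> x) \<le> (e - 1) * (c \<bullet> z)" by (simp add: inner_right_distrib algebra_simps)
      then have "c \<bullet> x \<le> c \<bullet> z" using e(1) by simp
      moreover have "c \<bullet> z \<le> c \<bullet> x" using c z FA by auto
      ultimately show ?thesis by simp
    qed simp
    then show "c \<bullet> y \<le> c \<bullet> z" using c y by simp
  qed
  moreover have "normal_cone A F \<subseteq> normal_cone A {x}" using xF by (auto simp: normal_cone_def)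
  ultimately show "\<sigma> \<in> {normal_cone A {x} | x. x \<in> A}" using F(3) xF FA by blast
next
  fix \<sigma> assume "\<sigma> \<in> {normal_cone A {x} | x. x \<in> A}"
  then obtain x where x: "x \<in> A" "\<sigma> = normal_cone A {x}" by auto
  define F where "F = \<Inter>{G. G face_of A \<and> x \<in> G}"
  have "A face_of A" using assms by (simp add: face_of_refl)
  then have F: "F face_of A" unfolding F_def using x(1) by (intro face_of_Inter) auto
  have xF: "x \<in> F" by (auto simp: F_def)
  have "normal_cone A {x} \<subseteq> normal_cone A F"
  proof
    fix c assume c: "c \<in> normal_cone A {x}"
    then have "A \<inter> {y. c \<bullet> y = c \<bullet> x} face_of A"
      using assms by (intro face_of_Int_supporting_hyperplane_le) (auto simp: normal_cone_def)
    then have "F \<subseteq> {y. c \<bullet> y = c \<bullet> x}" unfolding F_def using x(1) by blast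
    then show "c \<in> normal_cone A F" using c by (auto simp: normal_cone_def)
  qed
  moreover have "normal_cone A F \<subseteq> normal_cone A {x}" using xF by (auto simp: normal_cone_def)
  ultimately show "\<sigma> \<in> normal_fan A" unfolding normal_fan_def using F xF x(2) by blast
qed

text \<open>With solvable systems the coefficients are explicit: they are the values of
  \<open>c\<close> on the dual vectors. The remainder of any \<open>z\<close> is orthogonal to all
  \<open>u i\<close>, and the hypothesis, applied to it and its negative, shows that
  \<open>c\<close> vanishes there.\<close>

lemma farkas_independent:
  fixes u :: "'i \<Rightarrow> 'a::euclidean_space"
  assumes fin: "finite r" and solv: "\<And>f. \<exists>w. \<forall>i\<in>r. u i \<bullet> w = f i"
    and c: "\<And>w. (\<And>i. i \<in> r \<Longrightarrow> u i \<bullet> w \<le> 0) \<Longrightarrow> c \<bullet> w \<le> 0"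
  shows "\<exists>k. (\<forall>i\<in>r. 0 \<le> k i) \<and> c = (\<Sum>i\<in>r. k i *\<^sub>R u i)"
proof -
  have "\<exists>w. \<forall>j\<in>r. u j \<bullet> w = (if i = j then 1 else 0)" for i by (rule solv)
  then obtain w where w: "\<And>i j. j \<in> r \<Longrightarrow> u j \<bullet> w i = (if i = j then 1 else 0)" by metis
  define k where "k i = c \<bullet> w i" for i
  have "\<forall>i\<in>r. 0 \<le> k i"
    using c[of "- w i" for i] w by (auto simp: k_def)
  moreover have "c = (\<Sum>i\<in>r. k i *\<^sub>R u i)"
  proof (rule vector_eq_rdot[THEN iffD1], rule allI)
    fix z
    define z' where "z' = z - (\<Sum>i\<in>r. (u i \<bullet> z) *\<^sub>R w i)"
    have z': "u j \<bullet> z' = 0" if "j \<in> r" for j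
    proof -
      have "u j \<bullet> (\<Sum>i\<in>r. (u i \<bullet> z) *\<^sub>R w i) = (\<Sum>i\<in>r. if i = j then u i \<bullet> z else 0)"
        unfolding inner_sum_right using that by (intro sum.cong) (auto simp: w)
      then show ?thesis using that fin by (simp add: z'_def inner_diff_right)
    qed
    have "c \<bullet> z' = 0" using c[of z'] c[of "- z'"] z' by auto
    then have "z \<bullet> c = (\<Sum>i\<in>r. (u i \<bullet> z) * (c \<bullet> w i))"
      by (simp add: z'_def inner_diff_right inner_sum_right inner_commute)
    then show "c \<bullet> z = (\<Sum>i\<in>r. k i *\<^sub>R u i) \<bullet> z"
      unfolding inner_sum_left inner_scaleR_left k_def by (simp add: inner_commute mult.commute)
  qed
  ultimately show ?thesis by (intro exI[of _ k] conjI)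
qed

text \<open>Only finitely many inequalities are inactive, and their positive slacks leave room for a
  common step length.\<close>

lemma small_step_in_halfspaces:
  fixes u :: "'i \<Rightarrow> 'a::euclidean_space"
  assumes I: "finite I" and x: "\<And>i. i \<in> I \<Longrightarrow> u i \<bullet> x \<le> H i"
    and w: "\<And>i. i \<in> I \<Longrightarrow> u i \<bullet> x = H i \<Longrightarrow> u i \<bullet> w \<le> 0"
  shows "\<exists>e>0. \<forall>t. 0 \<le> t \<and> t \<le> e \<longrightarrow> (\<forall>i\<in>I. u i \<bullet> (x + t *\<^sub>R w) \<le> H i)"
proof -
  define A where "A = {i \<in> I. u i \<bullet> x = H i}"
  define d where "d = Min (insert 1 ((\<lambda>j. (H j - u j \<bullet> x) / (1 + \<bar>u j \<bullet> w\<bar>)) ` (I - A)))"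
  have "d > 0" unfolding d_def using x I
    by (subst Min_gr_iff) (auto simp: A_def intro!: divide_pos_pos add_pos_nonneg order_le_neq_trans)
  moreover have "u j \<bullet> (x + t *\<^sub>R w) \<le> H j" if t: "0 \<le> t" "t \<le> d" and j: "j \<in> I" for t j
  proof (cases "j \<in> A")
    case True
    then have "u j \<bullet> x = H j" "t * (u j \<bullet> w) \<le> 0"
      using w t by (auto simp: A_def mult_nonneg_nonpos)
    then show ?thesis by (simp add: inner_right_distrib)
  next
    case False
    then have "d \<le> (H j - u j \<bullet> x) / (1 + \<bar>u j \<bullet> w\<bar>)"
      unfolding d_def using I j by (intro Min_le) auto
    then have "t \<le> (H j - u j \<bullet> x) / (1 + \<bar>u j \<bullet> w\<bar>)" using t by simp
    then have "t * (1 + \<bar>u j \<bullet> w\<bar>) \<le> H j - u j \<bullet> x"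
      by (subst (asm) pos_le_divide_eq) (auto intro: add_pos_nonneg)
    moreover have "t * (u j \<bullet> w) \<le> t * (1 + \<bar>u j \<bullet> w\<bar>)" using t by (intro mult_left_mono) auto
    ultimately show ?thesis by (simp add: inner_right_distrib)
  qed
  ultimately show ?thesis by blast
qed

text \<open>A nonzero direction orthogonal to all active normals could be followed both ways, which
  would put \<open>v\<close> in the middle of a segment.\<close>

lemma extreme_point_of_halfspaces:
  fixes u :: "'i \<Rightarrow> 'a::euclidean_space"
  assumes I: "finite I" and v: "v extreme_point_of {x. \<forall>i\<in>I. u i \<bullet> x \<le> H i}"
    and w: "\<And>i. i \<in> I \<Longrightarrow> u i \<bullet> v = H i \<Longrightarrow> u i \<bullet> w = 0"
  shows "w = 0"
proof (rule ccontr)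
  assume w0: "w \<noteq> 0"
  have v': "\<And>i. i \<in> I \<Longrightarrow> u i \<bullet> v \<le> H i" using v by (simp add: extreme_point_of_def)
  obtain d where d: "d > 0" "\<forall>t. 0 \<le> t \<and> t \<le> d \<longrightarrow> (\<forall>i\<in>I. u i \<bullet> (v + t *\<^sub>R w) \<le> H i)"
    using small_step_in_halfspaces[where u = u and x = v and H = H and w = w, OF I v'] w by force
  obtain e where e: "e > 0" "\<forall>t. 0 \<le> t \<and> t \<le> e \<longrightarrow> (\<forall>i\<in>I. u i \<bullet> (v + t *\<^sub>R (- w)) \<le> H i)"
    using small_step_in_halfspaces[where u = u and x = v and H = H and w = "- w", OF I v'] w by force
  define t where "t = min d e"
  have t: "t > 0" "v + t *\<^sub>R w \<in> {x. \<forall>i\<in>I. u i \<bullet> x \<le> H i}" "v + t *\<^sub>R (- w) \<in> {x. \<forall>i\<in>I. u i \<bullet> x \<le> H i}"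
    using d e unfolding t_def mem_Collect_eq by (simp, metis less_eq_real_def min.cobounded1 min_less_iff_conj, metis less_eq_real_def min.cobounded2 min_less_iff_conj)
  have "v \<in> open_segment (v + t *\<^sub>R w) (v + t *\<^sub>R (- w))"
    unfolding in_segment using t(1) w0
    by (auto intro!: exI[of _ "1/2"] simp: algebra_simps add_eq_0_iff_both_eq_0 simp flip: scaleR_left_distrib)
  then show False using v t(2,3) unfolding extreme_point_of_def by blast
qed

context simplicial_complete_fan
begin

lemma small_step_in_hpoly:
  assumes "x \<in> hpoly H" "\<And>i. i \<in> active H x \<Longrightarrow> u i \<bullet> w \<le> 0"
  shows "\<exists>e>0. \<forall>t. 0 \<le> t \<and> t \<le> e \<longrightarrow> x + t *\<^sub>R w \<in> hpoly H"
  using small_step_in_halfspaces[OF finite_I, of u x H w] assms by (simp add: hpoly_def active_def)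

lemma normal_cone_hpoly:
  assumes "H \<in> type_cone" "x \<in> hpoly H"
  shows "normal_cone (hpoly H) {x} = cone_of (active H x)"
proof (intro equalityI subsetI)
  fix c assume c: "c \<in> normal_cone (hpoly H) {x}"
  have "c \<bullet> w \<le> 0" if w: "\<And>i. i \<in> active H x \<Longrightarrow> u i \<bullet> w \<le> 0" for w
  proof -
    obtain e where e: "e > 0" "\<forall>t. 0 \<le> t \<and> t \<le> e \<longrightarrow> x + t *\<^sub>R w \<in> hpoly H"
      using small_step_in_hpoly[OF assms(2) w] by blast
    then have "x + e *\<^sub>R w \<in> hpoly H" by auto
    then have "c \<bullet> (x + e *\<^sub>R w) \<le> c \<bullet> x" using c by (auto simp: normal_cone_def)
    then show ?thesis using e(1) by (simp add: inner_right_distrib mult_le_0_iff)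
  qed
  then have "\<exists>k. (\<forall>i\<in>active H x. 0 \<le> k i) \<and> c = (\<Sum>i\<in>active H x. k i *\<^sub>R u i)"
    by (rule farkas_independent[OF finite_cone[OF active_in_S[OF assms]] solvable[OF active_in_S[OF assms]]])
  then show "c \<in> cone_of (active H x)" unfolding cone_of_def by blast
next
  fix c assume "c \<in> cone_of (active H x)"
  then obtain k where k: "\<forall>i\<in>active H x. 0 \<le> k i" "c = (\<Sum>i\<in>active H x. k i *\<^sub>R u i)"
    by (auto simp: cone_of_def)
  have "c \<bullet> y \<le> c \<bullet> x" if "y \<in> hpoly H" for y
    unfolding k inner_sum_left inner_scaleR_left
    using k(1) that by (intro sum_mono mult_left_mono) (auto simp: active_def hpoly_def)
  then show "c \<in> normal_cone (hpoly H) {x}" by (auto simp: normal_cone_def)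
qed

lemma normal_fan_hpoly:
  assumes "H \<in> type_cone"
  shows "normal_fan (hpoly H) = cone_of ` S"
proof -
  have "convex (hpoly H)" using polytope_hpoly polytope_imp_convex by blast
  then have "normal_fan (hpoly H) = {cone_of (active H x) | x. x \<in> hpoly H}"
    using normal_cone_hpoly[OF assms] by (auto simp: normal_fan_points)
  also have "\<dots> = cone_of ` S"
    using active_in_S[OF assms] by (fastforce elim: type_coneE[OF assms])
  finally show ?thesis .
qed

lemma support_fun_hpoly:
  assumes "H \<in> type_cone" "i \<in> I"
  shows "support_fun (hpoly H) (u i) = H i"
proof -
  obtain x where "x \<in> hpoly H" "active H x = {i}"
    using type_coneE[OF assms(1) ray[OF assms(2)]] .
  then have "x \<in> hpoly H" "u i \<bullet> x = H i" by (auto simp: active_def)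
  then show ?thesis
    using support_fun_eqI[of x "hpoly H" "u i"] assms(2) by (auto simp: hpoly_def)
qed

text \<open>A point of \<open>A\<close> with normal cone \<open>cone_of r\<close> lies on exactly
  the supporting hyperplanes of the rays in \<open>r\<close>, and any separating functional belongs
  to some cone; so the support numbers recover \<open>A\<close>. The third claim, linearity of the
  support function on each cone, later shows that the support numbers determine a virtual
  polytope.\<close>

lemma analogous_hpoly:
  assumes ne: "type_cone \<noteq> {}" and A: "convex_polytope A" "normal_fan A = cone_of ` S"
  defines "H \<equiv> \<lambda>i. support_fun A (u i)"
  shows "H \<in> type_cone" "A = hpoly H"
    "\<And>r k. r \<in> S \<Longrightarrow> (\<And>i. i \<in> r \<Longrightarrow> 0 \<le> k i) \<Longrightarrow>
      support_fun A (\<Sum>i\<in>r. k i *\<^sub>R u i) = (\<Sum>i\<in>r. k i * H i)"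
proof -
  have conv: "convex A" and clo: "closed A"
    using A(1) by (auto simp: convex_polytope_def polytope_imp_convex polytope_imp_closed)
  have sup: "u i \<bullet> x \<le> H i" if "x \<in> A" for i x
    unfolding H_def using A(1) that by (rule support_fun_upper)
  have pt: "\<exists>x\<in>A. (\<forall>i\<in>r. u i \<bullet> x = H i) \<and> (\<forall>i\<in>I - r. u i \<bullet> x < H i) \<and> normal_cone A {x} = cone_of r"
    if r: "r \<in> S" for r
  proof -
    have "cone_of r \<in> normal_fan A" using A r by auto
    then obtain x where x: "x \<in> A" "cone_of r = normal_cone A {x}"
      unfolding normal_fan_points[OF conv] by auto
    have "u i \<bullet> x = H i" if "i \<in> I" "u i \<in> normal_cone A {x}" for i
      using that x(1) unfolding H_def normal_cone_def by (intro support_fun_eqI[symmetric]) auto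
    moreover have "u i \<bullet> x < H i" if i: "i \<in> I" "u i \<notin> normal_cone A {x}" for i
    proof -
      obtain y where "y \<in> A" "u i \<bullet> x < u i \<bullet> y" using i by (auto simp: normal_cone_def not_le)
      then show ?thesis using sup[of y i] by simp
    qed
    moreover have "i \<in> r \<longleftrightarrow> u i \<in> normal_cone A {x}" if "i \<in> I" for i
      using ray_in_cone_iff[OF ne r that] x(2) by simp
    ultimately show ?thesis using x cone_subset[OF r] by (intro bexI[OF _ x(1)]) auto
  qed
  show T: "H \<in> type_cone" unfolding type_cone_def using pt by blast
  show supp: "support_fun A (\<Sum>i\<in>r. k i *\<^sub>R u i) = (\<Sum>i\<in>r. k i * H i)"
    if r: "r \<in> S" and k: "\<And>i. i \<in> r \<Longrightarrow> 0 \<le> k i" for r k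
  proof -
    obtain x where x: "x \<in> A" "\<forall>i\<in>r. u i \<bullet> x = H i" using pt[OF r] by blast
    have "support_fun A (\<Sum>i\<in>r. k i *\<^sub>R u i) = (\<Sum>i\<in>r. k i *\<^sub>R u i) \<bullet> x"
    proof (rule support_fun_eqI[OF x(1)])
      fix y assume y: "y \<in> A"
      show "(\<Sum>i\<in>r. k i *\<^sub>R u i) \<bullet> y \<le> (\<Sum>i\<in>r. k i *\<^sub>R u i) \<bullet> x"
        unfolding inner_sum_left inner_scaleR_left using k x(2) sup[OF y] by (intro sum_mono mult_left_mono) auto
    qed
    also have "\<dots> = (\<Sum>i\<in>r. k i * H i)"
      unfolding inner_sum_left inner_scaleR_left using x(2) by (intro sum.cong) auto
    finally show ?thesis .
  qed
  show "A = hpoly H"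
  proof
    show "A \<subseteq> hpoly H" using sup by (auto simp: hpoly_def)
    show "hpoly H \<subseteq> A"
    proof
      fix z assume z: "z \<in> hpoly H"
      show "z \<in> A"
      proof (rule ccontr)
        assume "z \<notin> A"
        then obtain a b where ab: "a \<bullet> z < b" "\<forall>x\<in>A. b < a \<bullet> x"
          using separating_hyperplane_closed_point[OF conv clo] by blast
        obtain r k where r: "r \<in> S" "\<forall>i\<in>r. 0 < k i" "- a = (\<Sum>i\<in>r. k i *\<^sub>R u i)" using complete by metis
        obtain x where x: "x \<in> A" "\<forall>i\<in>r. u i \<bullet> x = H i" using pt[OF r(1)] by blast
        have "(- a) \<bullet> z \<le> (- a) \<bullet> x"
          unfolding r(3) inner_sum_left inner_scaleR_left
          using r(2) x(2) z cone_subset[OF r(1)]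
          by (intro sum_mono mult_left_mono) (auto simp: hpoly_def less_imp_le)
        then show False using ab x(1) by force
      qed
    qed
  qed
qed

lemma analogous_hpoly_iff:
  assumes "h \<in> type_cone"
  shows "analogous A (hpoly h) \<longleftrightarrow> (\<exists>H\<in>type_cone. A = hpoly H)"
proof
  assume "analogous A (hpoly h)"
  then have "convex_polytope A" "normal_fan A = cone_of ` S"
    using normal_fan_hpoly[OF assms] by (auto simp: analogous_def)
  then show "\<exists>H\<in>type_cone. A = hpoly H" using analogous_hpoly[of A] assms by blast
next
  assume "\<exists>H\<in>type_cone. A = hpoly H"
  then show "analogous A (hpoly h)"
    using assms by (auto simp: analogous_def normal_fan_hpoly convex_polytope_hpoly)
qed


subsection \<open>The volume as a function of the support numbers\<close>

lemma cone_independent: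
  assumes "r \<in> S" shows "inj_on u r" "independent (u ` r)"
proof -
  obtain w where w: "\<And>i j. i \<in> r \<Longrightarrow> j \<in> r \<Longrightarrow> u j \<bullet> w i = (if i = j then 1 else 0)"
    using dual_vectors[OF assms] by metis
  show inj: "inj_on u r"
    using w by (intro inj_onI) (metis zero_neq_one)
  show "independent (u ` r)"
  proof (rule independent_if_scalars_zero)
    show "finite (u ` r)" using finite_cone[OF assms] by simp
    fix f v assume 0: "(\<Sum>x\<in>u ` r. f x *\<^sub>R x) = 0" and "v \<in> u ` r"
    then obtain i where i: "i \<in> r" "v = u i" by auto
    have "0 = (\<Sum>x\<in>u ` r. f x *\<^sub>R x) \<bullet> w i" using 0 by simp
    also have "\<dots> = (\<Sum>j\<in>r. f (u j) * (u j \<bullet> w i))" using inj by (simp add: sum.reindex inner_sum_left)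
    also have "\<dots> = (\<Sum>j\<in>r. if j = i then f (u i) else 0)" using i by (intro sum.cong) (auto simp: w)
    also have "\<dots> = f v" using i finite_cone[OF assms] by simp
    finally show "f v = 0" by simp
  qed
qed

lemma card_cone_le: "r \<in> S \<Longrightarrow> card r \<le> DIM('a)"
  using independent_bound cone_independent by (metis card_image)

definition vol :: "('i \<Rightarrow> real) \<Rightarrow> real" where
  "vol H = measure lebesgue (hpoly H)"

lemma hpoly_cong: "(\<And>i. i \<in> I \<Longrightarrow> H i = H' i) \<Longrightarrow> hpoly H = hpoly H'"
  by (auto simp: hpoly_def)

lemma vol_cong: "(\<And>i. i \<in> I \<Longrightarrow> H i = H' i) \<Longrightarrow> vol H = vol H'"
  unfolding vol_def using hpoly_cong by metis

lemma lmeasurable_hpoly: "hpoly H \<in> lmeasurable"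
  using compact_hpoly by (rule lmeasurable_compact)

lemma vol_mono:
  assumes "\<And>i. i \<in> I \<Longrightarrow> H i \<le> H' i"
  shows "vol H \<le> vol H'"
  unfolding vol_def
proof (rule measure_mono_fmeasurable)
  show "hpoly H \<subseteq> hpoly H'" using assms by (force simp: hpoly_def)
qed (auto simp: lmeasurable_hpoly fmeasurableD)

lemma hpoly_translate: "hpoly (\<lambda>i. H i + u i \<bullet> w) = (+) w ` hpoly H"
proof (intro equalityI subsetI)
  fix x assume "x \<in> hpoly (\<lambda>i. H i + u i \<bullet> w)"
  then have "x - w \<in> hpoly H" by (auto simp: hpoly_def inner_diff_right algebra_simps)
  then show "x \<in> (+) w ` hpoly H" by (intro image_eqI[of _ _ "x - w"]) auto
qed (auto simp: hpoly_def inner_add_right)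

lemma vol_translate: "vol (\<lambda>i. H i + u i \<bullet> w) = vol H"
  unfolding vol_def hpoly_translate by (rule measure_translation)

lemma vol_scale: assumes "0 < c" shows "vol (\<lambda>i. c * H i) = c ^ DIM('a) * vol H"
proof -
  have "hpoly (\<lambda>i. c * H i) = (*\<^sub>R) c ` hpoly H"
  proof (intro equalityI subsetI)
    fix x assume x: "x \<in> hpoly (\<lambda>i. c * H i)"
    have "(1 / c) *\<^sub>R x \<in> hpoly H" using x assms by (auto simp: hpoly_def field_simps)
    then show "x \<in> (*\<^sub>R) c ` hpoly H" using assms by (intro image_eqI[of _ _ "(1 / c) *\<^sub>R x"]) auto
  qed (use assms in \<open>auto simp: hpoly_def\<close>)
  then show ?thesis unfolding vol_def using assms
    by (simp add: measure_lebesgue_affine[of c 0, simplified] abs_of_pos)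
qed

section \<open>Mixed differences of the volume\<close>

lemma fin_diffs_integral:
  fixes X :: "'b \<Rightarrow> ('i \<Rightarrow> real) \<Rightarrow> real"
  assumes "\<And>H. integrable M (\<lambda>x. X x H)"
  shows "integrable M (\<lambda>x. fin_diffs l (X x) H) \<and>
    fin_diffs l (\<lambda>H. \<integral>x. X x H \<partial>M) H = (\<integral>x. fin_diffs l (X x) H \<partial>M)"
proof (induction l arbitrary: H)
  case (Cons a l)
  obtain i s where a: "a = (i, s)" by (cases a)
  show ?case using Cons[of H] Cons[of "H(i := H i + s)"]
    by (simp add: a fin_diff_def fun_upd_def)
qed (simp add: assms)

lemma of_bool_hpoly: "of_bool (\<forall>i\<in>I. u i \<bullet> x \<le> H i) = indicat_real (hpoly H) x"
  by (simp add: hpoly_def indicator_def of_bool_def)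

lemma fin_diffs_vol:
  "integrable lebesgue (\<lambda>x. fin_diffs l (\<lambda>H. of_bool (\<forall>i\<in>I. u i \<bullet> x \<le> H i)) H)"
  "fin_diffs l vol H = (\<integral>x. fin_diffs l (\<lambda>H. of_bool (\<forall>i\<in>I. u i \<bullet> x \<le> H i)) H \<partial>lebesgue)"
proof -
  have int: "integrable lebesgue (\<lambda>x. of_bool (\<forall>i\<in>I. u i \<bullet> x \<le> H i) :: real)" for H
    unfolding of_bool_hpoly using lmeasurable_hpoly by (simp add: lmeasurable_iff_integrable)
  have "vol = (\<lambda>H. \<integral>x. of_bool (\<forall>i\<in>I. u i \<bullet> x \<le> H i) \<partial>lebesgue)"
    unfolding of_bool_hpoly vol_def by (simp add: fun_eq_iff lmeasure_integral_UNIV[OF lmeasurable_hpoly])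
  then show "integrable lebesgue (\<lambda>x. fin_diffs l (\<lambda>H. of_bool (\<forall>i\<in>I. u i \<bullet> x \<le> H i)) H)"
    "fin_diffs l vol H = (\<integral>x. fin_diffs l (\<lambda>H. of_bool (\<forall>i\<in>I. u i \<bullet> x \<le> H i)) H \<partial>lebesgue)"
    using fin_diffs_integral[OF int] by auto
qed

lemma fin_diffs_vol_cong:
  assumes "\<And>i. i \<in> I \<Longrightarrow> H i = H' i"
  shows "fin_diffs l vol H = fin_diffs l vol H'"
  using assms
proof (induction l arbitrary: H H')
  case (Cons a l)
  obtain i s where a: "a = (i, s)" by (cases a)
  have "fin_diffs l vol H = fin_diffs l vol H'" by (rule Cons.IH) (rule Cons.prems)
  moreover have "fin_diffs l vol (H(i := H i + s)) = fin_diffs l vol (H'(i := H' i + s))"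
    by (rule Cons.IH) (use Cons.prems in auto)
  ultimately show ?case by (simp only: a fin_diffs_Cons fin_diff_def)
next
  case Nil
  show ?case unfolding fin_diffs_Nil by (rule vol_cong) (rule Nil)
qed

lemma fin_diffs_vol_translate: "fin_diffs l vol (\<lambda>i. H i + u i \<bullet> w) = fin_diffs l vol H"
proof (induction l arbitrary: H)
  case (Cons a l)
  obtain i s where a: "a = (i, s)" by (cases a)
  have "(\<lambda>i. H i + u i \<bullet> w)(i := H i + u i \<bullet> w + s) = (\<lambda>j. (H(i := H i + s)) j + u j \<bullet> w)"
    by (auto simp: fun_eq_iff)
  then show ?case unfolding a fin_diffs_Cons fin_diff_def
    using Cons[of H] Cons[of "H(i := H i + s)"] by (simp add: fun_upd_def)
qed (simp add: vol_translate)

text \<open>Substitute for the statement that the mixed partial derivative of \<open>vol\<close>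
  over the multiset \<open>M\<close> of facets is zero near \<open>H0\<close>. One bound
  \<open>e\<close> governs both the base point and the steps.\<close>

definition vanishing :: "('i \<Rightarrow> real) \<Rightarrow> 'i multiset \<Rightarrow> bool" where
  "vanishing H0 M \<longleftrightarrow> (\<exists>e>0. \<forall>H l. (\<forall>i\<in>I. \<bar>H i - H0 i\<bar> < e) \<longrightarrow> image_mset fst (mset l) = M \<longrightarrow>
     (\<forall>p\<in>set l. \<bar>snd p\<bar> < e) \<longrightarrow> fin_diffs l vol H = 0)"

lemma vanishingE:
  assumes "vanishing H0 M"
  obtains e where "e > 0" "\<And>H l. (\<And>i. i \<in> I \<Longrightarrow> \<bar>H i - H0 i\<bar> < e) \<Longrightarrow> image_mset fst (mset l) = M \<Longrightarrow>
     (\<And>p. p \<in> set l \<Longrightarrow> \<bar>snd p\<bar> < e) \<Longrightarrow> fin_diffs l vol H = 0"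
  using assms unfolding vanishing_def by metis

lemma vanishingI:
  assumes "e > 0" "\<And>H l. (\<And>i. i \<in> I \<Longrightarrow> \<bar>H i - H0 i\<bar> < e) \<Longrightarrow> image_mset fst (mset l) = M \<Longrightarrow>
     (\<And>p. p \<in> set l \<Longrightarrow> \<bar>snd p\<bar> < e) \<Longrightarrow> fin_diffs l vol H = 0"
  shows "vanishing H0 M"
  unfolding vanishing_def using assms by blast

lemma image_mset_fst_split:
  assumes "image_mset fst (mset l) = add_mset i M"
  obtains s l' where "mset l = mset ((i, s) # l')" "image_mset fst (mset l') = M" "(i, s) \<in> set l" "set l' \<subseteq> set l"
proof -
  have "i \<in># image_mset fst (mset l)" using assms by simp
  then obtain s where s: "(i, s) \<in> set l" by auto
  have m: "mset l = mset ((i, s) # remove1 (i, s) l)" using s by simp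
  have "image_mset fst (mset ((i, s) # remove1 (i, s) l)) = add_mset i M" using assms m by metis
  then have "image_mset fst (mset (remove1 (i, s) l)) = M" by simp
  then show ?thesis using that[OF m _ s] set_remove1_subset by metis
qed

lemma vanishing_add_mset:
  assumes "vanishing H0 M" shows "vanishing H0 (add_mset i M)"
proof -
  obtain e where e: "e > 0" "\<And>H l. (\<And>i. i \<in> I \<Longrightarrow> \<bar>H i - H0 i\<bar> < e) \<Longrightarrow> image_mset fst (mset l) = M \<Longrightarrow>
     (\<And>p. p \<in> set l \<Longrightarrow> \<bar>snd p\<bar> < e) \<Longrightarrow> fin_diffs l vol H = 0"
    using vanishingE[OF assms] by blast
  show ?thesis
  proof (rule vanishingI)
    \<comment> \<open>Half the bound, because the additional step moves the base point.\<close>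
    show "e / 2 > 0" using e by simp
    fix H l assume H: "\<And>i. i \<in> I \<Longrightarrow> \<bar>H i - H0 i\<bar> < e / 2" and l: "image_mset fst (mset l) = add_mset i M"
      and s: "\<And>p. p \<in> set l \<Longrightarrow> \<bar>snd p\<bar> < e / 2"
    obtain s l' where l': "mset l = mset ((i, s) # l')" "image_mset fst (mset l') = M" "(i, s) \<in> set l" "set l' \<subseteq> set l"
      using image_mset_fst_split[OF l] .
    have se: "\<bar>snd p\<bar> < e" if "p \<in> set l'" for p using s[of p] that l'(4) e(1) by auto
    have 1: "fin_diffs l' vol H = 0"
    proof (rule e(2)[OF _ l'(2) se])
      show "\<bar>H j - H0 j\<bar> < e" if "j \<in> I" for j using H[OF that] e(1) by linarith
    qed
    have 2: "fin_diffs l' vol (H(i := H i + s)) = 0"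
    proof (rule e(2)[OF _ l'(2) se])
      show "\<bar>(H(i := H i + s)) j - H0 j\<bar> < e" if "j \<in> I" for j
      proof -
        have "\<bar>s\<bar> < e / 2" using s[OF l'(3)] by simp
        moreover have "(H(i := H i + s)) j = H j \<or> (H(i := H i + s)) j = H j + s" by simp
        ultimately show ?thesis using H[OF that] e(1) by linarith
      qed
    qed
    have "fin_diffs l vol H = fin_diffs ((i, s) # l') vol H" using fin_diffs_perm[OF l'(1)] by metis
    then show "fin_diffs l vol H = 0" by (simp add: fin_diff_def 1 2)
  qed
qed

lemma vanishing_mono: "vanishing H0 M \<Longrightarrow> M \<subseteq># N \<Longrightarrow> vanishing H0 N"
proof -
  have "vanishing H0 (M + K)" if "vanishing H0 M" for K
    using that by (induction K) (auto intro: vanishing_add_mset)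
  then show "vanishing H0 M \<Longrightarrow> M \<subseteq># N \<Longrightarrow> vanishing H0 N"
    by (metis subset_mset.add_diff_inverse)
qed

text \<open>The mixed difference is an integral over the points lying between the two positions of each
  of the facets concerned; moving these facets to such a point, one sees that they meet.\<close>

lemma vanishing_noncone:
  assumes H0: "H0 \<in> type_cone" and A: "A \<subseteq> I" "A \<notin> S"
  shows "vanishing H0 (mset_set A)"
proof -
  have finA: "finite A" using A finite_I finite_subset by blast
  obtain e where e: "e > 0" "\<And>H'. (\<forall>i\<in>I. \<bar>H' i - H0 i\<bar> < e) \<Longrightarrow> H' \<in> type_cone"
    using type_cone_open[OF H0] by metis
  show ?thesis
  proof (rule vanishingI)
    show "e / 2 > 0" using e by simp
    fix H l assume H: "\<And>i. i \<in> I \<Longrightarrow> \<bar>H i - H0 i\<bar> < e / 2" and l: "image_mset fst (mset l) = mset_set A"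
      and s: "\<And>p. p \<in> set l \<Longrightarrow> \<bar>snd p\<bar> < e / 2"
    have ml: "mset (map fst l) = mset_set A" using l by simp
    have setA: "fst ` set l = A" using ml finA by (metis finite_set_mset_mset_set list.set_map set_mset_mset)
    have dist: "distinct (map fst l)"
      using ml finA by (metis count_mset_set(1) count_mset_set(3) distinct_count_atmost_1 set_mset_mset finite_set_mset_mset_set)
    have "fin_diffs l (\<lambda>H. of_bool (\<forall>i\<in>I. u i \<bullet> x \<le> H i)) H = (0::real)" for x
    proof (rule ccontr)
      assume nz: "fin_diffs l (\<lambda>H. of_bool (\<forall>i\<in>I. u i \<bullet> x \<le> H i)) H \<noteq> (0::real)"
      define p where "p = (\<lambda>(i, s). if i \<in> I then of_bool (u i \<bullet> x \<le> H i + s) - of_bool (u i \<bullet> x \<le> H i) else (0::real))"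
      have nz1: "prod_list (map p l) \<noteq> 0" and nz2: "\<forall>i\<in>I - A. u i \<bullet> x \<le> H i"
        using nz unfolding fin_diffs_indicator[OF dist] p_def[symmetric] setA by auto
      have pos: "\<bar>u i \<bullet> x - H i\<bar> \<le> \<bar>s\<bar>" if "(i, s) \<in> set l" for i s
      proof -
        have "p (i, s) \<noteq> 0" using nz1 that by (auto simp: prod_list_zero_iff)
        then have "of_bool (u i \<bullet> x \<le> H i + s) \<noteq> (of_bool (u i \<bullet> x \<le> H i) :: real)"
          by (auto simp: p_def split: if_splits)
        then have "(u i \<bullet> x \<le> H i + s) \<noteq> (u i \<bullet> x \<le> H i)" by auto
        then show ?thesis by linarith
      qed
      \<comment> \<open>At a point \<open>x\<close> where the integrand is nonzero, the facets of
        \<open>A\<close> can be moved to \<open>x\<close> within their steps. The resulting numbers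
        are still in the type cone, and the set active at \<open>x\<close> is a cone containing
        \<open>A\<close>.\<close>
      define H' where "H' i = (if i \<in> A then u i \<bullet> x else H i)" for i
      have "\<bar>H' i - H0 i\<bar> < e" if i: "i \<in> I" for i
      proof (cases "i \<in> A")
        case True
        then obtain t where t: "(i, t) \<in> set l" using setA by auto
        then show ?thesis using pos[OF t] s[OF t] H[OF i] True unfolding H'_def by (simp; linarith)
      next
        case False
        then show ?thesis using H[OF i] e(1) by (auto simp: H'_def)
      qed
      then have T: "H' \<in> type_cone" using e(2) by blast
      have "x \<in> hpoly H'" using nz2 by (auto simp: hpoly_def H'_def)
      then have "active H' x \<in> S" using active_in_S[OF T] by blast
      moreover have "A \<subseteq> active H' x" using A(1) by (auto simp: active_def H'_def)
      ultimately show False using down A(2) by blast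
    qed
    then show "fin_diffs l vol H = 0" unfolding fin_diffs_vol(2) by simp
  qed
qed

text \<open>Substitute for the statement that the mixed derivative over \<open>M\<close> does not
  depend on the support numbers in \<open>J\<close>. Base points keep to half the bound, so that
  passing from one to the other is an admissible step.\<close>

definition insensitive :: "('i \<Rightarrow> real) \<Rightarrow> 'i multiset \<Rightarrow> 'i set \<Rightarrow> real \<Rightarrow> bool" where
  "insensitive H0 M J e \<longleftrightarrow> (\<forall>l H H'. image_mset fst (mset l) = M \<longrightarrow> (\<forall>p\<in>set l. \<bar>snd p\<bar> < e) \<longrightarrow>
      (\<forall>i\<in>I. \<bar>H i - H0 i\<bar> < e / 2) \<longrightarrow> (\<forall>i\<in>I. \<bar>H' i - H0 i\<bar> < e / 2) \<longrightarrow> (\<forall>i\<in>I - J. H i = H' i) \<longrightarrow>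
      fin_diffs l vol H = fin_diffs l vol H')"

text \<open>The coordinates in \<open>J\<close> are changed one at a time; each change amounts to a
  difference over \<open>add_mset j M\<close>, which vanishes.\<close>

lemma vanishing_insensitive:
  assumes J: "J \<subseteq> I" and van: "\<And>j. j \<in> J \<Longrightarrow> vanishing H0 (add_mset j M)"
  shows "\<exists>e>0. insensitive H0 M J e"
proof -
  have finJ: "finite J" using J finite_I finite_subset by blast
  have "\<exists>e>0. \<forall>H l. (\<forall>i\<in>I. \<bar>H i - H0 i\<bar> < e) \<longrightarrow> image_mset fst (mset l) = add_mset j M \<longrightarrow>
     (\<forall>p\<in>set l. \<bar>snd p\<bar> < e) \<longrightarrow> fin_diffs l vol H = 0" if "j \<in> J" for j
    using van[OF that] unfolding vanishing_def by blast
  then obtain ej where ej: "\<And>j. j \<in> J \<Longrightarrow> ej j > 0"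
    "\<And>j H l. j \<in> J \<Longrightarrow> (\<forall>i\<in>I. \<bar>H i - H0 i\<bar> < ej j) \<Longrightarrow> image_mset fst (mset l) = add_mset j M \<Longrightarrow>
     (\<forall>p\<in>set l. \<bar>snd p\<bar> < ej j) \<Longrightarrow> fin_diffs l vol H = 0" by metis
  define e where "e = Min (insert 1 (ej ` J))"
  have e: "e > 0" unfolding e_def using ej(1) finJ by (subst Min_gr_iff) auto
  have e_le: "e \<le> ej j" if "j \<in> J" for j unfolding e_def using finJ that by (intro Min_le) auto
  have insens: "fin_diffs l vol H = fin_diffs l vol H'"
    if "finite K" "K \<subseteq> J" "image_mset fst (mset l) = M" "\<forall>p\<in>set l. \<bar>snd p\<bar> < e"
      "\<forall>i\<in>I. \<bar>H i - H0 i\<bar> < e / 2" "\<forall>i\<in>I. \<bar>H' i - H0 i\<bar> < e / 2" "\<forall>i\<in>I - K. H i = H' i" for K l H H'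
    using that
  proof (induction K arbitrary: H rule: finite_induct)
    case empty
    then show ?case by (intro fin_diffs_vol_cong) auto
  next
    case (insert j K)
    then have j: "j \<in> J" "j \<in> I" using J by auto
    have "\<bar>H j - H0 j\<bar> < e / 2" "\<bar>H' j - H0 j\<bar> < e / 2" using insert.prems(4,5) j(2) by auto
    then have d: "\<bar>H' j - H j\<bar> < e" by linarith
    have "fin_diffs ((j, H' j - H j) # l) vol H = 0"
    proof (rule ej(2)[OF j(1)])
      show "\<forall>i\<in>I. \<bar>H i - H0 i\<bar> < ej j"
      proof
        fix k assume "k \<in> I"
        then have "\<bar>H k - H0 k\<bar> < e / 2" using insert.prems(4) by auto
        then show "\<bar>H k - H0 k\<bar> < ej j" using e e_le[OF j(1)] by linarith
      qed
      show "\<forall>p\<in>set ((j, H' j - H j) # l). \<bar>snd p\<bar> < ej j"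
        using d insert.prems(3) e_le[OF j(1)] by (auto intro: less_le_trans)
    qed (simp add: insert.prems(2))
    then have "fin_diffs l vol H = fin_diffs l vol (H(j := H' j))" by (simp add: fin_diff_def)
    also have "\<dots> = fin_diffs l vol H'"
      using insert.prems by (intro insert.IH) auto
    finally show ?case .
  qed
  show ?thesis unfolding insensitive_def
    by (intro exI[of _ e] conjI allI impI e, rule insens[OF finJ order_refl]) assumption+
qed

text \<open>A repeated index is traded for new ones by means of a translation that moves only this facet
  among those already present.\<close>

lemma vanishing_exchange:
  assumes M: "set_mset (add_mset i M) \<in> S" "i \<in># M"
    and new: "\<And>j. j \<in> I - set_mset M \<Longrightarrow> vanishing H0 (add_mset j M)"
  shows "vanishing H0 (add_mset i M)"
proof -
  define J where "J = I - set_mset M"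
  have J: "J \<subseteq> I" by (auto simp: J_def)
  have new': "\<And>j. j \<in> J \<Longrightarrow> vanishing H0 (add_mset j M)" using new by (simp add: J_def)
  obtain e where e: "e > 0" and insens: "insensitive H0 M J e"
    using vanishing_insensitive[OF J new'] by blast
  obtain w where w: "\<forall>k\<in>set_mset (add_mset i M). u k \<bullet> w = (if k = i then 1 else 0)"
    using solvable[OF M(1), of "\<lambda>k. if k = i then 1 else 0"] by blast
  have iI: "i \<in> I" using cone_subset[OF M(1)] by auto
  define C where "C = 1 + (\<Sum>k\<in>I. \<bar>u k \<bullet> w\<bar>)"
  have C: "C \<ge> 1" unfolding C_def by (simp add: sum_nonneg)
  have Ck: "\<bar>u k \<bullet> w\<bar> \<le> C" if "k \<in> I" for k
    using member_le_sum[of k I "\<lambda>k. \<bar>u k \<bullet> w\<bar>"] that finite_I by (simp add: C_def)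
  \<comment> \<open>The numbers \<open>H2\<close> deviate from \<open>H0\<close> by less than
    \<open>d + d + d * C\<close>, where each summand is at most \<open>e / 6\<close>.\<close>
  define d where "d = e / (6 * C)"
  have d: "0 < d" "d * C = e / 6" using e C by (auto simp: d_def field_simps)
  have d1: "d \<le> d * C" using d(1) C by (simp add: mult_le_cancel_left1)
  show ?thesis
  proof (rule vanishingI[OF d(1)])
    fix H l assume H: "\<And>i. i \<in> I \<Longrightarrow> \<bar>H i - H0 i\<bar> < d" and l: "image_mset fst (mset l) = add_mset i M"
      and s: "\<And>p. p \<in> set l \<Longrightarrow> \<bar>snd p\<bar> < d"
    obtain s l' where l': "mset l = mset ((i, s) # l')" "image_mset fst (mset l') = M" "(i, s) \<in> set l" "set l' \<subseteq> set l"
      using image_mset_fst_split[OF l] .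
    have sd: "\<bar>s\<bar> < d" using s[OF l'(3)] by simp
    define H1 where "H1 = H(i := H i + s)"
    define H2 where "H2 k = H1 k + u k \<bullet> (- s *\<^sub>R w)" for k
    \<comment> \<open>Translating by \<open>- s *\<^sub>R w\<close> undoes the step of facet
      \<open>i\<close> and leaves the other facets of \<open>M\<close> in place. In total only
      support numbers in \<open>J\<close> have changed, to which the difference over
      \<open>M\<close> is insensitive.\<close>
    have "fin_diffs l' vol H1 = fin_diffs l' vol H2" unfolding H2_def by (rule fin_diffs_vol_translate[symmetric])
    also have "\<dots> = fin_diffs l' vol H"
    proof (rule insens[unfolded insensitive_def, rule_format, OF l'(2)])
      have de: "d < e" "d < e / 2" using d d1 e by linarith+
      show "\<bar>snd p\<bar> < e" if "p \<in> set l'" for p using s[of p] l'(4) de(1) that by auto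
      show "\<bar>H i - H0 i\<bar> < e / 2" if "i \<in> I" for i using H[OF that] de(2) by linarith
      show "\<bar>H2 k - H0 k\<bar> < e / 2" if k: "k \<in> I" for k
      proof -
        have "\<bar>s * (u k \<bullet> w)\<bar> \<le> d * C" unfolding abs_mult using sd Ck[OF k] by (intro mult_mono) auto
        moreover have "\<bar>H1 k - H k\<bar> \<le> d" using sd by (auto simp: H1_def)
        moreover have "H2 k = H1 k - s * (u k \<bullet> w)" by (simp add: H2_def)
        ultimately show "\<bar>H2 k - H0 k\<bar> < e / 2"
          using H[OF k] d d1 e by linarith
      qed
      show "H2 k = H k" if "k \<in> I - J" for k
        using w M(2) that by (auto simp: J_def H2_def H1_def)
    qed
    finally have "fin_diffs ((i, s) # l') vol H = 0" by (simp add: fin_diff_def H1_def)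
    then show "fin_diffs l vol H = 0" using fin_diffs_perm[OF l'(1)] by metis
  qed
qed

text \<open>If the facets in \<open>M\<close> do not meet, the difference vanishes already with
  multiplicities ignored. Otherwise at most \<open>DIM('a)\<close> of them are distinct, so an index
  is repeated, and trading one copy for a new index enlarges the support. The induction is on the
  number of indices that do not yet occur.\<close>

lemma vanishing_of_large_size:
  assumes H0: "H0 \<in> type_cone" and "set_mset M \<subseteq> I" "DIM('a) < size M"
  shows "vanishing H0 M"
  using assms(2,3)
proof (induction "card I - card (set_mset M)" arbitrary: M rule: less_induct)
  case less
  show ?case
  proof (cases "set_mset M \<in> S")
    case False
    then have "vanishing H0 (mset_set (set_mset M))" using vanishing_noncone[OF H0 less.prems(1)] by blast
    then show ?thesis using mset_set_set_mset_msubset by (rule vanishing_mono)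
  next
    case True
    have "\<exists>i\<in>#M. count M i \<noteq> 1"
    proof (rule ccontr)
      assume "\<not> ?thesis"
      then have "size M = card (set_mset M)" by (simp add: size_multiset_overloaded_eq)
      then show False using card_cone_le[OF True] less.prems(2) by simp
    qed
    then obtain i where i: "i \<in># M" "count M i \<noteq> 1" by blast
    define M' where "M' = M - {#i#}"
    have M: "M = add_mset i M'" using i by (simp add: M'_def)
    have iM': "i \<in># M'" using i unfolding M by (simp add: not_in_iff)
    show ?thesis unfolding M
    proof (rule vanishing_exchange)
      show "set_mset (add_mset i M') \<in> S" using True M by simp
      show "i \<in># M'" by (rule iM')
      fix j assume j: "j \<in> I - set_mset M'"
      show "vanishing H0 (add_mset j M')"
      proof (rule less.hyps)
        have eq: "set_mset M = set_mset M'" using iM' M by auto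
        have "card (insert j (set_mset M')) = Suc (card (set_mset M'))" using j by simp
        moreover have "card (insert j (set_mset M')) \<le> card I"
          using j less.prems(1) eq by (intro card_mono finite_I) auto
        ultimately show "card I - card (set_mset (add_mset j M')) < card I - card (set_mset M)"
          by (simp add: eq)
        show "set_mset (add_mset j M') \<subseteq> I" using j less.prems(1) eq by auto
        show "DIM('a) < size (add_mset j M')" using less.prems(2) M by simp
      qed
    qed
  qed
qed

text \<open>In each variable the volume is monotone and has vanishing differences of order
  \<open>k\<close>, one more than the dimension. It is therefore a polynomial of degree below
  \<open>k\<close> in each variable separately, hence jointly.\<close>

lemma vol_locally_poly:
  assumes H0: "H0 \<in> type_cone"
  shows "\<exists>r>0. \<exists>p\<in>poly_functions (coords I). \<forall>H. (\<forall>j\<in>I. \<bar>H j - H0 j\<bar> \<le> r) \<longrightarrow> vol H = p H"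
proof -
  define k where "k = Suc (DIM('a))"
  have "vanishing H0 (replicate_mset k i)" if "i \<in> I" for i
    using that by (intro vanishing_of_large_size[OF H0]) (auto simp: k_def)
  then have "\<forall>i\<in>I. \<exists>e>0. \<forall>H l. (\<forall>i\<in>I. \<bar>H i - H0 i\<bar> < e) \<longrightarrow> image_mset fst (mset l) = replicate_mset k i \<longrightarrow>
     (\<forall>p\<in>set l. \<bar>snd p\<bar> < e) \<longrightarrow> fin_diffs l vol H = 0"
    unfolding vanishing_def by blast
  from bchoice[OF this] obtain ei where
    "\<forall>i\<in>I. 0 < ei i \<and> (\<forall>H l. (\<forall>j\<in>I. \<bar>H j - H0 j\<bar> < ei i) \<longrightarrow>
      image_mset fst (mset l) = replicate_mset k i \<longrightarrow> (\<forall>p\<in>set l. \<bar>snd p\<bar> < ei i) \<longrightarrow> fin_diffs l vol H = 0)"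
    by (elim exE)
  then have ei: "\<And>i. i \<in> I \<Longrightarrow> ei i > 0"
    "\<And>i H l. i \<in> I \<Longrightarrow> (\<forall>j\<in>I. \<bar>H j - H0 j\<bar> < ei i) \<Longrightarrow> image_mset fst (mset l) = replicate_mset k i \<Longrightarrow>
     (\<forall>p\<in>set l. \<bar>snd p\<bar> < ei i) \<Longrightarrow> fin_diffs l vol H = 0"
    by simp_all
  define e where "e = Min (insert 1 (ei ` I))"
  have e: "e > 0" unfolding e_def using ei(1) finite_I by (subst Min_gr_iff) auto
  have e_le: "e \<le> ei i" if "i \<in> I" for i unfolding e_def using finite_I that by (intro Min_le) auto
  have sep: "\<exists>q :: real poly. (degree q < k \<or> q = 0) \<and> (\<forall>x. \<bar>x - H0 i\<bar> \<le> e / 2 \<longrightarrow> vol (H(i := x)) = poly q x)"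
    if i: "i \<in> I" and H: "\<And>j. j \<in> I \<Longrightarrow> \<bar>H j - H0 j\<bar> \<le> e / 2" for H i
  proof -
    have "\<exists>q :: real poly. (degree q < k \<or> q = 0) \<and>
        (\<forall>x. H0 i - e / 2 \<le> x \<and> x \<le> H0 i + e / 2 \<longrightarrow> vol (H(i := x)) = poly q x)"
    proof (rule monotone_differences_imp_poly[OF _ _ e])
      show "H0 i - e / 2 < H0 i + e / 2" using e by simp
      show "vol (H(i := x)) \<le> vol (H(i := y))" if "x \<le> y" for x y
        using that by (intro vol_mono) auto
      fix x s assume x: "H0 i - e / 2 \<le> x" "x \<le> H0 i + e / 2" and s: "0 < s" "s < e"
      have "fin_diffs (replicate k (i, s)) vol (H(i := x)) = 0"
      proof (rule ei(2)[OF i])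
        show "\<forall>j\<in>I. \<bar>(H(i := x)) j - H0 j\<bar> < ei i"
        proof
          fix j assume "j \<in> I"
          moreover have "\<bar>x - H0 i\<bar> \<le> e / 2" using x by linarith
          ultimately have "\<bar>(H(i := x)) j - H0 j\<bar> \<le> e / 2" using H unfolding fun_upd_apply by auto
          then show "\<bar>(H(i := x)) j - H0 j\<bar> < ei i" using e e_le[OF i] by simp
        qed
      qed (use s e_le[OF i] in auto)
      then show "(seq_diff ^^ k) (\<lambda>j. vol (H(i := x + real j * s))) 0 = 0"
        by (simp only: fin_diffs_replicate)
    qed
    moreover have "(H0 i - e / 2 \<le> x \<and> x \<le> H0 i + e / 2) = (\<bar>x - H0 i\<bar> \<le> e / 2)" for x
      by linarith
    ultimately show ?thesis by simp
  qed
  obtain p where p: "p \<in> poly_functions (coords I)"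
    "\<And>H. (\<forall>j\<in>I. \<bar>H j - H0 j\<bar> \<le> e / 2) \<and> (\<forall>j. j \<notin> I \<longrightarrow> H j = H0 j) \<Longrightarrow> vol H = p H"
    using separately_poly_imp_poly[OF finite_I order_refl _ sep, of H0] e by auto
  have "vol H = p H" if H: "\<forall>j\<in>I. \<bar>H j - H0 j\<bar> \<le> e / 2" for H
  proof -
    define H' where "H' j = (if j \<in> I then H j else H0 j)" for j
    have "vol H = vol H'" by (intro vol_cong) (simp add: H'_def)
    also have "\<dots> = p H'" using H by (intro p(2)) (auto simp: H'_def)
    also have "\<dots> = p H" by (rule poly_functions_cong[OF p(1)]) (auto simp: coords_def H'_def)
    finally show ?thesis .
  qed
  then show ?thesis using p(1) e by (intro exI[of _ "e / 2"]) auto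
qed

text \<open>The polynomial found near one point is propagated along segments.\<close>

lemma vol_poly:
  assumes ne: "type_cone \<noteq> {}"
  shows "\<exists>p\<in>poly_functions (coords I). \<forall>H\<in>type_cone. vol H = p H"
proof -
  obtain h where h: "h \<in> type_cone" using ne by blast
  obtain r p where r: "r > 0" and p: "p \<in> poly_functions (coords I)"
    "\<And>H. (\<forall>j\<in>I. \<bar>H j - h j\<bar> \<le> r) \<Longrightarrow> vol H = p H"
    using vol_locally_poly[OF h] by blast
  have "vol H = p H" if H: "H \<in> type_cone" for H
  proof -
    define c where "c t i = h i + t * (H i - h i)" for t i
    define B where "B = 1 + (\<Sum>i\<in>I. \<bar>H i - h i\<bar>)"
    have B: "B > 0" by (auto simp: B_def intro!: add_pos_nonneg sum_nonneg)
    have Bi: "\<bar>H i - h i\<bar> \<le> B" if "i \<in> I" for i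
      using member_le_sum[of i I "\<lambda>i. \<bar>H i - h i\<bar>"] that finite_I by (simp add: B_def)
    have near: "\<bar>c t i - c s i\<bar> \<le> \<bar>t - s\<bar> * B" if "i \<in> I" for t s i
    proof -
      have "c t i - c s i = (t - s) * (H i - h i)" by (simp add: c_def algebra_simps)
      then show ?thesis using Bi[OF that] by (simp add: abs_mult mult_left_mono)
    qed
    have loc: "\<exists>d>0. \<exists>q :: real poly. \<forall>t. \<bar>t - s\<bar> \<le> d \<longrightarrow> vol (c t) = poly q t" if s: "0 \<le> s" "s \<le> 1" for s
    proof -
      have "c s \<in> type_cone" unfolding c_def using type_cone_segment[OF h H s] .
      then obtain r' p' where r': "r' > 0" and p': "p' \<in> poly_functions (coords I)"
        "\<And>H. (\<forall>j\<in>I. \<bar>H j - c s j\<bar> \<le> r') \<Longrightarrow> vol H = p' H"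
        using vol_locally_poly by blast
      obtain q where q: "\<And>t. p' (\<lambda>i. h i + t * (H i - h i)) = poly q t"
        using poly_functions_coords_line[OF p'(1), of h "\<lambda>i. H i - h i"] by blast
      have "vol (c t) = poly q t" if t: "\<bar>t - s\<bar> \<le> r' / B" for t
      proof -
        have "\<bar>t - s\<bar> * B \<le> r'" using t B by (simp add: field_simps)
        then have "vol (c t) = p' (c t)" using near by (intro p'(2)) (meson order_trans)
        then show ?thesis using q[of t] by (simp add: c_def[abs_def])
      qed
      then show ?thesis using r' B by (intro exI[of _ "r' / B"]) auto
    qed
    obtain q0 where q0: "\<And>t. p (\<lambda>i. h i + t * (H i - h i)) = poly q0 t"
      using poly_functions_coords_line[OF p(1), of h "\<lambda>i. H i - h i"] by blast
    \<comment> \<open>A whole neighbourhood of \<open>s\<close> is required, not \<open>s\<close>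
      alone: neighbouring local polynomials can then be compared on an interval.\<close>
    define good where "good s \<longleftrightarrow> (\<exists>d>0. \<forall>t. \<bar>t - s\<bar> \<le> d \<longrightarrow> vol (c t) = poly q0 t)" for s
    have "good 1"
    proof (rule connected_induction_simple[where S = "{0..1::real}" and P = good and a = 0 and b = 1])
      show "good 0" unfolding good_def
      proof (intro exI[of _ "r / B"] conjI allI impI)
        show "r / B > 0" using r B by simp
        fix t assume t: "\<bar>t - 0\<bar> \<le> r / B"
        have "\<bar>t - 0\<bar> * B \<le> r" using t B by (simp add: field_simps)
        then have "vol (c t) = p (c t)" using near[of _ t 0] by (intro p(2)) (auto simp: c_def intro: order_trans)
        then show "vol (c t) = poly q0 t" using q0[of t] by (simp add: c_def[abs_def])
      qed
      fix s :: real assume s: "s \<in> {0..1}"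
      obtain d q where d: "d > 0" and q: "\<forall>t. \<bar>t - s\<bar> \<le> d \<longrightarrow> vol (c t) = poly q t" using loc[of s] s by auto
      show "\<exists>U. openin (top_of_set {0..1}) U \<and> s \<in> U \<and> (\<forall>x\<in>U. \<forall>y\<in>U. good x \<longrightarrow> good y)"
      proof (intro exI[of _ "{0..1} \<inter> {s - d <..< s + d}"] conjI ballI impI)
        show "openin (top_of_set {0..1}) ({0..1} \<inter> {s - d<..<s + d})" by (intro openin_open_Int) simp
        show "s \<in> {0..1} \<inter> {s - d<..<s + d}" using s d by simp
        fix x y assume x: "x \<in> {0..1} \<inter> {s - d<..<s + d}" and y: "y \<in> {0..1} \<inter> {s - d<..<s + d}" and "good x"
        then obtain d' where d': "d' > 0" "\<forall>t. \<bar>t - x\<bar> \<le> d' \<longrightarrow> vol (c t) = poly q0 t" by (auto simp: good_def)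
        define m where "m = min d' (min (x - (s - d)) (s + d - x))"
        have m: "m > 0" using d' x by (auto simp: m_def)
        \<comment> \<open>Both polynomials give the volume on an interval to the right of
          \<open>x\<close>.\<close>
        have "q = q0"
        proof (rule poly_eqI_infinite)
          show "infinite {x<..<x + m}" using m by (simp add: infinite_Ioo)
          fix t assume "t \<in> {x<..<x + m}"
          then have "\<bar>t - x\<bar> \<le> d'" "\<bar>t - s\<bar> \<le> d" using m x by (auto simp: m_def abs_le_iff)
          then show "poly q t = poly q0 t" using q d' by metis
        qed
        moreover have "\<bar>t - s\<bar> \<le> d" if "\<bar>t - y\<bar> \<le> min (y - (s - d)) (s + d - y)" for t
          using that y by (auto simp: abs_le_iff)
        ultimately show "good y" unfolding good_def using q y
          by (intro exI[of _ "min (y - (s - d)) (s + d - y)"]) auto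
      qed
    qed auto
    then have "vol (c 1) = poly q0 1" by (auto simp: good_def)
    also have "\<dots> = p (c 1)" using q0[of 1] by (simp add: c_def[abs_def])
    finally show ?thesis by (simp add: c_def[abs_def])
  qed
  then show ?thesis using p(1) by blast
qed


text \<open>The type cone is open, so it contains an initial piece of the line from one of its
  points towards any \<open>H\<close>; polynomials that agree on this piece agree along the whole
  line.\<close>

lemma poly_functions_eq_on_type_cone:
  assumes ne: "type_cone \<noteq> {}" and pq: "p \<in> poly_functions (coords I)" "q \<in> poly_functions (coords I)"
    and eq: "\<And>H. H \<in> type_cone \<Longrightarrow> p H = q H"
  shows "p H = q H"
proof -
  obtain h where h: "h \<in> type_cone" using ne by blast
  obtain e where e: "e > 0" "\<And>H'. (\<forall>i\<in>I. \<bar>H' i - h i\<bar> < e) \<Longrightarrow> H' \<in> type_cone"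
    using type_cone_open[OF h] by metis
  define B where "B = 1 + (\<Sum>i\<in>I. \<bar>H i - h i\<bar>)"
  have B: "B > 0" by (auto simp: B_def intro!: add_pos_nonneg sum_nonneg)
  have Bi: "\<bar>H i - h i\<bar> < B" if "i \<in> I" for i
    using member_le_sum[of i I "\<lambda>i. \<bar>H i - h i\<bar>"] that finite_I by (simp add: B_def)
  obtain a where a: "\<And>t. p (\<lambda>i. h i + t * (H i - h i)) = poly a t"
    using poly_functions_coords_line[OF pq(1), of h "\<lambda>i. H i - h i"] by blast
  obtain b where b: "\<And>t. q (\<lambda>i. h i + t * (H i - h i)) = poly b t"
    using poly_functions_coords_line[OF pq(2), of h "\<lambda>i. H i - h i"] by blast
  have "a = b"
  proof (rule poly_eqI_infinite)
    show "infinite {0<..<e / B}" using e B by (simp add: infinite_Ioo)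
    fix t assume t: "t \<in> {0<..<e / B}"
    then have tB: "t * B < e" using B by (simp add: pos_less_divide_eq)
    have "(\<lambda>i. h i + t * (H i - h i)) \<in> type_cone"
    proof (rule e(2), rule ballI)
      fix i assume "i \<in> I"
      then have "t * \<bar>H i - h i\<bar> < t * B" using t Bi by (intro mult_strict_left_mono) auto
      also note tB
      finally have "\<bar>t * (H i - h i)\<bar> < e" using t by (simp add: abs_mult)
      then show "\<bar>h i + t * (H i - h i) - h i\<bar> < e" by simp
    qed
    then show "poly a t = poly b t" using eq a b by metis
  qed
  then show ?thesis using a[of 1] b[of 1] by simp
qed

text \<open>Scaling by \<open>c\<close> multiplies the volume by the power \<open>DIM('a)\<close> of
  \<open>c\<close>; comparing coefficients in \<open>c\<close> discards all monomials of other
  degrees.\<close>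

lemma vol_homogeneous_poly:
  assumes ne: "type_cone \<noteq> {}"
  shows "\<exists>M a. finite M \<and> (\<forall>m\<in>M. (\<Sum>i\<in>I. m i) = DIM('a)) \<and>
    (\<forall>H\<in>type_cone. vol H = (\<Sum>m\<in>M. a m * (\<Prod>i\<in>I. H i ^ m i)))"
proof -
  obtain p where p: "p \<in> poly_functions (coords I)" "\<And>H. H \<in> type_cone \<Longrightarrow> vol H = p H"
    using vol_poly[OF ne] by blast
  obtain M a where M: "finite M" "\<And>H. p H = (\<Sum>m\<in>M. a m * monomial_value I (\<lambda>i H. H i) m H)"
    using poly_functions_monomials[OF p(1)[unfolded coords_def] finite_I] by metis
  define D where "D = DIM('a)"
  have "vol H = (\<Sum>m\<in>{m \<in> M. (\<Sum>i\<in>I. m i) = D}. a m * (\<Prod>i\<in>I. H i ^ m i))" if H: "H \<in> type_cone" for H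
  proof -
    define q where "q = (\<Sum>m\<in>M. monom (a m * (\<Prod>i\<in>I. H i ^ m i)) (\<Sum>i\<in>I. m i))"
    have "q = monom (vol H) D"
    proof (rule poly_eqI_infinite)
      show "infinite {0::real<..}" by (simp add: infinite_Ioi)
      fix c :: real assume c: "c \<in> {0<..}"
      have "poly q c = p (\<lambda>i. c * H i)"
        unfolding q_def M(2) poly_sum
        by (intro sum.cong) (simp_all add: poly_monom monomial_value_def power_mult_distrib prod.distrib power_sum)
      also have "\<dots> = vol (\<lambda>i. c * H i)" using p(2)[OF type_cone_scale[OF H]] c by simp
      also have "\<dots> = poly (monom (vol H) D) c" using c by (simp add: vol_scale poly_monom D_def)
      finally show "poly q c = poly (monom (vol H) D) c" .
    qed
    then have "vol H = coeff q D" by simp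
    also have "\<dots> = (\<Sum>m\<in>M. if (\<Sum>i\<in>I. m i) = D then a m * (\<Prod>i\<in>I. H i ^ m i) else 0)"
      unfolding q_def coeff_sum by (intro sum.cong) auto
    also have "\<dots> = (\<Sum>m\<in>{m \<in> M. (\<Sum>i\<in>I. m i) = D}. a m * (\<Prod>i\<in>I. H i ^ m i))"
      using M(1) by (simp add: sum.inter_filter)
    finally show ?thesis .
  qed
  then show ?thesis using M(1)
    by (intro exI[of _ "{m \<in> M. (\<Sum>i\<in>I. m i) = D}"] exI[of _ a]) (auto simp: D_def)
qed

lemma type_cone_translate:
  assumes "H \<in> type_cone" shows "(\<lambda>i. H i + u i \<bullet> w) \<in> type_cone"
  unfolding type_cone_def
proof (intro CollectI ballI)
  fix r assume "r \<in> S"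
  then obtain x where "\<forall>i\<in>r. u i \<bullet> x = H i" "\<forall>i\<in>I - r. u i \<bullet> x < H i"
    using assms unfolding type_cone_def by blast
  then show "\<exists>x. (\<forall>i\<in>r. u i \<bullet> x = H i + u i \<bullet> w) \<and> (\<forall>i\<in>I - r. u i \<bullet> x < H i + u i \<bullet> w)"
    by (intro exI[of _ "x + w"]) (auto simp: inner_add_right)
qed

subsection \<open>Volume-preserving deformations are translations\<close>

definition vertex_cones :: "'i set set" where
  "vertex_cones = {r \<in> S. card r = DIM('a)}"

lemma vertex_cone_orthogonal:
  assumes "r \<in> vertex_cones" "\<And>i. i \<in> r \<Longrightarrow> u i \<bullet> w = 0" shows "w = 0"
proof -
  have r: "r \<in> S" "card r = DIM('a)" using assms(1) by (auto simp: vertex_cones_def)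
  have "card (u ` r) = DIM('a)" using card_image[OF cone_independent(1)[OF r(1)]] r(2) by simp
  then have "UNIV \<subseteq> span (u ` r)"
    using cone_independent(2)[OF r(1)] by (intro card_ge_dim_independent) auto
  then have "w \<in> span (u ` r)" by auto
  moreover have "x \<bullet> w = 0" if "x \<in> span (u ` r)" for x
    using that by (induction rule: span_induct_alt) (auto simp: assms(2) inner_add_left)
  ultimately have "w \<bullet> w = 0" by blast
  then show ?thesis by simp
qed

lemma vertex_cone_basis:
  assumes "r \<in> vertex_cones"
  shows "\<exists>k. c = (\<Sum>i\<in>r. k i *\<^sub>R u i)"
proof -
  have r: "r \<in> S" using assms by (auto simp: vertex_cones_def)
  obtain w where w: "\<And>i j. i \<in> r \<Longrightarrow> j \<in> r \<Longrightarrow> u j \<bullet> w i = (if i = j then 1 else 0)"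
    using dual_vectors[OF r] by metis
  have z: "z = (\<Sum>i\<in>r. (u i \<bullet> z) *\<^sub>R w i)" for z
  proof -
    have "u j \<bullet> (z - (\<Sum>i\<in>r. (u i \<bullet> z) *\<^sub>R w i)) = 0" if j: "j \<in> r" for j
    proof -
      have "u j \<bullet> (\<Sum>i\<in>r. (u i \<bullet> z) *\<^sub>R w i) = (\<Sum>i\<in>r. if i = j then u i \<bullet> z else 0)"
        unfolding inner_sum_right using j by (intro sum.cong) (auto simp: w)
      then show ?thesis using j finite_cone[OF r] by (simp add: inner_diff_right)
    qed
    then have "z - (\<Sum>i\<in>r. (u i \<bullet> z) *\<^sub>R w i) = 0" by (rule vertex_cone_orthogonal[OF assms])
    then show ?thesis by simp
  qed
  have eq: "c \<bullet> z = (\<Sum>i\<in>r. (c \<bullet> w i) *\<^sub>R u i) \<bullet> z" for z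
  proof -
    have "c \<bullet> z = c \<bullet> (\<Sum>i\<in>r. (u i \<bullet> z) *\<^sub>R w i)" using z[of z] by simp
    then show ?thesis by (simp add: inner_sum_left inner_sum_right mult.commute)
  qed
  have "c = (\<Sum>i\<in>r. (c \<bullet> w i) *\<^sub>R u i)"
    by (rule vector_eq_rdot[THEN iffD1], rule allI, rule eq)
  then show ?thesis by (intro exI[of _ "\<lambda>i. c \<bullet> w i"])
qed

text \<open>The pivoting step of the simplex algorithm: by compactness there is a last point of the
  ray in the polytope, and if no active facet opposed the direction there, a further small step
  would be possible.\<close>

lemma ray_hits_facet:
  assumes "x \<in> hpoly h" "w \<noteq> 0" "\<And>i. i \<in> active h x \<Longrightarrow> u i \<bullet> w \<le> 0"
  obtains t k where "t > 0" "x + t *\<^sub>R w \<in> hpoly h" "k \<in> active h (x + t *\<^sub>R w)" "u k \<bullet> w > 0"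
proof -
  define T where "T = {t. 0 \<le> t \<and> x + t *\<^sub>R w \<in> hpoly h}"
  obtain e where e: "e > 0" "\<forall>t. 0 \<le> t \<and> t \<le> e \<longrightarrow> x + t *\<^sub>R w \<in> hpoly h"
    using small_step_in_hpoly[OF assms(1,3)] by blast
  have eT: "e \<in> T" using e by (auto simp: T_def)
  have "closed T"
  proof -
    have "T = {0..} \<inter> (\<lambda>t. x + t *\<^sub>R w) -` hpoly h" by (auto simp: T_def)
    moreover have "closed ((\<lambda>t. x + t *\<^sub>R w) -` hpoly h)"
      using compact_imp_closed[OF compact_hpoly] by (intro closed_vimage) (auto intro!: continuous_intros)
    ultimately show ?thesis by auto
  qed
  moreover have "bounded T"
  proof -
    obtain B where B: "\<And>y. y \<in> hpoly h \<Longrightarrow> norm y \<le> B" using bounded_hpoly[of h] unfolding bounded_iff by blast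
    have "norm t \<le> (B + norm x) / norm w" if "t \<in> T" for t
    proof -
      have "norm (t *\<^sub>R w) \<le> norm (x + t *\<^sub>R w) + norm x"
        using norm_triangle_ineq4[of "x + t *\<^sub>R w" x] by simp
      also have "\<dots> \<le> B + norm x" using B that by (auto simp: T_def)
      finally show ?thesis using assms(2) by (simp add: pos_le_divide_eq)
    qed
    then show ?thesis unfolding bounded_iff by blast
  qed
  ultimately have "compact T" by (simp add: compact_eq_bounded_closed)
  then obtain t where t: "t \<in> T" "\<And>s. s \<in> T \<Longrightarrow> s \<le> t"
    using compact_attains_sup[of T] eT by blast
  have t0: "t > 0" using t(2)[OF eT] e(1) by simp
  have tP: "x + t *\<^sub>R w \<in> hpoly h" using t(1) by (simp add: T_def)
  have "\<exists>k\<in>active h (x + t *\<^sub>R w). u k \<bullet> w > 0"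
  proof (rule ccontr)
    assume "\<not> ?thesis"
    then have "\<And>i. i \<in> active h (x + t *\<^sub>R w) \<Longrightarrow> u i \<bullet> w \<le> 0" by force
    then obtain d where d: "d > 0" "\<forall>s. 0 \<le> s \<and> s \<le> d \<longrightarrow> x + t *\<^sub>R w + s *\<^sub>R w \<in> hpoly h"
      using small_step_in_hpoly[OF tP, of w] by blast
    then have "x + t *\<^sub>R w + d *\<^sub>R w \<in> hpoly h" by simp
    then have "t + d \<in> T" using t0 d(1) by (simp add: T_def scaleR_left_distrib add.assoc)
    then show False using t(2) d(1) by force
  qed
  then show ?thesis using that t0 tP by blast
qed

text \<open>With fewer active facets than the dimension, some direction is orthogonal to all their
  normals; following it keeps them active until a new facet is reached.\<close>

lemma extend_to_vertex_cone:
  assumes ne: "type_cone \<noteq> {}" and "r \<in> S"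
  shows "\<exists>q\<in>vertex_cones. r \<subseteq> q"
  using assms(2)
proof (induction "DIM('a) - card r" arbitrary: r rule: less_induct)
  case less
  obtain h where h: "h \<in> type_cone" using ne by blast
  obtain x where x: "x \<in> hpoly h" "active h x = r" using type_coneE[OF h less.prems] .
  show ?case
  proof (cases "card r = DIM('a)")
    case True
    then show ?thesis using less.prems by (auto simp: vertex_cones_def)
  next
    case False
    then have lt: "card r < DIM('a)" using card_cone_le[OF less.prems] by simp
    have "dim (u ` r) \<le> card (u ` r)" using finite_cone[OF less.prems] by (intro dim_le_card') auto
    also have "\<dots> \<le> card r" by (rule card_image_le[OF finite_cone[OF less.prems]])
    finally have "dim (u ` r) < DIM('a)" using lt by simp
    then have "span (u ` r) \<noteq> UNIV" by (metis dim_UNIV dim_span less_irrefl)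
    then obtain w where w: "w \<noteq> 0" "\<And>y. y \<in> span (u ` r) \<Longrightarrow> w \<bullet> y = 0"
      using span_not_UNIV_orthogonal by blast
    have w0: "u i \<bullet> w = 0" if "i \<in> r" for i
      using w(2)[OF span_base, of "u i"] that by (simp add: inner_commute)
    obtain t k where t: "t > 0" "x + t *\<^sub>R w \<in> hpoly h" "k \<in> active h (x + t *\<^sub>R w)" "u k \<bullet> w > 0"
      using ray_hits_facet[OF x(1) w(1)] w0 x(2) by (metis order_refl)
    define q where "q = active h (x + t *\<^sub>R w)"
    have q: "q \<in> S" using active_in_S[OF h t(2)] by (simp add: q_def)
    have "r \<subseteq> q" using w0 x(2) by (auto simp: q_def active_def inner_add_right)
    moreover have "k \<in> q" "k \<notin> r" using t w0 by (auto simp: q_def)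
    ultimately have sub: "r \<subset> q" by blast
    then have "card r < card q" using finite_cone[OF q] by (intro psubset_card_mono)
    then have "DIM('a) - card q < DIM('a) - card r" using lt by simp
    from less.hyps[OF this q] show ?thesis using sub by blast
  qed
qed

text \<open>The integrand is nonnegative, and it is 1 near a point slightly beyond every facet in
  \<open>r\<close> and strictly inside the other inequalities; such a point exists because the
  facets of a cone still meet after being moved a little. This is the counterpart of
  \<open>vanishing_noncone\<close>.\<close>

lemma fin_diffs_pos:
  assumes h: "h \<in> type_cone" and r: "r \<in> S" and l: "distinct (map fst l)" "fst ` set l = r"
    "\<And>p. p \<in> set l \<Longrightarrow> 0 < snd p"
  shows "0 < fin_diffs l vol h"
proof -
  obtain e where e: "e > 0" "\<And>H'. (\<forall>i\<in>I. \<bar>H' i - h i\<bar> < e) \<Longrightarrow> H' \<in> type_cone"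
    using type_cone_open[OF h] by metis
  \<comment> \<open>Half the minimum of the steps and of \<open>e\<close>: the point chosen below
    then lies strictly between both positions of each facet, and the moved numbers stay in the type
    cone.\<close>
  define d where "d = Min (insert e (snd ` set l)) / 2"
  have "Min (insert e (snd ` set l)) > 0" using e(1) l(3) by (subst Min_gr_iff) auto
  then have d: "0 < d" "d < e" and dl: "\<And>p. p \<in> set l \<Longrightarrow> d < snd p"
  proof -
    assume *: "Min (insert e (snd ` set l)) > 0"
    have "Min (insert e (snd ` set l)) \<le> e" by (intro Min_le) auto
    then show "0 < d" "d < e" using * unfolding d_def by linarith+
    fix p assume "p \<in> set l"
    then have "Min (insert e (snd ` set l)) \<le> snd p" by (intro Min_le) auto
    then show "d < snd p" using * unfolding d_def by linarith
  qed
  have "(\<lambda>i. if i \<in> r then h i + d else h i) \<in> type_cone"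
    using d e(1) by (intro e(2)) auto
  then obtain x where x: "\<forall>i\<in>r. u i \<bullet> x = h i + d" "\<forall>i\<in>I - r. u i \<bullet> x < h i"
    using r unfolding type_cone_def by force
  define U where "U = (\<Inter>(i, s)\<in>set l. {y. h i < u i \<bullet> y} \<inter> {y. u i \<bullet> y < h i + s}) \<inter> (\<Inter>i\<in>I - r. {y. u i \<bullet> y < h i})"
  have "open U" unfolding U_def
    by (intro open_Int open_INT) (auto intro: open_halfspace_lt open_halfspace_gt finite_I)
  moreover have "x \<in> U" using x d dl l(2) unfolding U_def by force
  ultimately obtain b where b: "b > 0" "ball x b \<subseteq> U" using openE by blast
  define F where "F y = fin_diffs l (\<lambda>H. of_bool (\<forall>i\<in>I. u i \<bullet> y \<le> H i)) h" for y
  have rI: "r \<subseteq> I" using cone_subset[OF r] .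
  have F: "F y = (\<Prod>(i, s)\<leftarrow>l. if i \<in> I then of_bool (u i \<bullet> y \<le> h i + s) - of_bool (u i \<bullet> y \<le> h i) else 0)
      * of_bool (\<forall>i\<in>I - r. u i \<bullet> y \<le> h i)" for y
    unfolding F_def fin_diffs_indicator[OF l(1)] l(2) ..
  have F0: "0 \<le> F y" for y
    unfolding F using l(3) by (intro mult_nonneg_nonneg prod_list_nonneg) (force simp: of_bool_def)+
  have F1: "F y = 1" if "y \<in> U" for y
  proof -
    have "\<forall>p\<in>set l. (case p of (i, s) \<Rightarrow> if i \<in> I then of_bool (u i \<bullet> y \<le> h i + s) - of_bool (u i \<bullet> y \<le> h i) else 0) = (1::real)"
      using that rI l(2) by (force simp: U_def)
    moreover have "(\<forall>p\<in>set l. f p = (1::real)) \<Longrightarrow> prod_list (map f l) = 1" for f and l :: "('i \<times> real) list"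
      by (induction l) auto
    ultimately have "(\<Prod>(i, s)\<leftarrow>l. if i \<in> I then of_bool (u i \<bullet> y \<le> h i + s) - of_bool (u i \<bullet> y \<le> h i) else 0) = (1::real)"
      by blast
    moreover have "\<forall>i\<in>I - r. u i \<bullet> y \<le> h i" using that by (auto simp: U_def intro: less_imp_le)
    ultimately show ?thesis unfolding F by simp
  qed
  have ind: "indicat_real (ball x b) y \<le> F y" for y
    using F0 F1 b(2) by (cases "y \<in> ball x b") auto
  have "0 < measure lebesgue (ball x b)"
    using content_ball_pos[OF b(1)] by (simp add: measure_completion)
  also have "\<dots> = (\<integral>y. indicat_real (ball x b) y \<partial>lebesgue)"
    by (simp add: lmeasure_integral_UNIV)
  also have "\<dots> \<le> (\<integral>y. F y \<partial>lebesgue)"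
    using ind lmeasurable_ball fin_diffs_vol(1)[of l h]
    by (intro integral_mono) (auto simp: F_def lmeasurable_iff_integrable)
  also have "\<dots> = fin_diffs l vol h" by (simp add: F_def fin_diffs_vol(2))
  finally show ?thesis .
qed


text \<open>\<open>q\<close> is the cone of an edge with direction \<open>z\<close>, and
  \<open>k\<close> and \<open>k'\<close> cut it off at its ends. A further ray forming a cone with
  \<open>q\<close> lies on the side of \<open>k\<close> or on that of \<open>k'\<close> of the
  hyperplane spanned by \<open>q\<close>, where two cones would share interior vectors.\<close>

lemma wall_neighbours:
  assumes ne: "type_cone \<noteq> {}"
    and w: "insert k q \<in> vertex_cones" "insert k' q \<in> vertex_cones" "k \<notin> q" "k' \<notin> q"
    and z: "\<And>i. i \<in> q \<Longrightarrow> u i \<bullet> z = 0" "u k \<bullet> z < 0" "0 < u k' \<bullet> z"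
    and j: "j \<notin> q" "insert j q \<in> S"
  shows "j = k \<or> j = k'"
proof -
  have eq: "j = m" if m: "insert m q \<in> vertex_cones" "m \<notin> q" "0 < (u j \<bullet> z) * (u m \<bullet> z)" for m
  proof -
    have mS: "insert m q \<in> S" using m(1) by (auto simp: vertex_cones_def)
    have finq: "finite q" using finite_cone[OF mS] by simp
    obtain c where c: "u j = (\<Sum>i\<in>insert m q. c i *\<^sub>R u i)" using vertex_cone_basis[OF m(1)] by blast
    have uj: "u j = c m *\<^sub>R u m + (\<Sum>i\<in>q. c i *\<^sub>R u i)" using c finq m(2) by simp
    have "u j \<bullet> z = c m * (u m \<bullet> z)"
      unfolding uj inner_add_left inner_sum_left using z(1) by simp
    then have "0 < c m * (u m \<bullet> z)\<^sup>2" using m(3) by (simp add: power2_eq_square mult.assoc)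
    then have cm: "0 < c m" by (simp add: zero_less_mult_iff)
    \<comment> \<open>Adding \<open>C\<close> times every ray of \<open>q\<close> to
      \<open>u j\<close> makes all coefficients with respect to \<open>insert m q\<close> positive,
      so the sum is interior to both cones.\<close>
    define C where "C = 1 + (\<Sum>i\<in>q. \<bar>c i\<bar>)"
    have C: "0 < C" by (auto simp: C_def intro!: add_pos_nonneg sum_nonneg)
    have Ci: "0 < C + c i" if "i \<in> q" for i
      using member_le_sum[of i q "\<lambda>i. \<bar>c i\<bar>"] that finq by (simp add: C_def)
    define k1 where "k1 i = (if i = j then 1 else C)" for i
    define k2 where "k2 i = (if i = m then c m else C + c i)" for i
    have s1: "(\<Sum>i\<in>q. k1 i *\<^sub>R u i) = (\<Sum>i\<in>q. C *\<^sub>R u i)" using j(1) by (intro sum.cong) (auto simp: k1_def)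
    have s2: "(\<Sum>i\<in>q. k2 i *\<^sub>R u i) = (\<Sum>i\<in>q. (C + c i) *\<^sub>R u i)" using m(2) by (intro sum.cong) (auto simp: k2_def)
    have "(\<Sum>i\<in>insert j q. k1 i *\<^sub>R u i) = u j + (\<Sum>i\<in>q. C *\<^sub>R u i)"
      using finq j(1) by (simp add: s1) (simp add: k1_def)
    also have "\<dots> = (\<Sum>i\<in>insert m q. k2 i *\<^sub>R u i)"
      using finq m(2) by (simp add: s2) (simp add: k2_def uj scaleR_left_distrib sum.distrib)
    finally have "insert j q = insert m q"
      using C Ci cm by (intro cone_unique[OF ne j(2) mS, of k1 k2]) (auto simp: k1_def k2_def)
    then show ?thesis using j(1) m(2) by blast
  qed
  have kS: "insert k q \<in> S" using w(1) by (auto simp: vertex_cones_def)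
  \<comment> \<open>A ray orthogonal to \<open>z\<close> would be a combination of the rays of
    \<open>q\<close>, against the independence of \<open>insert j q\<close>.\<close>
  have "u j \<bullet> z \<noteq> 0"
  proof
    assume 0: "u j \<bullet> z = 0"
    have finq: "finite q" using finite_cone[OF kS] by simp
    obtain c where c: "u j = (\<Sum>i\<in>insert k q. c i *\<^sub>R u i)" using vertex_cone_basis[OF w(1)] by blast
    have uj: "u j = c k *\<^sub>R u k + (\<Sum>i\<in>q. c i *\<^sub>R u i)" using c finq w(3) by simp
    have "u j \<bullet> z = c k * (u k \<bullet> z)"
      unfolding uj inner_add_left inner_sum_left using z(1) by simp
    then have "c k = 0" using 0 z(2) by simp
    then have uj: "u j = (\<Sum>i\<in>q. c i *\<^sub>R u i)" using uj by simp
    obtain v where v: "\<forall>i\<in>insert j q. u i \<bullet> v = (if i = j then 1 else 0)" 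
      using solvable[OF j(2), of "\<lambda>i. if i = j then 1 else 0"] by blast
    have "u j \<bullet> v = (\<Sum>i\<in>q. c i * (u i \<bullet> v))" by (subst uj) (simp add: inner_sum_left)
    also have "\<dots> = 0" using v j(1) by (intro sum.neutral) auto
    finally show False using v by simp
  qed
  then show ?thesis
    using eq[OF w(1,3)] eq[OF w(2,4)] z(2,3) by (cases "u j \<bullet> z < 0") (auto simp: mult_neg_neg)
qed

text \<open>The mixed difference over \<open>q\<close> depends only on the support numbers in
  \<open>q\<close> and on those of \<open>k\<close> and \<open>k'\<close>, and of these the
  deformation changes at most that of \<open>k\<close>. Invariance of the volume would then make the
  difference over \<open>insert k q\<close> zero, although it is positive. In geometric terms, the
  edge would change its length.\<close>

lemma deformation_across_wall:
  assumes h: "h \<in> type_cone"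
    and inv: "\<And>H t. H \<in> type_cone \<Longrightarrow> (\<lambda>i. H i + t * a i) \<in> type_cone \<Longrightarrow> vol (\<lambda>i. H i + t * a i) = vol H"
    and w: "insert k q \<in> vertex_cones" "insert k' q \<in> vertex_cones" "k \<notin> q" "k' \<notin> q"
    and z: "\<And>i. i \<in> q \<Longrightarrow> u i \<bullet> z = 0" "u k \<bullet> z < 0" "0 < u k' \<bullet> z"
    and a: "\<And>i. i \<in> insert k' q \<Longrightarrow> a i = 0"
  shows "a k = 0"
proof (rule ccontr)
  assume ak: "a k \<noteq> 0"
  have kS: "insert k q \<in> S" using w(1) by (auto simp: vertex_cones_def)
  have finq: "finite q" using finite_cone[OF kS] by simp
  have qI: "q \<subseteq> I" "k \<in> I" using cone_subset[OF kS] by auto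
  have ne: "type_cone \<noteq> {}" using h by blast
  define J where "J = {j \<in> I - q. insert j q \<notin> S}"
  have JI: "J \<subseteq> I" by (auto simp: J_def)
  have van: "vanishing h (add_mset j (mset_set q))" if "j \<in> J" for j
  proof -
    have "vanishing h (mset_set (insert j q))" using that qI by (intro vanishing_noncone[OF h]) (auto simp: J_def)
    then show ?thesis using that finq by (simp add: J_def)
  qed
  obtain e1 where e1: "e1 > 0" "insensitive h (mset_set q) J e1" using vanishing_insensitive[OF JI van] by blast
  obtain e2 where e2: "e2 > 0" "\<And>H'. (\<forall>i\<in>I. \<bar>H' i - h i\<bar> < e2) \<Longrightarrow> H' \<in> type_cone"
    using type_cone_open[OF h] by metis
  obtain qs where qs: "set qs = q" "distinct qs" using finite_distinct_list[OF finq] by blast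
  define A where "A = 1 + (\<Sum>i\<in>I. \<bar>a i\<bar>)"
  have A: "A \<ge> 1" by (simp add: A_def sum_nonneg)
  have Ai: "\<bar>a i\<bar> \<le> A" if "i \<in> I" for i
    using member_le_sum[of i I "\<lambda>i. \<bar>a i\<bar>"] that finite_I by (simp add: A_def)
  define m where "m = min e1 e2"
  have m: "m > 0" "m \<le> e1" "m \<le> e2" using e1 e2 by (auto simp: m_def)
  \<comment> \<open>The sign makes \<open>t * a k\<close> a positive step, as
    \<open>fin_diffs_pos\<close> demands; the size keeps every \<open>t * a i\<close> within
    \<open>m / 4\<close>.\<close>
  define t where "t = sgn (a k) * (m / (4 * A))"
  have tA: "\<bar>t\<bar> * A = m / 4" using A m ak by (simp add: t_def abs_mult abs_sgn_eq)
  have "t * a k = \<bar>a k\<bar> * (m / (4 * A))" by (simp add: t_def abs_sgn mult_ac)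
  also have "\<dots> > 0" using ak A m by (intro mult_pos_pos divide_pos_pos) auto
  finally have tak: "t * a k > 0" .
  have ta: "\<bar>t * a i\<bar> \<le> m / 4" if "i \<in> I" for i
    unfolding tA[symmetric] abs_mult using Ai[OF that] by (intro mult_left_mono) auto
  define n where "n = 1 + real (length qs)"
  \<comment> \<open>All the steps over \<open>qs\<close> together amount to at most
    \<open>m / 4\<close>.\<close>
  define s where "s = m / (4 * n)"
  have n: "n \<ge> 1" by (simp add: n_def)
  have s0: "s > 0" using m n by (auto simp: s_def intro!: divide_pos_pos)
  have ns: "n * s = m / 4" using n by (simp add: s_def)
  have sl: "real (length qs) * s \<le> m / 4"
    unfolding ns[symmetric] using s0 by (intro mult_right_mono) (auto simp: n_def)
  have s1: "s \<le> m / 4"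
    using mult_right_mono[OF n, of s] s0 unfolding ns by simp
  \<comment> \<open>Invariance is needed at every base point that the iterated differences reach.
    The budget of three quarters of \<open>m\<close> leaves one quarter for the deformation
    itself.\<close>
  have shift: "fin_diffs (map (\<lambda>i. (i, s)) xs) vol (\<lambda>i. H i + t * a i) = fin_diffs (map (\<lambda>i. (i, s)) xs) vol H"
    if "\<forall>i\<in>I. \<bar>H i - h i\<bar> + real (length xs) * s < m * (3/4)" for xs H
    using that
  proof (induction xs arbitrary: H)
    case Nil
    have "H \<in> type_cone" using Nil m by (intro e2(2)) force
    moreover have "(\<lambda>i. H i + t * a i) \<in> type_cone"
    proof (rule e2(2), rule ballI)
      fix i assume i: "i \<in> I"
      have "\<bar>H i - h i\<bar> < m * (3/4)" using Nil i by simp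
      then show "\<bar>H i + t * a i - h i\<bar> < e2" using ta[OF i] m by linarith
    qed
    ultimately show ?case using inv by simp
  next
    case (Cons x xs)
    have 1: "fin_diffs (map (\<lambda>i. (i, s)) xs) vol (\<lambda>i. H i + t * a i) = fin_diffs (map (\<lambda>i. (i, s)) xs) vol H"
    proof (rule Cons.IH, rule ballI)
      fix i assume "i \<in> I"
      then have "\<bar>H i - h i\<bar> + real (length (x # xs)) * s < m * (3/4)" using Cons.prems by blast
      then show "\<bar>H i - h i\<bar> + real (length xs) * s < m * (3/4)" using s0 by (simp add: algebra_simps)
    qed
    have 2: "fin_diffs (map (\<lambda>i. (i, s)) xs) vol (\<lambda>i. (H(x := H x + s)) i + t * a i)
      = fin_diffs (map (\<lambda>i. (i, s)) xs) vol (H(x := H x + s))"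
    proof (rule Cons.IH, rule ballI)
      fix i assume "i \<in> I"
      then have "\<bar>H i - h i\<bar> + real (length (x # xs)) * s < m * (3/4)" using Cons.prems by blast
      then have *: "\<bar>H i - h i\<bar> + s + real (length xs) * s < m * (3/4)" by (simp add: algebra_simps)
      have "(H(x := H x + s)) i = H i \<or> (H(x := H x + s)) i = H i + s" by simp
      then have "\<bar>(H(x := H x + s)) i - h i\<bar> \<le> \<bar>H i - h i\<bar> + s" using s0 by linarith
      then show "\<bar>(H(x := H x + s)) i - h i\<bar> + real (length xs) * s < m * (3/4)" using * by linarith
    qed
    have "(\<lambda>i. H i + t * a i)(x := H x + t * a x + s) = (\<lambda>i. (H(x := H x + s)) i + t * a i)" by auto
    then show ?case using 1 2 by (simp only: list.map fin_diffs_Cons fin_diff_def)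
  qed
  define l where "l = map (\<lambda>i. (i, s)) qs"
  have mset_l: "image_mset fst (mset l) = mset_set q"
    using mset_set_set[OF qs(2)] qs(1) by (simp add: l_def image_mset.compositionality comp_def)
  have "fin_diffs l vol h = fin_diffs l vol (\<lambda>i. h i + t * a i)"
    unfolding l_def by (rule shift[symmetric]) (use sl m in force)
  also have "\<dots> = fin_diffs l vol (h(k := h k + t * a k))"
  proof (rule e1(2)[unfolded insensitive_def, rule_format, OF mset_l])
    show "\<bar>snd p\<bar> < e1" if "p \<in> set l" for p using that s0 s1 m by (auto simp: l_def)
    show "\<bar>h i + t * a i - h i\<bar> < e1 / 2" if "i \<in> I" for i using ta[OF that] m by linarith
    have le: "\<bar>(h(k := h k + t * a k)) i - h i\<bar> \<le> \<bar>t * a i\<bar>" for i by simp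
    show "\<bar>(h(k := h k + t * a k)) i - h i\<bar> < e1 / 2" if "i \<in> I" for i
      using le[of i] ta[OF that] m by linarith
    show "h i + t * a i = (h(k := h k + t * a k)) i" if "i \<in> I - J" for i
    proof (cases "i \<in> q")
      case True
      then show ?thesis using a w(3) by auto
    next
      case False
      then have "insert i q \<in> S" using that by (auto simp: J_def)
      then have "i = k \<or> i = k'" using wall_neighbours[OF ne w z False] by blast
      then show ?thesis using a by auto
    qed
  qed
  finally have "fin_diffs ((k, t * a k) # l) vol h = 0" by (simp add: fin_diff_def)
  moreover have "0 < fin_diffs ((k, t * a k) # l) vol h"
    using qs w(3) tak s0 by (intro fin_diffs_pos[OF h kS]) (auto simp: l_def comp_def image_image)
  ultimately show False by simp
qed

text \<open>Adjacent vertices of a polytope of the fan are deformed by the same translation, and by the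
  simplex algorithm every vertex is connected to a given one.\<close>

theorem volume_preserving_imp_translation:
  assumes h: "h \<in> type_cone"
    and inv: "\<And>H t. H \<in> type_cone \<Longrightarrow> (\<lambda>i. H i + t * a i) \<in> type_cone \<Longrightarrow> vol (\<lambda>i. H i + t * a i) = vol H"
  shows "\<exists>w. \<forall>i\<in>I. a i = u i \<bullet> w"
proof -
  have ne: "type_cone \<noteq> {}" using h by blast
  obtain r0 where r0: "r0 \<in> vertex_cones"
    using extend_to_vertex_cone[OF ne, of "{}"] down complete[of 0] by (metis empty_subsetI)
  have r0S: "r0 \<in> S" using r0 by (simp add: vertex_cones_def)
  \<comment> \<open>The translation that realises \<open>a\<close> at one vertex; subtracting it
    leaves a deformation \<open>b\<close> that is zero on the facets through this vertex.\<close>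
  obtain w where w: "\<And>i. i \<in> r0 \<Longrightarrow> u i \<bullet> w = a i" using solvable[OF r0S, of a] by blast
  define b where "b i = a i - u i \<bullet> w" for i
  have b0: "b i = 0" if "i \<in> r0" for i using w[OF that] by (simp add: b_def)
  have binv: "vol (\<lambda>i. H i + t * b i) = vol H" if H: "H \<in> type_cone" "(\<lambda>i. H i + t * b i) \<in> type_cone" for H t
  proof -
    have eq: "(\<lambda>i. (H i + t * b i) + u i \<bullet> (t *\<^sub>R w)) = (\<lambda>i. H i + t * a i)"
      by (simp add: b_def algebra_simps)
    have "(\<lambda>i. H i + t * a i) \<in> type_cone" using type_cone_translate[OF H(2), of "t *\<^sub>R w"] unfolding eq .
    then have "vol (\<lambda>i. H i + t * a i) = vol H" by (rule inv[OF H(1)])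
    then show ?thesis using vol_translate[of "\<lambda>i. H i + t * b i" "t *\<^sub>R w"] unfolding eq by simp
  qed
  have "\<forall>r\<in>S. \<exists>x. x \<in> hpoly h \<and> active h x = r" using type_coneE[OF h] by metis
  then obtain xv where xv: "\<And>r. r \<in> S \<Longrightarrow> xv r \<in> hpoly h" "\<And>r. r \<in> S \<Longrightarrow> active h (xv r) = r"
    by (metis (full_types))
  \<comment> \<open>Among the vertices, this functional is maximal only at that of
    \<open>r0\<close>. The induction climbs from a vertex to a higher one, counting the vertices
    strictly above.\<close>
  define c where "c = (\<Sum>i\<in>r0. u i)"
  have finV: "finite vertex_cones" using finite_S by (simp add: vertex_cones_def)
  have bV: "\<forall>i\<in>r. b i = 0" if "r \<in> vertex_cones" for r
    using that
  proof (induction "card {p \<in> vertex_cones. c \<bullet> xv p > c \<bullet> xv r}" arbitrary: r rule: less_induct)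
    case less
    show ?case
    proof (cases "r = r0")
      case False
      have rS: "r \<in> S" "card r = DIM('a)" using less.prems by (auto simp: vertex_cones_def)
      have finr: "finite r" using finite_cone[OF rS(1)] .
      obtain v where v: "\<And>i j. i \<in> r \<Longrightarrow> j \<in> r \<Longrightarrow> u j \<bullet> v i = (if i = j then 1 else 0)"
        using dual_vectors[OF rS(1)] by metis
      define y where "y = xv r0 - xv r"
      have yr: "u j \<bullet> y \<le> 0" if "j \<in> r" for j
      proof -
        have "u j \<bullet> xv r = h j" using xv(2)[OF rS(1)] that by (auto simp: active_def)
        moreover have "u j \<bullet> xv r0 \<le> h j" using xv(1)[OF r0S] that cone_subset[OF rS(1)] by (auto simp: hpoly_def)
        ultimately show ?thesis by (simp add: y_def inner_diff_right)
      qed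
      have "y - (\<Sum>i\<in>r. (u i \<bullet> y) *\<^sub>R v i) = 0"
      proof (rule vertex_cone_orthogonal[OF less.prems])
        fix j assume j: "j \<in> r"
        have "u j \<bullet> (\<Sum>i\<in>r. (u i \<bullet> y) *\<^sub>R v i) = (\<Sum>i\<in>r. if i = j then u i \<bullet> y else 0)"
          unfolding inner_sum_right using j by (intro sum.cong) (auto simp: v)
        then show "u j \<bullet> (y - (\<Sum>i\<in>r. (u i \<bullet> y) *\<^sub>R v i)) = 0" using j finr by (simp add: inner_diff_right)
      qed
      then have y: "y = (\<Sum>i\<in>r. (u i \<bullet> y) *\<^sub>R v i)" by simp
      have cy: "0 < c \<bullet> y"
      proof -
        have "\<not> r0 \<subseteq> r" using False card_subset_eq[OF finr, of r0] rS(2) r0 by (auto simp: vertex_cones_def)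
        then obtain i0 where i0: "i0 \<in> r0" "i0 \<notin> r" by blast
        have le: "u i \<bullet> xv r \<le> h i" if "i \<in> r0" for i
          using xv(1)[OF rS(1)] that cone_subset[OF r0S] by (auto simp: hpoly_def)
        have "u i0 \<bullet> xv r \<noteq> h i0" using i0 xv(2)[OF rS(1)] cone_subset[OF r0S] by (auto simp: active_def)
        then have "(\<Sum>i\<in>r0. u i \<bullet> xv r) < (\<Sum>i\<in>r0. h i)"
          using le i0 finite_cone[OF r0S]
          by (intro sum_strict_mono_ex1) (auto intro!: bexI[of _ i0] simp: less_le)
        also have "\<dots> = (\<Sum>i\<in>r0. u i \<bullet> xv r0)"
        proof (rule sum.cong)
          fix i assume "i \<in> r0"
          then have "i \<in> active h (xv r0)" using xv(2)[OF r0S] by simp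
          then show "h i = u i \<bullet> xv r0" by (simp add: active_def)
        qed simp
        finally show ?thesis by (simp add: c_def y_def inner_diff_right inner_sum_left)
      qed
      \<comment> \<open>The vector \<open>y\<close> towards the top vertex is a nonnegative
        combination of the edge directions \<open>- v i\<close>, so \<open>c\<close> increases along
        one of these edges.\<close>
      have "\<exists>k\<in>r. 0 < (u k \<bullet> y) * (c \<bullet> v k)"
      proof (rule ccontr)
        assume "\<not> ?thesis"
        then have "(\<Sum>i\<in>r. (u i \<bullet> y) * (c \<bullet> v i)) \<le> 0" by (intro sum_nonpos) force
        moreover have "c \<bullet> y = (\<Sum>i\<in>r. (u i \<bullet> y) * (c \<bullet> v i))" by (subst y) (simp add: inner_sum_right)
        ultimately show False using cy by simp
      qed
      then obtain k where k: "k \<in> r" "0 < (u k \<bullet> y) * (c \<bullet> v k)" by blast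
      then have cv: "c \<bullet> v k < 0" using yr[OF k(1)] by (auto simp: zero_less_mult_iff)
      define z where "z = - v k"
      have z: "u j \<bullet> z = (if j = k then -1 else 0)" if "j \<in> r" for j using v[OF k(1) that] by (simp add: z_def)
      have z0: "z \<noteq> 0" using z[OF k(1)] by auto
      obtain t k' where t: "t > 0" "xv r + t *\<^sub>R z \<in> hpoly h" "k' \<in> active h (xv r + t *\<^sub>R z)" "0 < u k' \<bullet> z"
        by (rule ray_hits_facet[OF xv(1)[OF rS(1)] z0]) (use z xv(2)[OF rS(1)] in \<open>auto split: if_splits\<close>)
      define r' where "r' = active h (xv r + t *\<^sub>R z)"
      define q where "q = r - {k}"
      have r'S: "r' \<in> S" unfolding r'_def by (rule active_in_S[OF h t(2)])
      have k'r: "k' \<notin> r" using t(4) z[of k'] by (auto split: if_splits)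
      have "u j \<bullet> (xv r + t *\<^sub>R z) = h j" if "j \<in> q" for j
        using that z[of j] xv(2)[OF rS(1)] by (auto simp: q_def active_def inner_add_right)
      then have sub: "insert k' q \<subseteq> r'" using t(3) cone_subset[OF rS(1)] by (auto simp: r'_def active_def q_def)
      have cardq: "card (insert k' q) = DIM('a)"
        using k'r k(1) finr rS(2) by (simp add: q_def card_insert_if card_Diff_singleton card_gt_0_iff)
      \<comment> \<open>No cone has more rays than the dimension, so no further facet is active at
        the far end of the edge.\<close>
      have "r' = insert k' q"
        using card_seteq[OF finite_cone[OF r'S] sub] cardq card_cone_le[OF r'S] by simp
      then have r'V: "r' \<in> vertex_cones" and r'q: "insert k' q \<in> vertex_cones"
        using r'S cardq by (auto simp: vertex_cones_def)
      have xr': "xv r' = xv r + t *\<^sub>R z"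
      proof -
        have "xv r' - (xv r + t *\<^sub>R z) = 0"
        proof (rule vertex_cone_orthogonal[OF r'V])
          fix i assume i: "i \<in> r'"
          then have "u i \<bullet> xv r' = h i" using xv(2)[OF r'S] by (auto simp: active_def)
          moreover have "u i \<bullet> (xv r + t *\<^sub>R z) = h i" using i by (auto simp: r'_def active_def)
          ultimately show "u i \<bullet> (xv r' - (xv r + t *\<^sub>R z)) = 0" by (simp add: inner_diff_right)
        qed
        then show ?thesis by simp
      qed
      have up: "c \<bullet> xv r < c \<bullet> xv r'" using cv t(1) by (simp add: xr' z_def inner_diff_right mult_pos_neg)
      have "{p \<in> vertex_cones. c \<bullet> xv p > c \<bullet> xv r'} \<subset> {p \<in> vertex_cones. c \<bullet> xv p > c \<bullet> xv r}"
        using up r'V by force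
      then have "card {p \<in> vertex_cones. c \<bullet> xv p > c \<bullet> xv r'} < card {p \<in> vertex_cones. c \<bullet> xv p > c \<bullet> xv r}"
        using finV by (intro psubset_card_mono) auto
      from less.hyps[OF this r'V] have br': "\<forall>i\<in>insert k' q. b i = 0" using \<open>r' = insert k' q\<close> by simp
      have rq: "insert k q = r" using k(1) by (auto simp: q_def)
      have "b k = 0"
      proof (rule deformation_across_wall[OF h binv, where q = q and k' = k' and z = z])
        show "insert k q \<in> vertex_cones" using less.prems rq by simp
        show "u k \<bullet> z < 0" using z[OF k(1)] by simp
        show "u i \<bullet> z = 0" if "i \<in> q" for i using z[of i] that by (auto simp: q_def)
      qed (use r'q k'r t(4) br' in \<open>auto simp: q_def\<close>)
      then show ?thesis using br' rq by blast
    qed (use b0 in blast)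
  qed
  have "a i = u i \<bullet> w" if i: "i \<in> I" for i
  proof -
    obtain q where "q \<in> vertex_cones" "{i} \<subseteq> q" using extend_to_vertex_cone[OF ne ray[OF i]] by blast
    then have "b i = 0" using bV by blast
    then show ?thesis by (simp add: b_def)
  qed
  then show ?thesis by blast
qed

end

subsection \<open>Constant-coefficient differential operators on polynomial functions\<close>

text \<open>The domain is a bare real vector space without topology, as virtual polytopes form one.
  Derivatives are therefore taken along lines, where the functions restrict to univariate
  polynomials.\<close>

locale linear_functionals =
  fixes L :: "('v::real_vector \<Rightarrow> real) set"
  assumes linear_L: "l \<in> L \<Longrightarrow> linear l"
begin

lemma along_line:
  assumes "p \<in> poly_functions L"
  shows "\<exists>q. \<forall>t. p (x + t *\<^sub>R v) = poly q t"
proof (rule poly_functions_along_curve[OF assms])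
  fix l assume "l \<in> L"
  then have "l (x + t *\<^sub>R v) = poly [:l x, l v:] t" for t
    using linear_L by (simp add: linear_add linear_cmul)
  then show "\<exists>q. \<forall>t. l (x + t *\<^sub>R v) = poly q t" by blast
qed

lemma has_dir_deriv:
  assumes "p \<in> poly_functions L"
  shows "((\<lambda>t. p (x + t *\<^sub>R v)) has_real_derivative dir_deriv v p x) (at 0)"
proof -
  obtain q where q: "\<And>t. p (x + t *\<^sub>R v) = poly q t" using along_line[OF assms] by metis
  show ?thesis unfolding q dir_deriv_def DERIV_deriv_iff_real_differentiable
    by (intro differentiableI[OF poly_DERIV[unfolded has_field_derivative_def]])
qed

lemma dir_derivI:
  assumes "\<And>x. ((\<lambda>t. p (x + t *\<^sub>R v)) has_real_derivative d x) (at 0)"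
  shows "dir_deriv v p = d"
  using assms by (auto simp: fun_eq_iff dir_deriv_def intro: DERIV_imp_deriv)

lemma dir_deriv_const [simp]: "dir_deriv v (\<lambda>_. c) = (\<lambda>_. 0)"
  by (rule dir_derivI) simp

lemma dir_deriv_gen: "l \<in> L \<Longrightarrow> dir_deriv v l = (\<lambda>_. l v)"
  by (rule dir_derivI) (auto simp: linear_add[OF linear_L] linear_cmul[OF linear_L] intro!: derivative_eq_intros)

lemma dir_deriv_add:
  assumes "p \<in> poly_functions L" "q \<in> poly_functions L"
  shows "dir_deriv v (\<lambda>x. p x + q x) = (\<lambda>x. dir_deriv v p x + dir_deriv v q x)"
  by (rule dir_derivI) (intro DERIV_add has_dir_deriv assms)

lemma dir_deriv_mult:
  assumes "p \<in> poly_functions L" "q \<in> poly_functions L"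
  shows "dir_deriv v (\<lambda>x. p x * q x) = (\<lambda>x. dir_deriv v p x * q x + dir_deriv v q x * p x)"
proof (rule dir_derivI)
  fix x
  show "((\<lambda>t. p (x + t *\<^sub>R v) * q (x + t *\<^sub>R v)) has_real_derivative
      dir_deriv v p x * q x + dir_deriv v q x * p x) (at 0)"
    using DERIV_mult[OF has_dir_deriv[OF assms(1), of x v] has_dir_deriv[OF assms(2), of x v]] by simp
qed

lemma dir_deriv_closed:
  assumes "p \<in> poly_functions L" shows "dir_deriv v p \<in> poly_functions L"
  using assms by induction
    (auto simp: dir_deriv_gen dir_deriv_add dir_deriv_mult intro: poly_functions.intros)

lemma dir_deriv_cmult:
  assumes "p \<in> poly_functions L"
  shows "dir_deriv v (\<lambda>x. c * p x) = (\<lambda>x. c * dir_deriv v p x)"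
  by (subst dir_deriv_mult) (auto intro: poly_functions.const assms)

lemma dir_deriv_commute:
  assumes "p \<in> poly_functions L"
  shows "dir_deriv v (dir_deriv w p) = dir_deriv w (dir_deriv v p)"
  using assms
proof induction
  case (add p q)
  then show ?case by (simp add: dir_deriv_add dir_deriv_closed)
next
  case (mult p q)
  have "dir_deriv a (dir_deriv b (\<lambda>x. p x * q x)) = (\<lambda>x. dir_deriv a (dir_deriv b p) x * q x + dir_deriv a q x * dir_deriv b p x
      + (dir_deriv a (dir_deriv b q) x * p x + dir_deriv a p x * dir_deriv b q x))" for a b
    using mult.hyps by (simp add: dir_deriv_mult dir_deriv_add dir_deriv_closed poly_functions.mult)
  then show ?case using mult.IH by (simp add: fun_eq_iff mult.commute)
qed (simp_all add: dir_deriv_gen)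

lemma dir_deriv_linear:
  assumes "p \<in> poly_functions L" shows "linear (\<lambda>v. dir_deriv v p x)"
proof (rule linearI)
  fix v w :: 'v and c :: real
  show "dir_deriv (v + w) p x = dir_deriv v p x + dir_deriv w p x"
    using assms by induction
      (auto simp: dir_deriv_gen dir_deriv_add dir_deriv_mult linear_add[OF linear_L] algebra_simps)
  show "dir_deriv (c *\<^sub>R v) p x = c *\<^sub>R dir_deriv v p x"
    using assms by induction
      (auto simp: dir_deriv_gen dir_deriv_add dir_deriv_mult linear_cmul[OF linear_L] algebra_simps)
qed

lemma dir_deriv_zero_imp_invariant:
  assumes "p \<in> poly_functions L" "\<And>x. dir_deriv v p x = 0"
  shows "p (x + t *\<^sub>R v) = p x"
proof -
  have "((\<lambda>t. p (x + t *\<^sub>R v)) has_real_derivative 0) (at s)" for s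
  proof -
    have "((\<lambda>t. p (x + s *\<^sub>R v + t *\<^sub>R v)) has_real_derivative 0) (at 0)"
      using has_dir_deriv[OF assms(1), of "x + s *\<^sub>R v" v] assms(2) by simp
    moreover have "(\<lambda>t. p (x + s *\<^sub>R v + t *\<^sub>R v)) = (\<lambda>t. p (x + (t + s) *\<^sub>R v))"
      by (simp add: scaleR_left_distrib add_ac)
    ultimately show ?thesis using DERIV_shift[of "\<lambda>t. p (x + t *\<^sub>R v)" 0 0 s] by simp
  qed
  then have "(\<lambda>t. p (x + t *\<^sub>R v)) t = (\<lambda>t. p (x + t *\<^sub>R v)) 0" by (intro DERIV_isconst_all) blast
  then show ?thesis by simp
qed

lemma foldr_dir_deriv_closed: "p \<in> poly_functions L \<Longrightarrow> foldr dir_deriv vs p \<in> poly_functions L"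
  by (induction vs) (auto intro: dir_deriv_closed)

lemma foldr_dir_deriv_remove1:
  assumes "p \<in> poly_functions L" "v \<in> set vs"
  shows "foldr dir_deriv vs p = dir_deriv v (foldr dir_deriv (remove1 v vs) p)"
  using assms(2)
  by (induction vs) (auto simp: dir_deriv_commute foldr_dir_deriv_closed[OF assms(1)])

lemma foldr_dir_deriv_perm:
  assumes "p \<in> poly_functions L" "mset vs = mset ws"
  shows "foldr dir_deriv vs p = foldr dir_deriv ws p"
  using assms(2)
proof (induction vs arbitrary: ws)
  case (Cons v vs)
  then have "v \<in> set ws" by (metis list.set_intros(1) mset_eq_setD)
  moreover have "mset vs = mset (remove1 v ws)"
    using Cons.prems by (metis mset.simps(2) mset_remove1 add_mset_remove_trivial)
  ultimately show ?case using Cons.IH[of "remove1 v ws"] foldr_dir_deriv_remove1[OF assms(1), of v ws] by simp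
qed simp

lemma mset_deriv_eq:
  assumes "p \<in> poly_functions L" shows "mset_deriv (mset vs) p = foldr dir_deriv vs p"
  unfolding mset_deriv_def
  by (rule foldr_dir_deriv_perm[OF assms]) (rule someI[of "\<lambda>ws. mset ws = mset vs" vs], simp)

lemma mset_deriv_closed: "p \<in> poly_functions L \<Longrightarrow> mset_deriv M p \<in> poly_functions L"
  unfolding mset_deriv_def by (rule foldr_dir_deriv_closed)

lemma mset_deriv_union:
  assumes "p \<in> poly_functions L" shows "mset_deriv (M + N) p = mset_deriv M (mset_deriv N p)"
proof -
  obtain vs ws where "M = mset vs" "N = mset ws" using ex_mset by metis
  then show ?thesis
    using mset_deriv_eq[OF assms, of "vs @ ws"] mset_deriv_eq[OF assms, of ws]
      mset_deriv_eq[OF foldr_dir_deriv_closed[OF assms], of vs ws] by simp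
qed

lemma mset_deriv_single: "p \<in> poly_functions L \<Longrightarrow> mset_deriv {#v#} p = dir_deriv v p"
  using mset_deriv_eq[of p "[v]"] by simp

lemma mset_deriv_add:
  assumes "p \<in> poly_functions L" "q \<in> poly_functions L"
  shows "mset_deriv M (\<lambda>x. p x + q x) = (\<lambda>x. mset_deriv M p x + mset_deriv M q x)"
proof -
  obtain vs where M: "M = mset vs" using ex_mset by metis
  have "foldr dir_deriv vs (\<lambda>x. p x + q x) = (\<lambda>x. foldr dir_deriv vs p x + foldr dir_deriv vs q x)"
    by (induction vs) (auto simp: dir_deriv_add foldr_dir_deriv_closed assms)
  then show ?thesis by (simp add: M mset_deriv_eq assms poly_functions.add)
qed

lemma mset_deriv_cmult:
  assumes "p \<in> poly_functions L"
  shows "mset_deriv M (\<lambda>x. c * p x) = (\<lambda>x. c * mset_deriv M p x)"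
proof -
  obtain vs where M: "M = mset vs" using ex_mset by metis
  have "foldr dir_deriv vs (\<lambda>x. c * p x) = (\<lambda>x. c * foldr dir_deriv vs p x)"
    by (induction vs) (auto simp: dir_deriv_cmult foldr_dir_deriv_closed assms)
  then show ?thesis by (simp add: M mset_deriv_eq assms poly_functions.mult poly_functions.const)
qed

end

lemma diff_op_superset:
  assumes "finite K" "Poly_Mapping.keys p \<subseteq> K"
  shows "diff_op p f x = (\<Sum>M\<in>K. of_int (Poly_Mapping.lookup p M) * mset_deriv M f x)"
  unfolding diff_op_def using assms by (intro sum.mono_neutral_left) (auto simp: in_keys_iff)

lemma diff_op_add [simp]: "diff_op (p + q) f x = diff_op p f x + diff_op q f x"
proof -
  define K where "K = Poly_Mapping.keys p \<union> Poly_Mapping.keys q"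
  have "diff_op r f x = (\<Sum>M\<in>K. of_int (Poly_Mapping.lookup r M) * mset_deriv M f x)"
    if "r \<in> {p, q, p + q}" for r
    using that Poly_Mapping.keys_add[of p q] by (intro diff_op_superset) (auto simp: K_def)
  then show ?thesis by (simp add: lookup_add distrib_right sum.distrib)
qed

lemma diff_op_zero [simp]: "diff_op 0 f x = 0"
  by (simp add: diff_op_def)

lemma diff_op_uminus [simp]: "diff_op (- p) f x = - diff_op p f x"
  using diff_op_add[of p "- p" f x] by simp

lemma diff_op_diff [simp]: "diff_op (p - q) f x = diff_op p f x - diff_op q f x"
  using diff_op_add[of p "- q" f x] by simp

lemma diff_op_single: "diff_op (Poly_Mapping.single M k) f x = of_int k * mset_deriv M f x"
  by (subst diff_op_superset[of "{M}"]) auto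

lemma poly_mapping_single_induct [case_names zero single_add]:
  fixes p :: "'a \<Rightarrow>\<^sub>0 'b::comm_monoid_add"
  assumes "P 0" "\<And>M k p. P p \<Longrightarrow> P (Poly_Mapping.single M k + p)"
  shows "P p"
proof (induction p rule: Poly_Mapping.update_induct)
  case (update f a b)
  have "Poly_Mapping.update a b f = Poly_Mapping.single a b + f"
    using update(1) by (intro poly_mapping_eqI) (auto simp: lookup_update lookup_add lookup_single when_def in_keys_iff)
  then show ?case using assms(2)[OF update(3), of a b] by simp
qed (rule assms(1))

context linear_functionals
begin

lemma diff_op_closed:
  assumes "f \<in> poly_functions L" shows "diff_op p f \<in> poly_functions L"
  unfolding diff_op_def[abs_def]
  by (intro poly_functions_sum poly_functions.mult poly_functions.const mset_deriv_closed assms) simp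

text \<open>Products of operators act by composition; this makes the operators that kill
  \<open>f\<close> an ideal.\<close>

lemma diff_op_single_mult:
  assumes "f \<in> poly_functions L"
  shows "diff_op (Poly_Mapping.single M k * p) f x = of_int k * mset_deriv M (diff_op p f) x"
proof (induction p arbitrary: x rule: poly_mapping_single_induct)
  case zero
  have "mset_deriv M (\<lambda>x. 0 * f x) = (\<lambda>x. 0 * mset_deriv M f x)" by (rule mset_deriv_cmult[OF assms])
  then show ?case by (simp add: diff_op_def[abs_def])
next
  case (single_add N j p)
  have eq: "diff_op (Poly_Mapping.single N j + p) f = (\<lambda>x. of_int j * mset_deriv N f x + diff_op p f x)"
    by (simp add: fun_eq_iff diff_op_single)
  have e1: "mset_deriv M (diff_op (Poly_Mapping.single N j + p) f)
      = (\<lambda>x. of_int j * mset_deriv (M + N) f x + mset_deriv M (diff_op p f) x)"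
    unfolding eq
    by (simp add: mset_deriv_add mset_deriv_cmult mset_deriv_union assms mset_deriv_closed diff_op_closed
        poly_functions.mult poly_functions.const)
  have e2: "diff_op (Poly_Mapping.single M k * (Poly_Mapping.single N j + p)) f x
      = of_int (k * j) * mset_deriv (M + N) f x + diff_op (Poly_Mapping.single M k * p) f x"
    by (simp add: distrib_left mult_single diff_op_single)
  show ?case unfolding e1 e2 single_add by (simp add: algebra_simps)
qed

lemma diff_op_mult_eq_zero:
  assumes "f \<in> poly_functions L" "\<And>x. diff_op p f x = 0"
  shows "diff_op (q * p) f x = 0"
proof (induction q arbitrary: x rule: poly_mapping_single_induct)
  case (single_add M k q)
  have "diff_op p f = (\<lambda>x. 0 * f x)" using assms(2) by (simp add: fun_eq_iff)
  then have "diff_op (Poly_Mapping.single M k * p) f x = 0"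
    using diff_op_single_mult[OF assms(1), of M k p x] mset_deriv_cmult[OF assms(1), of M 0] by simp
  then show ?case using single_add by (simp add: distrib_right)
qed simp

lemma diff_op_poly_var:
  "f \<in> poly_functions L \<Longrightarrow> diff_op (poly_var v) f x = dir_deriv v f x"
  by (simp add: poly_var_def diff_op_single mset_deriv_single)

end

subsection \<open>The ring of differential operators\<close>

lemma cring_int_poly_ring: "cring (int_poly_ring U)"
proof (rule cringI)
  show "abelian_group (int_poly_ring U)"
  proof (rule abelian_groupI)
    fix x y assume "x \<in> carrier (int_poly_ring U)" "y \<in> carrier (int_poly_ring U)"
    then show "x \<oplus>\<^bsub>int_poly_ring U\<^esub> y \<in> carrier (int_poly_ring U)"
      using Poly_Mapping.keys_add[of x y] by (auto simp: int_poly_ring_def)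
  next
    fix x assume x: "x \<in> carrier (int_poly_ring U)"
    then show "\<exists>y\<in>carrier (int_poly_ring U). y \<oplus>\<^bsub>int_poly_ring U\<^esub> x = \<zero>\<^bsub>int_poly_ring U\<^esub>"
      by (intro bexI[of _ "- x"]) (auto simp: int_poly_ring_def in_keys_iff)
  qed (auto simp: int_poly_ring_def add_ac)
  show "comm_monoid (int_poly_ring U)"
  proof (rule comm_monoidI)
    fix x y assume xy: "x \<in> carrier (int_poly_ring U)" "y \<in> carrier (int_poly_ring U)"
    show "x \<otimes>\<^bsub>int_poly_ring U\<^esub> y \<in> carrier (int_poly_ring U)"
      unfolding int_poly_ring_def
    proof (simp, intro ballI)
      fix M assume "M \<in> Poly_Mapping.keys (x * y)"
      then obtain a b where "M = a + b" "a \<in> Poly_Mapping.keys x" "b \<in> Poly_Mapping.keys y"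
        using Poly_Mapping.keys_mult[of x y] by auto
      then show "set_mset M \<subseteq> U" using xy by (auto simp: int_poly_ring_def)
    qed
  qed (auto simp: int_poly_ring_def mult_ac)
qed (auto simp: int_poly_ring_def distrib_right)

text \<open>The third isomorphism theorem in the form suited to \<open>polytope_ring\<close>: the
  composite of the two quotient maps has kernel \<open>J\<close>, so that vanishing in the double
  quotient can be tested on representatives. A coset of \<open>I\<close> lies in \<open>J\<close> as
  soon as one of its representatives does, since \<open>J\<close> contains \<open>I\<close>.\<close>

lemma iterated_quotient:
  fixes R (structure)
  assumes "cring R" "ideal I R" "ideal J R" "I \<subseteq> J"
  defines "A \<equiv> {D \<in> carrier (R Quot I). D \<subseteq> J}"
  shows "ring_hom_cring R ((R Quot I) Quot A) (\<lambda>p. A +>\<^bsub>R Quot I\<^esub> (I +> p))"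
    and "\<And>p. p \<in> carrier R \<Longrightarrow>
      A +>\<^bsub>R Quot I\<^esub> (I +> p) = \<zero>\<^bsub>(R Quot I) Quot A\<^esub> \<longleftrightarrow> p \<in> J"
proof -
  interpret R: cring R by fact
  interpret I: ideal I R by fact
  interpret J: ideal J R by fact
  interpret Q: cring "R Quot I" by (rule I.quotient_is_cring) fact
  have sub: "I +> p \<subseteq> J \<longleftrightarrow> p \<in> J" if p: "p \<in> carrier R" for p
  proof
    assume "I +> p \<subseteq> J"
    moreover have "p \<in> I +> p" using p by (rule I.a_rcos_self)
    ultimately show "p \<in> J" by blast
  next
    assume "p \<in> J"
    then show "I +> p \<subseteq> J" using assms(4) J.a_closed by (auto simp: a_r_coset_def')
  qed
  have car: "carrier (R Quot I) = (+>) I ` carrier R"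
    by (auto simp: FactRing_def A_RCOSETS_def')
  have A: "A = (+>) I ` J" unfolding A_def car using sub J.a_subset by auto
  have idA: "ideal A (R Quot I)" unfolding A by (rule R.ring_ideal_imp_quot_ideal) fact+
  interpret A: ideal A "R Quot I" by (rule idA)
  interpret T: cring "(R Quot I) Quot A" by (rule A.quotient_is_cring) (rule Q.is_cring)
  have "(+>\<^bsub>R Quot I\<^esub>) A \<circ> (+>) I \<in> ring_hom R ((R Quot I) Quot A)"
    by (rule ring_hom_trans[OF I.rcos_ring_hom A.rcos_ring_hom])
  then show "ring_hom_cring R ((R Quot I) Quot A) (\<lambda>p. A +>\<^bsub>R Quot I\<^esub> (I +> p))"
    by unfold_locales (simp add: comp_def)
  show "A +>\<^bsub>R Quot I\<^esub> (I +> p) = \<zero>\<^bsub>(R Quot I) Quot A\<^esub> \<longleftrightarrow> p \<in> J" if p: "p \<in> carrier R" for p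
  proof -
    have pQ: "I +> p \<in> carrier (R Quot I)" using p car by auto
    have "A +>\<^bsub>R Quot I\<^esub> (I +> p) = A \<longleftrightarrow> I +> p \<in> A"
      using pQ A.a_rcos_const A.a_rcos_self by metis
    moreover have "I +> p \<in> A \<longleftrightarrow> p \<in> J" unfolding A_def using sub[OF p] pQ by blast
    moreover have "\<zero>\<^bsub>(R Quot I) Quot A\<^esub> = A" unfolding FactRing_def by simp
    ultimately show ?thesis by (simp only:)
  qed
qed

subsection \<open>Virtual polytopes and facet classes\<close>

lemma support_fun_singleton_zero [simp]: "support_fun {0} c = 0"
  by (simp add: support_fun_def)

lemma vp_support_vp_of: "convex_polytope A \<Longrightarrow> vp_support (vp_of A) c = support_fun A c"
  by transfer simp

lemma vp_support_diff [simp]: "vp_support (v - w) c = vp_support v c - vp_support w c"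
  by (simp only: minus_virtual_polytope_def vp_support_plus vp_support_uminus)

lemma linear_support_number: "linear (support_number Q F)"
  by (rule linearI) (simp_all add: support_number_def)

lemma add_pow_int_poly_ring:
  fixes k :: int
  assumes "p \<in> carrier (int_poly_ring U)"
  shows "[k] \<cdot>\<^bsub>int_poly_ring U\<^esub> p = of_int k * p"
proof -
  interpret cring "int_poly_ring U" by (rule cring_int_poly_ring)
  have nat: "[n] \<cdot>\<^bsub>int_poly_ring U\<^esub> p = of_nat n * p" for n :: nat
    by (induction n) (auto simp: add_pow_def nat_pow_def int_poly_ring_def distrib_right add.commute)
  have neg: "\<ominus>\<^bsub>int_poly_ring U\<^esub> q = - q" if "q \<in> carrier (int_poly_ring U)" for q
    using that by (intro minus_equality) (auto simp: int_poly_ring_def)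
  show ?thesis
  proof (cases "0 \<le> k")
    case True
    then show ?thesis by (simp add: add_pow_int_ge nat of_nat_nat)
  next
    case False
    have "[nat (- k)] \<cdot>\<^bsub>int_poly_ring U\<^esub> p \<in> carrier (int_poly_ring U)"
      using assms by (rule add.nat_pow_closed)
    then show ?thesis using False by (simp add: add_pow_int_lt neg nat of_nat_nat)
  qed
qed

lemma diff_op_of_int_mult: "diff_op (of_int k * p) f x = of_int k * diff_op p f x"
proof -
  have "diff_op (of_nat n * p) f x = of_nat n * diff_op p f x" for n
    by (induction n) (auto simp: distrib_right)
  then show ?thesis by (cases k) (auto simp: distrib_right left_diff_distrib)
qed

lemma diff_op_sum: "diff_op (\<Sum>i\<in>A. p i) f x = (\<Sum>i\<in>A. diff_op (p i) f x)"
  by (induction A rule: infinite_finite_induct) auto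

text \<open>\<open>unimodular\<close> says in dual form that the normals at a vertex generate all
  integer vectors; in this form it applies directly to vertices with integer support numbers and to
  translation vectors.\<close>

locale smooth_polytope =
  simplicial_complete_fan "{F. F facet_of Q}" "outer_normal Q" S
  for Q :: "(real^'d) set" and S +
  fixes h :: "(real^'d) set \<Rightarrow> real"
  assumes h: "h \<in> type_cone" and Q_eq: "Q = hpoly h"
    and h_integral: "F facet_of Q \<Longrightarrow> h F \<in> \<int>"
    and unimodular: "r \<in> vertex_cones \<Longrightarrow> (\<And>F. F \<in> r \<Longrightarrow> outer_normal Q F \<bullet> w \<in> \<int>) \<Longrightarrow> integral_vector w"
begin

section \<open>The space of virtual polytopes and its lattice in coordinates\<close>

abbreviation "facets \<equiv> {F. F facet_of Q}"

lemma ne: "type_cone \<noteq> {}"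
  using h by blast

lemma analogous_iff: "analogous A Q \<longleftrightarrow> (\<exists>H\<in>type_cone. A = hpoly H)"
  using analogous_hpoly_iff[OF h] by (simp add: Q_eq[symmetric])

lemma support_number_hpoly:
  assumes "H \<in> type_cone" "F facet_of Q" shows "support_number Q F (vp_of (hpoly H)) = H F"
  using assms by (simp add: support_number_def vp_support_vp_of convex_polytope_hpoly support_fun_hpoly)

text \<open>\<open>type_cone\<close> is an open cone, so a small perturbation of \<open>h\<close>
  can be scaled up. Any vector of numbers is thus a difference of two members, and the multiplier is
  an integer so that integrality is preserved.\<close>

lemma large_multiple_in_type_cone:
  shows "\<exists>m::nat. 0 < m \<and> (\<lambda>F. H F + real m * h F) \<in> type_cone"
proof -
  obtain e where e: "e > 0" "\<And>H'. (\<forall>F\<in>facets. \<bar>H' F - h F\<bar> < e) \<Longrightarrow> H' \<in> type_cone"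
    using type_cone_open[OF h] by metis
  define B where "B = (\<Sum>F\<in>facets. \<bar>H F\<bar>)"
  have B: "\<bar>H F\<bar> \<le> B" if "F facet_of Q" for F
    unfolding B_def using that finite_I by (intro member_le_sum) auto
  obtain m0 :: nat where m0: "B / e < real m0" using reals_Archimedean2 by blast
  define m where "m = Suc m0"
  have "(\<lambda>F. H F + real m * h F) \<in> type_cone"
  proof -
    have m1: "0 < real m" "real m0 < real m" by (auto simp: m_def)
    have "(\<lambda>F. h F + H F / real m) \<in> type_cone"
    proof (rule e(2), rule ballI)
      fix F assume "F \<in> facets"
      then have "\<bar>H F\<bar> \<le> B" using B by simp
      also have "B < real m0 * e" using m0 e(1) by (simp add: pos_divide_less_eq)
      also have "\<dots> < real m * e" using m1(2) e(1) by (rule mult_strict_right_mono)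
      finally show "\<bar>h F + H F / real m - h F\<bar> < e" using m1 by (simp add: pos_divide_less_eq mult.commute)
    qed
    then have "(\<lambda>F. real m * (h F + H F / real m)) \<in> type_cone" using m1(1) by (rule type_cone_scale)
    then show ?thesis using m1 by (simp add: distrib_left add.commute)
  qed
  then show ?thesis by (intro exI[of _ m] conjI) (simp add: m_def)
qed

lemma virtual_spaceI:
  "H \<in> type_cone \<Longrightarrow> H' \<in> type_cone \<Longrightarrow> vp_of (hpoly H) - vp_of (hpoly H') \<in> virtual_space Q"
  unfolding virtual_space_def analogous_iff by blast

lemma virtual_space_surj:
  obtains v where "v \<in> virtual_space Q" "\<And>F. F facet_of Q \<Longrightarrow> support_number Q F v = H F"
proof -
  from large_multiple_in_type_cone[of H]
  obtain m :: nat where m: "0 < m" "(\<lambda>F. H F + real m * h F) \<in> type_cone" by (elim exE conjE)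
  have mh: "(\<lambda>F. real m * h F) \<in> type_cone" using h m(1) by (intro type_cone_scale) auto
  show ?thesis
    using that[OF virtual_spaceI[OF m(2) mh]] support_number_hpoly[OF m(2)] support_number_hpoly[OF mh]
    by (simp add: linear_diff[OF linear_support_number])
qed

text \<open>Support functions of polytopes of the fan are linear on each cone, so their values on
  the rays determine them everywhere.\<close>

lemma virtual_space_eqI:
  assumes "v \<in> virtual_space Q" "w \<in> virtual_space Q"
    and eq: "\<And>F. F facet_of Q \<Longrightarrow> support_number Q F v = support_number Q F w"
  shows "v = w"
proof (rule vp_support_inject, rule ext)
  fix c
  obtain r k where r: "r \<in> S" "\<forall>F\<in>r. 0 < k F" "c = (\<Sum>F\<in>r. k F *\<^sub>R outer_normal Q F)" using complete by metis
  have sup: "vp_support (vp_of A) c = (\<Sum>F\<in>r. k F * support_number Q F (vp_of A))" if "analogous A Q" for A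
  proof -
    have A: "convex_polytope A" "normal_fan A = cone_of ` S"
      using that normal_fan_hpoly[OF h] by (auto simp: analogous_def Q_eq[symmetric])
    show ?thesis
      using analogous_hpoly(3)[OF ne A r(1), of k] r(2,3) A(1)
      by (simp add: vp_support_vp_of support_number_def less_imp_le)
  qed
  have lin: "vp_support v c = (\<Sum>F\<in>r. k F * support_number Q F v)" if v: "v \<in> virtual_space Q" for v
  proof -
    obtain A B where "v = vp_of A - vp_of B" "analogous A Q" "analogous B Q"
      using v unfolding virtual_space_def by blast
    then show ?thesis
      by (simp add: sup linear_diff[OF linear_support_number] right_diff_distrib sum_subtractf)
  qed
  show "vp_support v c = vp_support w c"
    unfolding lin[OF assms(1)] lin[OF assms(2)] using eq cone_subset[OF r(1)] by (intro sum.cong) auto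
qed

lemma coordinate_vector_eqI:
  assumes "v \<in> virtual_space Q"
    "\<And>G. G facet_of Q \<Longrightarrow> support_number Q G v = (if G = F then 1 else 0)"
  shows "coordinate_vector Q F = v"
  unfolding coordinate_vector_def
proof (rule the_equality)
  show "v \<in> virtual_space Q \<and> (\<forall>G. G facet_of Q \<longrightarrow> support_number Q G v = (if G = F then 1 else 0))"
    using assms by blast
  fix w assume "w \<in> virtual_space Q \<and> (\<forall>G. G facet_of Q \<longrightarrow> support_number Q G w = (if G = F then 1 else 0))"
  then show "w = v" using assms by (intro virtual_space_eqI) auto
qed

lemma coordinate_vector:
  "coordinate_vector Q F \<in> virtual_space Q"
  "G facet_of Q \<Longrightarrow> support_number Q G (coordinate_vector Q F) = (if G = F then 1 else 0)"
proof -
  obtain v where v: "v \<in> virtual_space Q"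
    "\<And>G. G facet_of Q \<Longrightarrow> support_number Q G v = (if G = F then 1 else 0)"
    using virtual_space_surj[of "\<lambda>G. if G = F then 1 else 0"] by blast
  have "coordinate_vector Q F = v" by (rule coordinate_vector_eqI[OF v])
  then show "coordinate_vector Q F \<in> virtual_space Q"
    "G facet_of Q \<Longrightarrow> support_number Q G (coordinate_vector Q F) = (if G = F then 1 else 0)"
    using v by auto
qed

lemma extreme_point_active:
  assumes H: "H \<in> type_cone" and v: "v extreme_point_of hpoly H"
  shows "active H v \<in> vertex_cones"
proof -
  have vP: "v \<in> hpoly H" using v by (simp add: extreme_point_of_def)
  define r where "r = active H v"
  have r: "r \<in> S" unfolding r_def by (rule active_in_S[OF H vP])
  have "card r = DIM(real^'d)"
  proof (rule ccontr)
    assume "card r \<noteq> DIM(real^'d)"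
    then have lt: "card r < DIM(real^'d)" using card_cone_le[OF r] by simp
    have "dim (outer_normal Q ` r) \<le> card (outer_normal Q ` r)" using finite_cone[OF r] by (intro dim_le_card') auto
    also have "\<dots> \<le> card r" by (rule card_image_le[OF finite_cone[OF r]])
    finally have "dim (outer_normal Q ` r) < DIM(real^'d)" using lt by simp
    then have "span (outer_normal Q ` r) \<noteq> UNIV" by (metis dim_UNIV dim_span less_irrefl)
    then obtain w where w: "w \<noteq> 0" "\<And>y. y \<in> span (outer_normal Q ` r) \<Longrightarrow> w \<bullet> y = 0"
      using span_not_UNIV_orthogonal by blast
    have "w = 0"
    proof (rule extreme_point_of_halfspaces[OF finite_I v[unfolded hpoly_def]])
      fix i assume "i \<in> facets" "outer_normal Q i \<bullet> v = H i"
      then have "i \<in> r" by (simp add: r_def active_def)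
      then show "outer_normal Q i \<bullet> w = 0"
        using w(2)[OF span_base, of "outer_normal Q i"] by (simp add: inner_commute)
    qed
    then show False using w(1) by blast
  qed
  then show ?thesis using r by (simp add: vertex_cones_def r_def)
qed

lemma integer_polytope_hpoly:
  assumes H: "H \<in> type_cone" and int: "\<And>F. F facet_of Q \<Longrightarrow> H F \<in> \<int>"
  shows "integer_polytope (hpoly H)"
  unfolding integer_polytope_def
proof (intro conjI allI impI polytope_hpoly)
  fix v assume v: "v extreme_point_of hpoly H"
  show "integral_vector v"
    using int by (intro unimodular[OF extreme_point_active[OF H v]]) (auto simp: active_def)
qed

lemma virtual_lattice_zero: "0 \<in> virtual_lattice Q"
  and virtual_lattice_diff: "v \<in> virtual_lattice Q \<Longrightarrow> w \<in> virtual_lattice Q \<Longrightarrow> v - w \<in> virtual_lattice Q"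
  by (auto simp: virtual_lattice_def hull_def)

lemma virtual_lattice_inc: "integer_polytope A \<Longrightarrow> analogous A Q \<Longrightarrow> vp_of A \<in> virtual_lattice Q"
  unfolding virtual_lattice_def by (rule hull_inc) blast

lemma virtual_lattice_add:
  assumes "v \<in> virtual_lattice Q" "w \<in> virtual_lattice Q" shows "v + w \<in> virtual_lattice Q"
  using virtual_lattice_diff[OF assms(1) virtual_lattice_diff[OF virtual_lattice_zero assms(2)]] by simp

text \<open>The vector is a difference of two polytopes of the fan with integer support numbers, and
  these are integer polytopes by unimodularity.\<close>

lemma coordinate_vector_in_lattice: "coordinate_vector Q F \<in> virtual_lattice Q"
proof -
  define H where "H m G = (if G = F then 1 else 0) + real m * h G" for m G
  from large_multiple_in_type_cone[of "\<lambda>G. if G = F then 1 else 0"]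
  obtain m :: nat where m: "0 < m" "(\<lambda>G. (if G = F then 1 else 0) + real m * h G) \<in> type_cone"
    by (elim exE conjE)
  have mH: "H m \<in> type_cone" using m(2) by (simp add: H_def[abs_def])
  have mh: "(\<lambda>F. real m * h F) \<in> type_cone" using h m(1) by (intro type_cone_scale) auto
  have "coordinate_vector Q F = vp_of (hpoly (H m)) - vp_of (hpoly (\<lambda>F. real m * h F))"
  proof (rule coordinate_vector_eqI[OF virtual_spaceI[OF mH mh]])
    fix G assume G: "G facet_of Q"
    show "support_number Q G (vp_of (hpoly (H m)) - vp_of (hpoly (\<lambda>F. real m * h F))) = (if G = F then 1 else 0)"
      using support_number_hpoly[OF mH G] support_number_hpoly[OF mh G]
      by (simp add: linear_diff[OF linear_support_number] H_def)
  qed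
  moreover have "vp_of (hpoly (H m)) \<in> virtual_lattice Q"
    using mH h_integral by (intro virtual_lattice_inc integer_polytope_hpoly) (auto simp: H_def analogous_iff)
  moreover have "vp_of (hpoly (\<lambda>F. real m * h F)) \<in> virtual_lattice Q"
    using mh h_integral by (intro virtual_lattice_inc integer_polytope_hpoly) (auto simp: analogous_iff)
  ultimately show ?thesis using virtual_lattice_diff by metis
qed

section \<open>The volume polynomial and the operators that annihilate it\<close>

definition numbers :: "(real^'d) virtual_polytope \<Rightarrow> (real^'d) set \<Rightarrow> real" where
  "numbers v = (\<lambda>F. support_number Q F v)"

text \<open>Justifies the definite description in \<open>volume_polynomial\<close>: existence is the
  homogeneous formula for the volume, and uniqueness holds because polynomials that agree on the
  type cone agree for all values of the coordinates.\<close>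

lemma volume_polynomial_repr:
  obtains p where "p \<in> poly_functions (coords facets)" "\<And>H. H \<in> type_cone \<Longrightarrow> vol H = p H"
    "\<And>v. volume_polynomial Q v = p (numbers v)"
proof -
  obtain M a where M: "finite M" "\<forall>m\<in>M. (\<Sum>F\<in>facets. m F) = DIM(real^'d)"
    "\<forall>H\<in>type_cone. vol H = (\<Sum>m\<in>M. a m * (\<Prod>F\<in>facets. H F ^ m F))"
    using vol_homogeneous_poly[OF ne] by blast
  have poly: "(\<lambda>H. \<Sum>m\<in>N. b m * (\<Prod>F\<in>facets. H F ^ m F)) \<in> poly_functions (coords facets)"
    if "finite N" for N and b :: "((real^'d) set \<Rightarrow> nat) \<Rightarrow> real"
    using that finite_I
    by (intro poly_functions_sum poly_functions.mult poly_functions.const poly_functions_prod poly_functions_power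
        poly_functions.gen) (auto simp: coords_def)
  define p where "p H = (\<Sum>m\<in>M. a m * (\<Prod>F\<in>facets. H F ^ m F))" for H :: "(real^'d) set \<Rightarrow> real"
  have p: "p \<in> poly_functions (coords facets)" unfolding p_def[abs_def] by (rule poly[OF M(1)])
  have pv: "vol H = p H" if "H \<in> type_cone" for H using M(3) that by (simp add: p_def)
  have num: "p (numbers (vp_of (hpoly H))) = vol H" if H: "H \<in> type_cone" for H
  proof -
    have "p (numbers (vp_of (hpoly H))) = p H"
      by (rule poly_functions_cong[OF p]) (auto simp: coords_def numbers_def support_number_hpoly[OF H])
    then show ?thesis using pv[OF H] by simp
  qed
  have "volume_polynomial Q = (\<lambda>v. p (numbers v))"
    unfolding volume_polynomial_def
  proof (rule the_equality)
    have "homogeneous_polynomial Q (\<lambda>v. p (numbers v))"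
      unfolding homogeneous_polynomial_def
      using M(1,2) by (intro exI[of _ "DIM(real^'d)"] exI[of _ M] exI[of _ a]) (simp add: p_def numbers_def)
    then show "homogeneous_polynomial Q (\<lambda>v. p (numbers v)) \<and>
        (\<forall>A. analogous A Q \<longrightarrow> p (numbers (vp_of A)) = measure lebesgue A)"
      using num by (auto simp: analogous_iff vol_def)
    fix f assume f: "homogeneous_polynomial Q f \<and> (\<forall>A. analogous A Q \<longrightarrow> f (vp_of A) = measure lebesgue A)"
    then obtain N b where N: "finite N" "f = (\<lambda>v. \<Sum>m\<in>N. b m * (\<Prod>F\<in>facets. support_number Q F v ^ m F))"
      unfolding homogeneous_polynomial_def by blast
    define q where "q H = (\<Sum>m\<in>N. b m * (\<Prod>F\<in>facets. H F ^ m F))" for H :: "(real^'d) set \<Rightarrow> real"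
    have q: "q \<in> poly_functions (coords facets)" unfolding q_def[abs_def] by (rule poly[OF N(1)])
    have fq: "f v = q (numbers v)" for v by (simp add: N q_def numbers_def)
    have "q H = p H" for H
    proof (rule poly_functions_eq_on_type_cone[OF ne q p])
      fix H assume H: "H \<in> type_cone"
      have "q H = q (numbers (vp_of (hpoly H)))"
        by (rule poly_functions_cong[OF q]) (auto simp: coords_def numbers_def support_number_hpoly[OF H])
      also have "\<dots> = vol H" using f H unfolding fq by (auto simp: analogous_iff vol_def)
      finally show "q H = p H" using pv[OF H] by simp
    qed
    then show "f = (\<lambda>v. p (numbers v))" by (simp add: fun_eq_iff fq)
  qed
  then show ?thesis using that[OF p pv] by simp
qed

sublocale linear_functionals "support_number Q ` facets"
  by (rule linear_functionals.intro) (auto simp: linear_support_number)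

lemma volume_polynomial_closed: "volume_polynomial Q \<in> poly_functions (support_number Q ` facets)"
proof -
  obtain p where p: "p \<in> poly_functions (coords facets)" "\<And>v. volume_polynomial Q v = p (numbers v)"
    using volume_polynomial_repr by metis
  have "(\<lambda>v. p (numbers v)) \<in> poly_functions (support_number Q ` facets)"
    by (rule poly_functions_comp[OF p(1)]) (auto simp: coords_def numbers_def intro: poly_functions.gen)
  moreover have "volume_polynomial Q = (\<lambda>v. p (numbers v))" using p(2) by blast
  ultimately show ?thesis by simp
qed

text \<open>Every virtual polytope shares its support numbers with one in
  \<open>virtual_space\<close>, so testing an operator there, as \<open>annihilator\<close> does, is
  the same as testing it everywhere.\<close>

lemma eq_zero_on_virtual_space:
  assumes "f \<in> poly_functions (support_number Q ` facets)" "\<And>x. x \<in> virtual_space Q \<Longrightarrow> f x = 0"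
  shows "f v = 0"
proof -
  obtain w where w: "w \<in> virtual_space Q" "\<And>F. F facet_of Q \<Longrightarrow> support_number Q F w = support_number Q F v"
    using virtual_space_surj[of "\<lambda>F. support_number Q F v"] by blast
  have "f v = f w" by (rule poly_functions_cong[OF assms(1)]) (auto simp: w(2))
  then show ?thesis using assms(2)[OF w(1)] by simp
qed

text \<open>The preimage of \<open>vol_annihilator\<close> in the polynomial ring, before additivity
  of the variables is imposed.\<close>

definition null_ops :: "((real^'d) virtual_polytope multiset \<Rightarrow>\<^sub>0 int) set" where
  "null_ops = {p \<in> carrier (int_poly_ring (virtual_lattice Q)). \<forall>x. diff_op p (volume_polynomial Q) x = 0}"

lemma ideal_kernel: "ideal null_ops (int_poly_ring (virtual_lattice Q))"
proof -
  let ?R = "int_poly_ring (virtual_lattice Q)"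
  interpret R: cring ?R by (rule cring_int_poly_ring)
  have neg: "\<ominus>\<^bsub>?R\<^esub> q = - q" if "q \<in> carrier ?R" for q
    using that by (intro R.minus_equality) (auto simp: int_poly_ring_def)
  have ops: "x \<oplus>\<^bsub>?R\<^esub> y = x + y" "x \<otimes>\<^bsub>?R\<^esub> y = x * y" "\<zero>\<^bsub>?R\<^esub> = 0" for x y
    by (simp_all add: int_poly_ring_def)
  have mem: "p \<in> null_ops \<longleftrightarrow> p \<in> carrier ?R \<and> (\<forall>x. diff_op p (volume_polynomial Q) x = 0)" for p
    by (simp only: null_ops_def mem_Collect_eq)
  have sub: "subgroup null_ops (add_monoid ?R)"
  proof (rule R.add.subgroupI)
    show "null_ops \<subseteq> carrier ?R" using mem by blast
    have "0 \<in> null_ops" using R.zero_closed unfolding mem ops by simp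
    then show "null_ops \<noteq> {}" by blast
    fix p assume p: "p \<in> null_ops"
    then have pc: "p \<in> carrier ?R" unfolding mem by blast
    show "\<ominus>\<^bsub>?R\<^esub> p \<in> null_ops" using p R.a_inv_closed[OF pc] unfolding mem neg[OF pc] by simp
    fix q assume q: "q \<in> null_ops"
    then have qc: "q \<in> carrier ?R" unfolding mem by blast
    show "p \<oplus>\<^bsub>?R\<^esub> q \<in> null_ops" using p q R.a_closed[OF pc qc] unfolding mem ops by simp
  qed
  show ?thesis
  proof (rule idealI[OF R.ring_axioms sub])
    fix p q assume p: "p \<in> null_ops" and q: "q \<in> carrier ?R"
    have z: "diff_op (q * p) (volume_polynomial Q) x = 0" for x
      by (rule diff_op_mult_eq_zero[OF volume_polynomial_closed]) (use p in \<open>simp add: null_ops_def\<close>)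
    have "p \<in> carrier ?R" using p unfolding mem by blast
    then have "q * p \<in> null_ops" using R.m_closed[OF q, of p] z unfolding mem ops by blast
    then show "q \<otimes>\<^bsub>?R\<^esub> p \<in> null_ops" "p \<otimes>\<^bsub>?R\<^esub> q \<in> null_ops"
      unfolding ops by (simp_all only: mult.commute)
  qed
qed

lemma poly_var_closed: "v \<in> virtual_lattice Q \<Longrightarrow> poly_var v \<in> carrier (int_poly_ring (virtual_lattice Q))"
  by (simp add: poly_var_def int_poly_ring_def)

text \<open>Directional derivatives are additive in the direction, so the action on the volume
  polynomial factors through the symmetric algebra.\<close>

lemma sym_generators_in_kernel:
  "{poly_var (v + w) - poly_var v - poly_var w | v w. v \<in> virtual_lattice Q \<and> w \<in> virtual_lattice Q} \<subseteq> null_ops"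
proof clarify
  fix v w assume v: "v \<in> virtual_lattice Q" and w: "w \<in> virtual_lattice Q"
  let ?R = "int_poly_ring (virtual_lattice Q)"
  have "M \<in> {{#v + w#}, {#v#}, {#w#}}" if "M \<in> Poly_Mapping.keys (poly_var (v + w) - poly_var v - poly_var w)" for M
    using that unfolding in_keys_iff by (auto simp: poly_var_def lookup_minus lookup_single when_def split: if_splits)
  then have "poly_var (v + w) - poly_var v - poly_var w \<in> carrier ?R"
    using v w virtual_lattice_add[OF v w] by (fastforce simp: int_poly_ring_def)
  moreover have "diff_op (poly_var (v + w) - poly_var v - poly_var w) (volume_polynomial Q) x = 0" for x
    by (simp add: diff_op_poly_var volume_polynomial_closed linear_add[OF dir_deriv_linear[OF volume_polynomial_closed]])
  ultimately show "poly_var (v + w) - poly_var v - poly_var w \<in> null_ops" by (simp add: null_ops_def)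
qed

lemma sym_ideal_props:
  "ideal (sym_ideal (virtual_lattice Q)) (int_poly_ring (virtual_lattice Q))"
  "sym_ideal (virtual_lattice Q) \<subseteq> null_ops"
proof -
  let ?R = "int_poly_ring (virtual_lattice Q)"
  interpret R: cring ?R by (rule cring_int_poly_ring)
  have "null_ops \<subseteq> carrier ?R" by (auto simp: null_ops_def)
  then have car: "{poly_var (v + w) - poly_var v - poly_var w | v w. v \<in> virtual_lattice Q \<and> w \<in> virtual_lattice Q} \<subseteq> carrier ?R"
    using sym_generators_in_kernel by blast
  then show "ideal (sym_ideal (virtual_lattice Q)) ?R" unfolding sym_ideal_def by (rule R.genideal_ideal)
  show "sym_ideal (virtual_lattice Q) \<subseteq> null_ops"
    unfolding sym_ideal_def by (rule R.genideal_minimal[OF ideal_kernel sym_generators_in_kernel])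
qed

lemma vol_annihilator_eq:
  "vol_annihilator Q = {D \<in> carrier (sym_alg (virtual_lattice Q)). D \<subseteq> null_ops}"
proof -
  let ?R = "int_poly_ring (virtual_lattice Q)"
  interpret sI: ideal "sym_ideal (virtual_lattice Q)" ?R by (rule sym_ideal_props(1))
  have "(\<forall>p\<in>D. \<forall>x\<in>virtual_space Q. diff_op p (volume_polynomial Q) x = 0) \<longleftrightarrow> D \<subseteq> null_ops"
    if D: "D \<in> carrier (sym_alg (virtual_lattice Q))" for D
  proof
    assume *: "\<forall>p\<in>D. \<forall>x\<in>virtual_space Q. diff_op p (volume_polynomial Q) x = 0"
    have "D \<subseteq> carrier ?R"
      using D sI.a_rcosets_carrier by (simp add: sym_alg_def FactRing_def)
    moreover have "diff_op p (volume_polynomial Q) x = 0" if "p \<in> D" for p x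
      by (rule eq_zero_on_virtual_space[OF diff_op_closed[OF volume_polynomial_closed]]) (use * that in blast)
    ultimately show "D \<subseteq> null_ops" by (auto simp: null_ops_def)
  qed (auto simp: null_ops_def)
  then show ?thesis by (auto simp: vol_annihilator_def annihilator_def)
qed

definition op_class :: "((real^'d) virtual_polytope multiset \<Rightarrow>\<^sub>0 int) \<Rightarrow> ((real^'d) virtual_polytope multiset \<Rightarrow>\<^sub>0 int) set set" where
  "op_class p = vol_annihilator Q +>\<^bsub>sym_alg (virtual_lattice Q)\<^esub>
     (sym_ideal (virtual_lattice Q) +>\<^bsub>int_poly_ring (virtual_lattice Q)\<^esub> p)"

lemma op_class_hom: "ring_hom_cring (int_poly_ring (virtual_lattice Q)) (polytope_ring Q) op_class"
  and op_class_eq_zero_iff: "p \<in> carrier (int_poly_ring (virtual_lattice Q)) \<Longrightarrow>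
    op_class p = \<zero>\<^bsub>polytope_ring Q\<^esub> \<longleftrightarrow> (\<forall>x. diff_op p (volume_polynomial Q) x = 0)"
proof -
  note iq = iterated_quotient[OF cring_int_poly_ring sym_ideal_props(1) ideal_kernel sym_ideal_props(2),
      folded sym_alg_def, folded vol_annihilator_eq, folded polytope_ring_def op_class_def]
  show "ring_hom_cring (int_poly_ring (virtual_lattice Q)) (polytope_ring Q) op_class"
    using iq(1) by (simp add: op_class_def[abs_def])
  show "p \<in> carrier (int_poly_ring (virtual_lattice Q)) \<Longrightarrow>
    op_class p = \<zero>\<^bsub>polytope_ring Q\<^esub> \<longleftrightarrow> (\<forall>x. diff_op p (volume_polynomial Q) x = 0)"
    using iq(2)[of p] by (simp add: null_ops_def)
qed

lemma facet_class_eq: "facet_class Q F = op_class (poly_var (coordinate_vector Q F))"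
  by (simp add: facet_class_def op_class_def sym_gen_def)

text \<open>A derivative that vanishes everywhere makes the volume constant along \<open>v\<close>,
  so the theorem on volume-preserving deformations applies. Conversely, translation invariance on
  the type cone extends to all coordinates as a polynomial identity.\<close>

lemma dir_deriv_volume_eq_zero_iff:
  "(\<forall>x. dir_deriv v (volume_polynomial Q) x = 0) \<longleftrightarrow>
    (\<exists>w. \<forall>F. F facet_of Q \<longrightarrow> support_number Q F v = outer_normal Q F \<bullet> w)"
proof -
  obtain p where p: "p \<in> poly_functions (coords facets)" "\<And>H. H \<in> type_cone \<Longrightarrow> vol H = p H"
    "\<And>v. volume_polynomial Q v = p (numbers v)"
    using volume_polynomial_repr by metis
  have p_cong: "p H = p H'" if "\<And>F. F facet_of Q \<Longrightarrow> H F = H' F" for H H'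
    by (rule poly_functions_cong[OF p(1)]) (auto simp: coords_def that)
  have num: "numbers (x + t *\<^sub>R v) = (\<lambda>F. numbers x F + t * support_number Q F v)" for x t
    by (simp add: numbers_def linear_add[OF linear_support_number] linear_cmul[OF linear_support_number])
  show ?thesis
  proof
    assume 0: "\<forall>x. dir_deriv v (volume_polynomial Q) x = 0"
    have "\<exists>w. \<forall>F\<in>facets. support_number Q F v = outer_normal Q F \<bullet> w"
    proof (rule volume_preserving_imp_translation[OF h])
      fix H t assume H: "H \<in> type_cone" "(\<lambda>F. H F + t * support_number Q F v) \<in> type_cone"
      have nH: "numbers (vp_of (hpoly H)) F = H F" if "F facet_of Q" for F
        using support_number_hpoly[OF H(1) that] by (simp add: numbers_def)
      have "vol (\<lambda>F. H F + t * support_number Q F v) = p (numbers (vp_of (hpoly H) + t *\<^sub>R v))"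
        unfolding p(2)[OF H(2)] num by (rule p_cong) (simp add: nH)
      also have "\<dots> = volume_polynomial Q (vp_of (hpoly H))"
        using dir_deriv_zero_imp_invariant[OF volume_polynomial_closed, of v] 0 by (simp add: p(3))
      also have "\<dots> = vol H" unfolding p(2)[OF H(1)] p(3) by (rule p_cong) (simp add: nH)
      finally show "vol (\<lambda>F. H F + t * support_number Q F v) = vol H" .
    qed
    then show "\<exists>w. \<forall>F. F facet_of Q \<longrightarrow> support_number Q F v = outer_normal Q F \<bullet> w" by auto
  next
    assume "\<exists>w. \<forall>F. F facet_of Q \<longrightarrow> support_number Q F v = outer_normal Q F \<bullet> w"
    then obtain w where w: "\<And>F. F facet_of Q \<Longrightarrow> support_number Q F v = outer_normal Q F \<bullet> w" by blast
    have inv: "p (\<lambda>F. H F + outer_normal Q F \<bullet> (t *\<^sub>R w)) = p H" for H t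
    proof (rule poly_functions_eq_on_type_cone[OF ne _ p(1)])
      show "(\<lambda>H. p (\<lambda>F. H F + outer_normal Q F \<bullet> (t *\<^sub>R w))) \<in> poly_functions (coords facets)"
      proof (rule poly_functions_comp[OF p(1)])
        fix l assume "l \<in> coords facets"
        then obtain F where F: "F \<in> facets" "l = (\<lambda>H. H F)" unfolding coords_def by blast
        have "(\<lambda>H. H F) \<in> poly_functions (coords facets)"
          using F(1) by (intro poly_functions.gen) (auto simp: coords_def)
        then show "(\<lambda>H. l (\<lambda>F. H F + outer_normal Q F \<bullet> (t *\<^sub>R w))) \<in> poly_functions (coords facets)"
          unfolding F(2) by (rule poly_functions.add[OF _ poly_functions.const])
      qed
      fix H assume H: "H \<in> type_cone"
      show "p (\<lambda>F. H F + outer_normal Q F \<bullet> (t *\<^sub>R w)) = p H"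
        using p(2)[OF H] p(2)[OF type_cone_translate[OF H]] vol_translate by metis
    qed
    have const: "volume_polynomial Q (x + t *\<^sub>R v) = volume_polynomial Q x" for x t
    proof -
      have "p (numbers (x + t *\<^sub>R v)) = p (\<lambda>F. numbers x F + outer_normal Q F \<bullet> (t *\<^sub>R w))"
        unfolding num by (rule p_cong) (simp add: w)
      then show ?thesis unfolding p(3) using inv by simp
    qed
    show "\<forall>x. dir_deriv v (volume_polynomial Q) x = 0" by (simp add: dir_deriv_def const)
  qed
qed

text \<open>The combination is the class of a polynomial of degree one in the variables, which acts
  as the derivative along the virtual polytope with support numbers \<open>a F\<close>.\<close>

theorem facet_relation_iff:
  fixes a :: "(real^'d) set \<Rightarrow> int"
  shows "(\<Oplus>\<^bsub>polytope_ring Q\<^esub> F \<in> facets. [a F] \<cdot>\<^bsub>polytope_ring Q\<^esub> facet_class Q F) = \<zero>\<^bsub>polytope_ring Q\<^esub> \<longleftrightarrow>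
    (\<exists>w. \<forall>F. F facet_of Q \<longrightarrow> of_int (a F) = outer_normal Q F \<bullet> w)"
proof -
  let ?R = "int_poly_ring (virtual_lattice Q)" and ?e = "\<lambda>F. coordinate_vector Q F"
  interpret hom: ring_hom_cring ?R "polytope_ring Q" op_class by (rule op_class_hom)
  have e: "poly_var (?e F) \<in> carrier ?R" for F by (intro poly_var_closed coordinate_vector_in_lattice)
  have ae: "of_int k * poly_var (?e F) \<in> carrier ?R" for F and k :: int
    using hom.R.add.int_pow_closed[OF e[of F], of k] add_pow_int_poly_ring[OF e, of k F] by simp
  have "[a F] \<cdot>\<^bsub>polytope_ring Q\<^esub> facet_class Q F = op_class (of_int (a F) * poly_var (?e F))" for F
  proof -
    have "group_hom (add_monoid ?R) (add_monoid (polytope_ring Q)) op_class"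
      by unfold_locales (auto simp: hom_def)
    from group_hom.hom_int_pow[OF this, of "poly_var (?e F)" "a F"] e
    have "op_class ([a F] \<cdot>\<^bsub>?R\<^esub> poly_var (?e F)) = [a F] \<cdot>\<^bsub>polytope_ring Q\<^esub> op_class (poly_var (?e F))"
      by (simp add: add_pow_def)
    then show ?thesis by (simp add: facet_class_eq add_pow_int_poly_ring[OF e])
  qed
  moreover have "(\<Oplus>\<^bsub>polytope_ring Q\<^esub> F \<in> B. op_class (of_int (a F) * poly_var (?e F)))
      = op_class (\<Sum>F\<in>B. of_int (a F) * poly_var (?e F)) \<and> (\<Sum>F\<in>B. of_int (a F) * poly_var (?e F)) \<in> carrier ?R"
    if "finite B" for B
    using that
  proof (induction B rule: finite_induct)
    case empty
    have z: "\<zero>\<^bsub>?R\<^esub> = 0" by (simp add: int_poly_ring_def)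
    then show ?case using hom.hom_zero hom.R.zero_closed by simp
  next
    case (insert F B)
    have plus: "x \<oplus>\<^bsub>?R\<^esub> y = x + y" for x y by (simp add: int_poly_ring_def)
    have "op_class (of_int (a F) * poly_var (?e F)) \<oplus>\<^bsub>polytope_ring Q\<^esub> op_class (\<Sum>F\<in>B. of_int (a F) * poly_var (?e F))
      = op_class (of_int (a F) * poly_var (?e F) + (\<Sum>F\<in>B. of_int (a F) * poly_var (?e F)))"
      using hom.hom_add[OF ae[of "a F" F], of "\<Sum>F\<in>B. of_int (a F) * poly_var (?e F)"] insert.IH by (simp add: plus)
    moreover have "of_int (a F) * poly_var (?e F) + (\<Sum>F\<in>B. of_int (a F) * poly_var (?e F)) \<in> carrier ?R"
      using hom.R.a_closed[OF ae[of "a F" F], of "\<Sum>F\<in>B. of_int (a F) * poly_var (?e F)"] insert.IH by (simp add: plus)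
    ultimately show ?case using insert ae by (simp add: hom.S.finsum_insert)
  qed
  note * = this[OF finite_I]
  ultimately have "(\<Oplus>\<^bsub>polytope_ring Q\<^esub> F \<in> facets. [a F] \<cdot>\<^bsub>polytope_ring Q\<^esub> facet_class Q F) = \<zero>\<^bsub>polytope_ring Q\<^esub> \<longleftrightarrow>
      (\<forall>x. diff_op (\<Sum>F\<in>facets. of_int (a F) * poly_var (?e F)) (volume_polynomial Q) x = 0)"
    using op_class_eq_zero_iff by simp
  also have "\<dots> \<longleftrightarrow> (\<forall>x. dir_deriv (\<Sum>F\<in>facets. of_int (a F) *\<^sub>R ?e F) (volume_polynomial Q) x = 0)"
    by (simp add: diff_op_sum diff_op_of_int_mult diff_op_poly_var volume_polynomial_closed
        linear_sum[OF dir_deriv_linear[OF volume_polynomial_closed]] linear_cmul[OF dir_deriv_linear[OF volume_polynomial_closed]])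
  also have "\<dots> \<longleftrightarrow> (\<exists>w. \<forall>F. F facet_of Q \<longrightarrow> of_int (a F) = outer_normal Q F \<bullet> w)"
  proof -
    have "support_number Q G (\<Sum>F\<in>facets. of_int (a F) *\<^sub>R ?e F) = of_int (a G)" if G: "G facet_of Q" for G
    proof -
      have "support_number Q G (\<Sum>F\<in>facets. of_int (a F) *\<^sub>R ?e F)
          = (\<Sum>F\<in>facets. if F = G then of_int (a F) else 0)"
        unfolding linear_sum[OF linear_support_number] linear_cmul[OF linear_support_number]
        using coordinate_vector(2)[OF G] by (intro sum.cong) auto
      then show ?thesis using G finite_I by simp
    qed
    then show ?thesis unfolding dir_deriv_volume_eq_zero_iff by simp
  qed
  finally show ?thesis .
qed

end

subsection \<open>Simple polytopes and their normal fans\<close>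

definition ray_of :: "'a::real_vector \<Rightarrow> 'a set" where
  "ray_of a = {t *\<^sub>R a | t. 0 \<le> t}"

lemma ray_of_self [simp]: "a \<in> ray_of a"
  unfolding ray_of_def by (intro CollectI exI[of _ 1]) simp

lemma ray_of_memE:
  assumes "b \<in> ray_of a" "b \<noteq> 0"
  obtains t where "t > 0" "b = t *\<^sub>R a"
proof -
  obtain t where t: "0 \<le> t" "b = t *\<^sub>R a" using assms(1) by (auto simp: ray_of_def)
  moreover have "t \<noteq> 0" using t assms(2) by auto
  ultimately show ?thesis using that[of t] by simp
qed

lemma ray_of_scale: "t > 0 \<Longrightarrow> ray_of (t *\<^sub>R a) = ray_of a"
proof (intro equalityI subsetI)
  fix x assume t: "t > 0" and "x \<in> ray_of a"
  then obtain s where "0 \<le> s" "x = s *\<^sub>R a" by (auto simp: ray_of_def)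
  then show "x \<in> ray_of (t *\<^sub>R a)"
    using t unfolding ray_of_def by (intro CollectI exI[of _ "s / t"]) auto
qed (auto simp: ray_of_def intro: mult_nonneg_nonneg less_imp_le)

lemma ray_of_eqI: "b \<in> ray_of a \<Longrightarrow> b \<noteq> 0 \<Longrightarrow> ray_of b = ray_of a"
  by (metis ray_of_memE ray_of_scale)

lemma dim_ray_of: "a \<noteq> 0 \<Longrightarrow> dim (ray_of (a::'a::euclidean_space)) = 1"
proof -
  assume "a \<noteq> 0"
  have "span (ray_of a) = span {a}"
  proof
    show "span (ray_of a) \<subseteq> span {a}"
      by (rule span_minimal) (auto simp: ray_of_def intro: span_scale span_base)
    show "span {a} \<subseteq> span (ray_of a)" by (rule span_mono) simp
  qed
  then have "dim (ray_of a) = dim {a}" by (metis dim_span)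
  then show ?thesis using \<open>a \<noteq> 0\<close> by (simp add: dim_singleton)
qed

lemma interior_normal_cone:
  assumes "x \<in> interior A" "c \<in> normal_cone A {x}" shows "c = 0"
proof (rule ccontr)
  assume c: "c \<noteq> 0"
  obtain e where e: "e > 0" "ball x e \<subseteq> A" using assms(1) unfolding mem_interior by blast
  define y where "y = x + (e / (2 * norm c)) *\<^sub>R c"
  have "dist x y < e" using e(1) c by (simp add: y_def dist_norm)
  then have "y \<in> A" using e(2) by auto
  then have "c \<bullet> y \<le> c \<bullet> x" using assms(2) by (simp add: normal_cone_def)
  then have "(e / (2 * norm c)) * (c \<bullet> c) \<le> 0" by (simp add: y_def inner_right_distrib)
  moreover have "0 < (e / (2 * norm c)) * (c \<bullet> c)" using e(1) c by (intro mult_pos_pos divide_pos_pos) auto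
  ultimately show False by simp
qed

text \<open>A linear functional equal to 1 on \<open>B\<close> is positive on all nonzero elements
  of the cone.\<close>

lemma pointed_convex_cone_hull:
  fixes B :: "'a::euclidean_space set"
  assumes "independent B" "w \<in> convex_cone hull B" "- w \<in> convex_cone hull B"
  shows "w = 0"
proof -
  obtain g :: "'a \<Rightarrow> real" where g: "linear g" "\<forall>x\<in>B. g x = 1"
    using linear_independent_extend[OF assms(1), of "\<lambda>_. 1 :: real"] by blast
  define C where "C = {x. 0 \<le> g x \<and> (g x = 0 \<longrightarrow> x = 0)}"
  have "convex_cone C"
    unfolding convex_cone_iff C_def
    using linear_0[OF g(1)] linear_add[OF g(1)] linear_cmul[OF g(1)]
    by (auto simp: add_nonneg_eq_0_iff)
  then have "convex_cone hull B \<subseteq> C"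
    using g(2) by (intro hull_minimal) (auto simp: C_def)
  then have "w \<in> C" "- w \<in> C" using assms by auto
  then show ?thesis using linear_neg[OF g(1), of w] by (auto simp: C_def)
qed

text \<open>If \<open>Q\<close> lay in a hyperplane, both normals of the hyperplane would belong to
  every normal cone, but a simplicial cone contains no line.\<close>

lemma simplicial_fan_full_dim:
  fixes Q :: "'a::euclidean_space set"
  assumes "simplicial_fan (normal_fan Q)" "convex Q" "Q \<noteq> {}"
  shows "aff_dim Q = DIM('a)"
proof (rule ccontr)
  assume "aff_dim Q \<noteq> DIM('a)"
  then have "aff_dim Q < DIM('a)" using aff_dim_le_DIM[of Q] by simp
  then obtain a b where a: "a \<noteq> 0" "Q \<subseteq> {x. a \<bullet> x = b}" by (rule aff_lowdim_subset_hyperplane)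
  obtain x where x: "x \<in> Q" using assms(3) by blast
  have "normal_cone Q {x} \<in> normal_fan Q" using x normal_fan_points[OF assms(2)] by blast
  then obtain B where B: "independent B" "normal_cone Q {x} = convex_cone hull B"
    using assms(1) unfolding simplicial_fan_def by blast
  have "a \<bullet> y = b" if "y \<in> Q" for y using a(2) that by blast
  then have "a \<in> normal_cone Q {x}" "- a \<in> normal_cone Q {x}" using x by (simp_all add: normal_cone_def)
  then show False using pointed_convex_cone_hull[OF B(1)] a(1) unfolding B(2) by blast
qed

lemma hyperplane_subset_imp_parallel:
  fixes a c :: "'a::euclidean_space"
  assumes "a \<noteq> 0" "{x. a \<bullet> x = b} \<subseteq> {x. c \<bullet> x = d}"
  obtains t where "c = t *\<^sub>R a"
proof -
  define x where "x = (b / (a \<bullet> a)) *\<^sub>R a"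
  define t where "t = (c \<bullet> a) / (a \<bullet> a)"
  define w where "w = c - t *\<^sub>R a"
  have aw: "a \<bullet> w = 0" using assms(1) by (simp add: w_def t_def inner_diff_right inner_commute)
  have ax: "a \<bullet> x = b" using assms(1) by (simp add: x_def)
  have "a \<bullet> (x + w) = b" using ax aw by (simp add: inner_right_distrib)
  then have "c \<bullet> x = d" "c \<bullet> (x + w) = d" using assms(2) ax by blast+
  then have "c \<bullet> w = 0" by (simp add: inner_right_distrib)
  then have "w \<bullet> w = 0" using aw by (simp add: w_def inner_diff_left inner_diff_right algebra_simps)
  then have "c = t *\<^sub>R a" by (simp add: w_def)
  then show ?thesis by (rule that)
qed

text \<open>The affine hull of a facet is a hyperplane, so functionals constant on the facet are
  multiples of a single normal; a point of \<open>Q\<close> off the facet fixes the sign.\<close>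

lemma facet_normal_cone:
  fixes Q :: "'a::euclidean_space set"
  assumes "polyhedron Q" "aff_dim Q = DIM('a)" "F facet_of Q"
  obtains a where "a \<noteq> 0" "normal_cone Q F = ray_of a" "\<And>x. x \<in> F \<Longrightarrow> F = {y \<in> Q. a \<bullet> y = a \<bullet> x}"
proof -
  obtain a b where a: "a \<noteq> 0" "Q \<subseteq> {x. a \<bullet> x \<le> b}" "F = Q \<inter> {x. a \<bullet> x = b}"
    using facet_of_polyhedron[OF assms(1,3)] .
  obtain x0 where x0: "x0 \<in> F" using assms(3) by (auto simp: facet_of_def)
  have "aff_dim F = DIM('a) - 1" using assms(2,3) by (simp add: facet_of_def)
  then obtain a' b' where a': "a' \<noteq> 0" "affine hull F = {x. a' \<bullet> x = b'}"
    using aff_dim_eq_hyperplane[of F] by auto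
  have par: "\<exists>t. c = t *\<^sub>R a'" if "F \<subseteq> {x. c \<bullet> x = d}" for c d
  proof -
    have "affine hull F \<subseteq> {x. c \<bullet> x = d}"
      using that affine_hyperplane by (rule hull_minimal)
    then show ?thesis using hyperplane_subset_imp_parallel[OF a'(1)] unfolding a'(2) by metis
  qed
  obtain s where s: "a = s *\<^sub>R a'" using par[of a b] a(3) by blast
  have s0: "s \<noteq> 0" using s a(1) by auto
  have "\<not> Q \<subseteq> {x. a \<bullet> x = b}"
  proof
    assume "Q \<subseteq> {x. a \<bullet> x = b}"
    then have "aff_dim Q \<le> aff_dim {x. a \<bullet> x = b}" by (rule aff_dim_subset)
    then show False using assms(2) a(1) by simp
  qed
  then obtain y0 where y0: "y0 \<in> Q" "a \<bullet> y0 < b" using a(2) by force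
  have "normal_cone Q F = ray_of a"
  proof (intro equalityI subsetI)
    fix c assume c: "c \<in> normal_cone Q F"
    have "c \<bullet> x = c \<bullet> x0" if "x \<in> F" for x
      using c that x0 a(3) by (auto simp: normal_cone_def intro!: antisym)
    then obtain t where t: "c = t *\<^sub>R a'" using par[of c "c \<bullet> x0"] by blast
    have ct: "c = (t / s) *\<^sub>R a" using s s0 t by simp
    have "c \<bullet> y0 \<le> c \<bullet> x0" using c x0 y0(1) by (simp add: normal_cone_def)
    then have "0 \<le> (t / s) * (b - a \<bullet> y0)" using x0 a(3) by (simp add: ct right_diff_distrib)
    then have "0 \<le> t / s" using y0(2) by (simp only: zero_le_mult_iff) auto
    then show "c \<in> ray_of a" using ct by (auto simp: ray_of_def)
  next
    fix c assume "c \<in> ray_of a"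
    then obtain t where "0 \<le> t" "c = t *\<^sub>R a" by (auto simp: ray_of_def)
    then show "c \<in> normal_cone Q F" using a(2,3) by (auto simp: normal_cone_def intro!: mult_left_mono)
  qed
  moreover have "F = {y \<in> Q. a \<bullet> y = a \<bullet> x}" if "x \<in> F" for x using that a(3) by auto
  ultimately show ?thesis using that a(1) by blast
qed

locale simple_full_polytope =
  fixes Q :: "'a::euclidean_space set" and u :: "'a set \<Rightarrow> 'a"
  assumes simple: "simple_polytope Q" and full: "aff_dim Q = DIM('a)"
    and normal: "F facet_of Q \<Longrightarrow> u F \<noteq> 0 \<and> normal_cone Q F = ray_of (u F)"
begin

abbreviation "heights F \<equiv> support_fun Q (u F)"

text \<open>The sets of facets through the points of \<open>Q\<close> encode the cones of the normal
  fan.\<close>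

definition tight :: "'a \<Rightarrow> 'a set set" where
  "tight x = {F. F facet_of Q \<and> x \<in> F}"

lemma poly: "polytope Q"
  using simple by (simp add: simple_polytope_def)

lemma nonempty: "Q \<noteq> {}"
  using full by auto

lemma conv_poly: "convex_polytope Q"
  using poly nonempty by (simp add: convex_polytope_def)

lemma finite_facets: "finite {F. F facet_of Q}"
  using poly by (rule finite_polytope_facets)

lemma height_upper: "x \<in> Q \<Longrightarrow> u F \<bullet> x \<le> heights F"
  using conv_poly by (rule support_fun_upper)

lemma facet_eq: assumes "F facet_of Q" shows "F = {x \<in> Q. u F \<bullet> x = heights F}"
proof -
  obtain a where a: "a \<noteq> 0" "normal_cone Q F = ray_of a" "\<And>x. x \<in> F \<Longrightarrow> F = {y \<in> Q. a \<bullet> y = a \<bullet> x}"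
    using facet_normal_cone[OF polytope_imp_polyhedron[OF poly] full assms] by metis
  have "u F \<in> ray_of a" using normal[OF assms] a(2) by (metis ray_of_self)
  then obtain t where t: "t > 0" "u F = t *\<^sub>R a" using normal[OF assms] ray_of_memE by blast
  obtain x where x: "x \<in> F" using assms by (auto simp: facet_of_def)
  then have xQ: "x \<in> Q" using facet_of_imp_subset[OF assms] by blast
  have "u F \<in> normal_cone Q F" using normal[OF assms] by simp
  then have "heights F = u F \<bullet> x" using x xQ by (intro support_fun_eqI) (auto simp: normal_cone_def)
  moreover have "(u F \<bullet> y = u F \<bullet> x) = (a \<bullet> y = a \<bullet> x)" for y using t by simp
  ultimately show ?thesis using a(3)[OF x] by simp
qed

lemma tight_eq: "x \<in> Q \<Longrightarrow> tight x = {F. F facet_of Q \<and> u F \<bullet> x = heights F}"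
  unfolding tight_def using facet_eq by blast

text \<open>A segment from an interior point to a point outside leaves \<open>Q\<close> through some
  facet, and the inequality of this facet fails at the outer end.\<close>

lemma halfspaces: "Q = {x. \<forall>F\<in>{F. F facet_of Q}. u F \<bullet> x \<le> heights F}"
proof (intro equalityI subsetI)
  fix z assume z: "z \<in> {x. \<forall>F\<in>{F. F facet_of Q}. u F \<bullet> x \<le> heights F}"
  show "z \<in> Q"
  proof (rule ccontr)
    assume zQ: "z \<notin> Q"
    have ri: "interior Q = Q - \<Union> {F. F facet_of Q}"
      using rel_interior_of_polyhedron[OF polytope_imp_polyhedron[OF poly]] interior_rel_interior[OF full] by simp
    have "rel_interior Q \<noteq> {}" using poly nonempty by (simp add: rel_interior_eq_empty polytope_imp_convex)
    then obtain x0 where x0: "x0 \<in> interior Q" using interior_rel_interior[OF full] by auto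
    then have x0Q: "x0 \<in> Q" using interior_subset by blast
    have "closed_segment x0 z \<inter> frontier Q \<noteq> {}"
      using x0Q zQ by (intro connected_Int_frontier) auto
    then obtain y where y: "y \<in> closed_segment x0 z" "y \<in> frontier Q" by blast
    have "frontier Q = Q - interior Q" using polytope_imp_closed[OF poly] by (simp add: frontier_def)
    then obtain F where F: "F facet_of Q" "y \<in> F" using y(2) ri by blast
    obtain t where t: "0 \<le> t" "t \<le> 1" "y = (1 - t) *\<^sub>R x0 + t *\<^sub>R z" using y(1) by (auto simp: closed_segment_def)
    have yF: "u F \<bullet> y = heights F" using facet_eq[OF F(1)] F(2) by blast
    have "x0 \<notin> F" using x0 ri F(1) by blast
    then have x0F: "u F \<bullet> x0 < heights F" using facet_eq[OF F(1)] x0Q height_upper[OF x0Q, of F] by force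
    have zF: "u F \<bullet> z \<le> heights F" using z F(1) by blast
    have "t \<noteq> 1" using t(3) zQ F facet_of_imp_subset by fastforce
    then have "(1 - t) * (u F \<bullet> x0) < (1 - t) * heights F" using t(2) x0F by (intro mult_strict_left_mono) auto
    moreover have "t * (u F \<bullet> z) \<le> t * heights F" using t(1) zF by (rule mult_left_mono[rotated])
    ultimately have "u F \<bullet> y < heights F" unfolding t(3) by (simp add: inner_right_distrib algebra_simps)
    then show False using yF by simp
  qed
qed (use height_upper in auto)

text \<open>The normals at an extreme point span the space, and by simplicity their number is the
  dimension; so they are independent, and values on them can be prescribed.\<close>

lemma extreme_tight_solvable:
  assumes "v extreme_point_of Q"
  shows "\<exists>w. \<forall>F\<in>tight v. u F \<bullet> w = f F"
proof -
  have vQ: "v \<in> Q" using assms by (simp add: extreme_point_of_def)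
  have fin: "finite (tight v)" using finite_facets by (simp add: tight_def)
  have card: "card (tight v) = DIM('a)"
    using simple assms full unfolding simple_polytope_def tight_def by auto
  have ext: "v extreme_point_of {x. \<forall>F\<in>{F. F facet_of Q}. u F \<bullet> x \<le> heights F}"
    by (simp only: halfspaces[symmetric] assms)
  have orth: "w = 0" if w: "\<And>F. F \<in> tight v \<Longrightarrow> u F \<bullet> w = 0" for w
    by (rule extreme_point_of_halfspaces[OF finite_facets ext]) (use w tight_eq[OF vQ] in blast)
  have sp: "span (u ` tight v) = UNIV"
  proof (rule ccontr)
    assume "span (u ` tight v) \<noteq> UNIV"
    then obtain w where "w \<noteq> 0" "\<And>y. y \<in> span (u ` tight v) \<Longrightarrow> w \<bullet> y = 0"
      using span_not_UNIV_orthogonal by blast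
    then show False using orth[of w] span_base[of _ "u ` tight v"] by (metis imageI inner_commute)
  qed
  have "DIM('a) = dim (u ` tight v)" using sp by (metis dim_UNIV dim_span)
  also have "\<dots> \<le> card (u ` tight v)" using fin by (intro dim_le_card') auto
  finally have "card (u ` tight v) = card (tight v)" using card card_image_le[OF fin, of u] by simp
  then have inj: "inj_on u (tight v)" by (rule eq_card_imp_inj_on[OF fin])
  have "independent (u ` tight v)"
    using fin sp card \<open>card (u ` tight v) = card (tight v)\<close>
    by (intro card_le_dim_spanning[of _ UNIV]) auto
  then obtain g :: "'a \<Rightarrow> real" where g: "linear g" "\<forall>x\<in>u ` tight v. g x = f (inv_into (tight v) u x)"
    using linear_independent_extend[of "u ` tight v" "\<lambda>x. f (inv_into (tight v) u x)"] by blast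
  have "u F \<bullet> adjoint g 1 = f F" if "F \<in> tight v" for F
    using adjoint_works[OF g(1), of "u F" 1] g(2) that inj by (simp add: inv_into_f_f)
  then show ?thesis by blast
qed

lemma tight_subset_extreme:
  assumes "x \<in> Q"
  obtains v where "v extreme_point_of Q" "tight x \<subseteq> tight v"
proof -
  define G where "G = \<Inter> (insert Q (tight x))"
  have convQ: "convex Q" using poly by (rule polytope_imp_convex)
  have face: "G face_of Q" unfolding G_def
    using convQ by (intro face_of_Inter) (auto simp: tight_def facet_of_imp_face_of face_of_refl)
  have "x \<in> G" using assms by (auto simp: G_def tight_def)
  moreover have "compact G" using face_of_imp_compact[OF convQ polytope_imp_compact[OF poly] face] .
  moreover have "convex G" using face_of_imp_convex[OF face] .
  ultimately obtain v where v: "v extreme_point_of G" using extreme_point_exists_convex by blast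
  then have "v \<in> G" by (simp add: extreme_point_of_def)
  then have "tight x \<subseteq> tight v" by (auto simp: G_def tight_def)
  moreover have "v extreme_point_of Q" using v extreme_point_of_face[OF face] by blast
  ultimately show ?thesis using that by blast
qed

lemma tight_solvable: "x \<in> Q \<Longrightarrow> \<exists>w. \<forall>F\<in>tight x. u F \<bullet> w = f F"
  by (metis extreme_tight_solvable subsetD tight_subset_extreme)

lemma small_step:
  assumes "x \<in> Q" "\<And>F. F \<in> tight x \<Longrightarrow> u F \<bullet> w \<le> 0"
  obtains e where "e > 0" "\<And>t. 0 \<le> t \<Longrightarrow> t \<le> e \<Longrightarrow> x + t *\<^sub>R w \<in> Q"
proof -
  have "\<exists>e>0. \<forall>t. 0 \<le> t \<and> t \<le> e \<longrightarrow> (\<forall>F\<in>{F. F facet_of Q}. u F \<bullet> (x + t *\<^sub>R w) \<le> heights F)"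
    using assms tight_eq[OF assms(1)] height_upper[OF assms(1)]
    by (intro small_step_in_halfspaces finite_facets) auto
  then obtain e where e: "e > 0" "\<forall>t. 0 \<le> t \<and> t \<le> e \<longrightarrow> (\<forall>F\<in>{F. F facet_of Q}. u F \<bullet> (x + t *\<^sub>R w) \<le> heights F)"
    by blast
  show ?thesis
  proof (rule that[OF e(1)])
    show "x + t *\<^sub>R w \<in> Q" if "0 \<le> t" "t \<le> e" for t
      by (subst halfspaces) (use e(2) that in blast)
  qed
qed

text \<open>Solvability gives a direction that leaves the facets outside \<open>q\<close> and
  follows those in \<open>q\<close>.\<close>

lemma tight_down:
  assumes "x \<in> Q" "q \<subseteq> tight x"
  shows "q \<in> tight ` Q"
proof -
  obtain w where w: "\<And>F. F \<in> tight x \<Longrightarrow> u F \<bullet> w = (if F \<in> q then 0 else - 1)"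
    using tight_solvable[OF assms(1), of "\<lambda>F. if F \<in> q then 0 else - 1"] by blast
  obtain e where e: "e > 0" "\<And>t. 0 \<le> t \<Longrightarrow> t \<le> e \<Longrightarrow> x + t *\<^sub>R w \<in> Q"
  proof (rule small_step[OF assms(1)])
    show "u F \<bullet> w \<le> 0" if "F \<in> tight x" for F using w[OF that] by simp
  qed blast
  \<comment> \<open>Only half the admissible step: being the midpoint of \<open>x\<close> and a
    point of \<open>Q\<close>, \<open>y\<close> lies on no facet that misses
    \<open>x\<close>.\<close>
  define y where "y = x + (e / 2) *\<^sub>R w"
  have yQ: "y \<in> Q" unfolding y_def using e by auto
  have zQ: "x + e *\<^sub>R w \<in> Q" using e by auto
  have uy: "u F \<bullet> y = ((u F \<bullet> x) + u F \<bullet> (x + e *\<^sub>R w)) / 2" for F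
    by (simp add: y_def inner_right_distrib field_simps)
  have "F \<in> tight y \<longleftrightarrow> F \<in> q" if F: "F facet_of Q" for F
  proof (cases "F \<in> tight x")
    case True
    then have "u F \<bullet> x = heights F" using tight_eq[OF assms(1)] by blast
    then show ?thesis using w[OF True] e(1) F
      unfolding tight_eq[OF yQ] by (simp add: y_def inner_right_distrib)
  next
    case False
    then have "u F \<bullet> x < heights F"
      using F height_upper[OF assms(1), of F] tight_eq[OF assms(1)] by force
    then have "u F \<bullet> y < heights F" using height_upper[OF zQ, of F] unfolding uy by simp
    then show ?thesis using False assms(2) unfolding tight_eq[OF yQ] by auto
  qed
  moreover have "F facet_of Q" if "F \<in> q" for F using that assms(2) by (auto simp: tight_def)
  ultimately have "tight y = q" by (auto simp: tight_def)
  then show ?thesis using yQ by blast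
qed

text \<open>Completeness is Farkas' lemma at a point of \<open>Q\<close> where \<open>c\<close> is
  maximal; facets with coefficient zero are dropped, which \<open>tight_down\<close>
  permits.\<close>

lemma simplicial_complete_fan: "simplicial_complete_fan {F. F facet_of Q} u (tight ` Q)"
proof
  fix r assume r: "r \<in> tight ` Q"
  then obtain x where x: "x \<in> Q" "r = tight x" by blast
  show "r \<subseteq> {F. F facet_of Q}" by (auto simp: x tight_def)
  show "q \<in> tight ` Q" if "q \<subseteq> r" for q by (rule tight_down[OF x(1)]) (use that x(2) in simp)
  show "\<exists>w. \<forall>i\<in>r. u i \<bullet> w = f i" for f unfolding x(2) by (rule tight_solvable[OF x(1)])
next
  fix c
  obtain x where x: "x \<in> Q" "\<And>y. y \<in> Q \<Longrightarrow> c \<bullet> y \<le> c \<bullet> x" using support_fun_attained[OF conv_poly] by metis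
  have fin: "finite (tight x)" using finite_facets by (simp add: tight_def)
  have "\<exists>k. (\<forall>F\<in>tight x. 0 \<le> k F) \<and> c = (\<Sum>F\<in>tight x. k F *\<^sub>R u F)"
  proof (rule farkas_independent[OF fin tight_solvable[OF x(1)]])
    fix w assume w: "\<And>F. F \<in> tight x \<Longrightarrow> u F \<bullet> w \<le> 0"
    obtain e where e: "e > 0" "\<And>t. 0 \<le> t \<Longrightarrow> t \<le> e \<Longrightarrow> x + t *\<^sub>R w \<in> Q" using small_step[OF x(1) w] by blast
    then have "c \<bullet> (x + e *\<^sub>R w) \<le> c \<bullet> x" by (intro x(2)) auto
    then show "c \<bullet> w \<le> 0" using e(1) by (simp add: inner_right_distrib mult_le_0_iff)
  qed
  then obtain k where k: "\<forall>F\<in>tight x. 0 \<le> k F" "c = (\<Sum>F\<in>tight x. k F *\<^sub>R u F)" by blast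
  define q where "q = {F \<in> tight x. k F \<noteq> 0}"
  have "q \<in> tight ` Q" by (rule tight_down[OF x(1)]) (auto simp: q_def)
  moreover have "\<forall>F\<in>q. 0 < k F" using k(1) by (auto simp: q_def order_less_le)
  moreover have "c = (\<Sum>F\<in>q. k F *\<^sub>R u F)"
    unfolding k(2) q_def using fin by (intro sum.mono_neutral_right) auto
  ultimately show "\<exists>r\<in>tight ` Q. \<exists>k. (\<forall>i\<in>r. 0 < k i) \<and> c = (\<Sum>i\<in>r. k i *\<^sub>R u i)" by blast
next
  fix F assume F: "F \<in> {F. F facet_of Q}"
  then obtain x where x: "x \<in> F" by (auto simp: facet_of_def)
  then have "x \<in> Q" using F facet_of_imp_subset by blast
  moreover have "{F} \<subseteq> tight x" using F x by (auto simp: tight_def)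
  ultimately show "{F} \<in> tight ` Q" by (rule tight_down)
qed (rule finite_facets)

end

sublocale simple_full_polytope \<subseteq> simplicial_complete_fan "{F. F facet_of Q}" u "tight ` Q"
  by (rule simplicial_complete_fan)

context simple_full_polytope
begin

lemma heights_in_type_cone: "(\<lambda>F. heights F) \<in> type_cone"
  unfolding type_cone_def
proof (intro CollectI ballI)
  fix r assume "r \<in> tight ` Q"
  then obtain x where x: "x \<in> Q" "r = tight x" by blast
  show "\<exists>x. (\<forall>F\<in>r. u F \<bullet> x = heights F) \<and> (\<forall>F\<in>{F. F facet_of Q} - r. u F \<bullet> x < heights F)"
  proof (intro exI[of _ x] conjI ballI)
    show "u F \<bullet> x = heights F" if "F \<in> r" for F using that tight_eq[OF x(1)] x(2) by blast
    show "u F \<bullet> x < heights F" if "F \<in> {F. F facet_of Q} - r" for F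
      using that tight_eq[OF x(1)] x(2) height_upper[OF x(1), of F] by force
  qed
qed

lemma hpoly_heights: "Q = hpoly (\<lambda>F. heights F)"
  unfolding hpoly_def using halfspaces .

end

subsection \<open>Facets of Gelfand--Zetlin polytopes\<close>

text \<open>The ratio \<open>t\<close> of two parallel integral vectors is rational,
  \<open>a / b\<close> in lowest terms. Then \<open>u\<close> is \<open>b\<close> times an integral
  vector and \<open>v\<close> is \<open>a\<close> times one, so primitivity gives
  \<open>a = b = 1\<close>.\<close>

lemma primitive_vector_unique:
  assumes "primitive_vector u" "primitive_vector v" "v = t *\<^sub>R u" "t > 0"
  shows "v = u"
proof -
  have u: "integral_vector u" "u \<noteq> 0" and v: "integral_vector v" using assms by (auto simp: primitive_vector_def)
  obtain k where k: "u $ k \<noteq> 0" using u(2) by (auto simp: vec_eq_iff)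
  have "t = v $ k / u $ k" using k assms(3) by simp
  moreover have "v $ k \<in> \<rat>" "u $ k \<in> \<rat>"
    using u(1) v Ints_subset_Rats by (auto simp: integral_vector_def)
  ultimately have "t \<in> \<rat>" by simp
  then obtain a b :: nat where ab: "b \<noteq> 0" "\<bar>t\<bar> = real a / real b" "coprime a b"
    by (rule Rats_abs_nat_div_natE)
  have t: "t = real a / real b" using ab(2) assms(4) by simp
  have a0: "a \<noteq> 0"
  proof
    assume "a = 0"
    then have "t = 0" using t by simp
    then show False using assms(4) by simp
  qed
  have div: "\<exists>z. integral_vector z \<and> x = real m *\<^sub>R z"
    if x: "integral_vector x" "integral_vector y" and m: "coprime l m" "m \<noteq> 0" "real l *\<^sub>R x = real m *\<^sub>R y"
    for x y :: "real^'d" and l m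
  proof (intro exI conjI)
    show "x = real m *\<^sub>R ((1 / real m) *\<^sub>R x)" using m(2) by simp
    show "integral_vector ((1 / real m) *\<^sub>R x)"
      unfolding integral_vector_def
    proof
      fix k
      have "x $ k \<in> \<int>" "y $ k \<in> \<int>" using x by (auto simp: integral_vector_def)
      then obtain p q :: int where p: "x $ k = of_int p" and q: "y $ k = of_int q" by (metis Ints_cases)
      have "real l * x $ k = real m * y $ k" using m(3) by (metis vector_scaleR_component real_scaleR_def)
      then have "real_of_int (int l * p) = real_of_int (int m * q)" by (simp add: p q)
      then have "int l * p = int m * q" by (simp only: of_int_eq_iff)
      then have "int m dvd int l * p" by simp
      moreover have "coprime (int m) (int l)" using m(1) by (simp add: coprime_commute)
      ultimately have "int m dvd p" by (simp add: coprime_dvd_mult_right_iff)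
      then obtain r where "p = int m * r" by blast
      then show "((1 / real m) *\<^sub>R x) $ k \<in> \<int>" using m(2) p by simp
    qed
  qed
  have eq: "real a *\<^sub>R u = real b *\<^sub>R v" using ab(1) by (simp add: assms(3) t)
  have "b = 1" using div[OF u(1) v ab(3) ab(1) eq] assms(1) by (auto simp: primitive_vector_def)
  moreover have "a = 1"
    using div[OF v u(1) _ a0 eq[symmetric]] ab(3) assms(2) by (auto simp: primitive_vector_def coprime_commute)
  ultimately show ?thesis using assms(3) t by simp
qed

text \<open>Any primitive vector with the same set of maximisers lies in the ray of
  \<open>u\<close>. The alternative in the last assumption serves two situations: for
  \<open>Q\<close> the normal cone of the facet is known, for the Gelfand--Zetlin polytope that of a
  suitable point.\<close>

lemma outer_normal_eqI:
  assumes prim: "primitive_vector u" and F: "F = {x \<in> A. \<forall>y\<in>A. u \<bullet> y \<le> u \<bullet> x}"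
    and x: "x \<in> F" and cone: "normal_cone A F \<subseteq> ray_of u \<or> normal_cone A {x} \<subseteq> ray_of u"
  shows "outer_normal A F = u"
  unfolding outer_normal_def
proof (rule the_equality)
  show "primitive_vector u \<and> F = {x \<in> A. \<forall>y\<in>A. u \<bullet> y \<le> u \<bullet> x}" using prim F by blast
  fix v assume v: "primitive_vector v \<and> F = {x \<in> A. \<forall>y\<in>A. v \<bullet> y \<le> v \<bullet> x}"
  then have "v \<in> normal_cone A F" "v \<in> normal_cone A {x}" using x by (auto simp: normal_cone_def)
  then have "v \<in> ray_of u" using cone by blast
  moreover have "v \<noteq> 0" using v by (simp add: primitive_vector_def)
  ultimately obtain t where "t > 0" "v = t *\<^sub>R u" by (rule ray_of_memE)
  then show "v = u" using primitive_vector_unique[OF prim] v by blast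
qed

text \<open>Row 0 consists of constants; giving them the zero vector lets all inequalities share one
  formula for their normals.\<close>

definition gz_unit :: "(nat \<Rightarrow> nat \<Rightarrow> 'd::finite) \<Rightarrow> nat \<Rightarrow> nat \<Rightarrow> real^'d" where
  "gz_unit c i j = (if i = 0 then 0 else axis (c i j) 1)"

fun gz_normal :: "(nat \<Rightarrow> nat \<Rightarrow> 'd::finite) \<Rightarrow> gz_symbol \<Rightarrow> real^'d" where
  "gz_normal c (GZ i j) = gz_unit c i j - gz_unit c (i + 1) j"
| "gz_normal c (GZm i j) = gz_unit c (i + 1) (j - 1) - gz_unit c i j"

fun gz_bound :: "(nat \<Rightarrow> int) \<Rightarrow> gz_symbol \<Rightarrow> real" where
  "gz_bound lam (GZ i j) = (if i = 0 then - of_int (lam j) else 0)"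
| "gz_bound lam (GZm i j) = (if i = 0 then of_int (lam j) else 0)"

fun gz_slack :: "(nat \<Rightarrow> nat \<Rightarrow> real) \<Rightarrow> gz_symbol \<Rightarrow> real" where
  "gz_slack e (GZ i j) = e (i + 1) j - e i j"
| "gz_slack e (GZm i j) = e i j - e (i + 1) (j - 1)"

lemma gz_unit_inner [simp]: "gz_unit c i j \<bullet> x = (if i = 0 then 0 else x $ c i j)"
  by (simp add: gz_unit_def inner_axis' )

lemma gz_normal_inner: "gz_normal c s \<bullet> x = gz_bound lam s - gz_slack (gz_entry c lam x) s"
  by (cases s) (auto simp: inner_diff_left gz_entry_def)

lemma gz_facet_eq:
  "gz_facet n c lam s = {x \<in> gz_polytope n c lam. gz_normal c s \<bullet> x = gz_bound lam s}"
  unfolding gz_normal_inner[of c s _ lam] by (cases s) auto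

lemma finite_gz_symbols: "finite (gz_symbols n)"
proof -
  have "gz_symbols n \<subseteq> (\<lambda>(i, j). GZ i j) ` ({..n} \<times> {..n}) \<union> (\<lambda>(i, j). GZm i j) ` ({..n} \<times> {..n})"
    unfolding gz_symbols_def by (auto simp: image_iff)
  then show ?thesis by (rule finite_subset) simp
qed

lemma gz_polytope_eq:
  "gz_polytope n c lam = {x. \<forall>s\<in>gz_symbols n. gz_normal c s \<bullet> x \<le> gz_bound lam s}"
proof (intro equalityI subsetI)
  fix x assume x: "x \<in> gz_polytope n c lam"
  have "0 \<le> gz_slack (gz_entry c lam x) s" if s: "s \<in> gz_symbols n" for s
  proof (cases s)
    case (GZ i j)
    then show ?thesis using x s by (auto simp: gz_polytope_def gz_symbols_def)
  next
    case (GZm i j)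
    then have "i \<le> n - 2 \<and> 1 \<le> j - 1 \<and> j - 1 \<le> n - i - 1" "j - 1 + 1 = j" using s by (auto simp: gz_symbols_def)
    then show ?thesis using x GZm unfolding gz_polytope_def by (metis (mono_tags, lifting) diff_ge_0_iff_ge gz_slack.simps(2) mem_Collect_eq)
  qed
  then show "x \<in> {x. \<forall>s\<in>gz_symbols n. gz_normal c s \<bullet> x \<le> gz_bound lam s}"
    by (simp add: gz_normal_inner[of c _ x lam])
next
  fix x assume "x \<in> {x. \<forall>s\<in>gz_symbols n. gz_normal c s \<bullet> x \<le> gz_bound lam s}"
  then have *: "0 \<le> gz_slack (gz_entry c lam x) s" if "s \<in> gz_symbols n" for s
    using that by (simp add: gz_normal_inner[of c _ x lam])
  show "x \<in> gz_polytope n c lam"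
    unfolding gz_polytope_def
  proof (intro CollectI allI impI)
    fix i j assume ij: "i \<le> n - 2 \<and> 1 \<le> j \<and> j \<le> n - i - 1"
    then have "GZ i j \<in> gz_symbols n" "GZm i (j + 1) \<in> gz_symbols n" by (auto simp: gz_symbols_def)
    from this[THEN *] show "gz_entry c lam x i j \<le> gz_entry c lam x (i + 1) j \<and>
        gz_entry c lam x (i + 1) j \<le> gz_entry c lam x i (j + 1)" by simp
  qed
qed

text \<open>A point satisfying exactly one of the inequalities with equality: every entry is the mean of
  its two neighbours in the previous row, except for one which coincides with a neighbour.\<close>

fun gz_array :: "(nat \<Rightarrow> nat \<Rightarrow> real) \<Rightarrow> (nat \<Rightarrow> int) \<Rightarrow> nat \<Rightarrow> nat \<Rightarrow> real" where
  "gz_array th lam 0 j = of_int (lam j)"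
| "gz_array th lam (Suc i) j = gz_array th lam i j + th i j * (gz_array th lam i (j + 1) - gz_array th lam i j)"

fun gz_weight :: "gz_symbol \<Rightarrow> nat \<Rightarrow> nat \<Rightarrow> real" where
  "gz_weight (GZ a b) i j = (if i = a \<and> j = b then 0 else 1/2)"
| "gz_weight (GZm a b) i j = (if i = a \<and> j + 1 = b then 1 else 1/2)"

text \<open>The third bound says that in a row a weight 1 is never followed by a weight 0: at most
  one weight differs from 1/2.\<close>

lemma gz_weight_bounds: "0 \<le> gz_weight s i j" "gz_weight s i j \<le> 1"
  "0 < (1 - gz_weight s i j) + gz_weight s i (j + 1)"
  by (cases s; simp)+

text \<open>A gap in the next row is a nonnegative combination of two adjacent gaps of this row,
  with coefficients that are not both zero.\<close>

lemma gz_array_strict: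
  assumes "strict_mono_on {1..n} lam" "1 \<le> j" "j + 1 \<le> n - i"
  shows "gz_array (gz_weight s) lam i j < gz_array (gz_weight s) lam i (j + 1)"
  using assms(2,3)
proof (induction i arbitrary: j)
  case 0
  then show ?case using strict_mono_onD[OF assms(1), of j "j + 1"] by simp
next
  case (Suc i)
  define A where "A = gz_array (gz_weight s) lam i"
  have d: "A j < A (j + 1)" "A (j + 1) < A (j + 1 + 1)"
    unfolding A_def using Suc.prems by (intro Suc.IH; simp)+
  define p q where "p = 1 - gz_weight s i j" and "q = gz_weight s i (j + 1)"
  have pq: "0 \<le> p" "0 \<le> q" "0 < p + q"
    using gz_weight_bounds[of s i j] gz_weight_bounds[of s i "j + 1"] by (auto simp: p_def q_def)
  have "gz_array (gz_weight s) lam (Suc i) (j + 1) - gz_array (gz_weight s) lam (Suc i) j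
      = p * (A (j + 1) - A j) + q * (A (j + 1 + 1) - A (j + 1))"
    by (simp add: A_def p_def q_def algebra_simps)
  also have "\<dots> > 0"
  proof (cases "0 < p")
    case True
    then show ?thesis using d pq by (intro add_pos_nonneg mult_pos_pos mult_nonneg_nonneg) auto
  next
    case False
    then show ?thesis using d pq by (intro add_nonneg_pos mult_pos_pos mult_nonneg_nonneg) auto
  qed
  finally show ?case by simp
qed

section \<open>Facet normals of the Gelfand--Zetlin polytope\<close>

definition gz_index :: "nat \<Rightarrow> (nat \<times> nat) set" where
  "gz_index n = {(i, j). 1 \<le> i \<and> i \<le> n - 1 \<and> 1 \<le> j \<and> j \<le> n - i}"

locale gz =
  fixes n :: nat and c :: "nat \<Rightarrow> nat \<Rightarrow> 'd::finite" and lam :: "nat \<Rightarrow> int"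
  assumes labelling: "gz_labelling n c" and strictly_dominant: "strict_mono_on {1..n} lam"
begin

abbreviation "P \<equiv> gz_polytope n c lam"

lemma bij: "bij_betw (\<lambda>(i, j). c i j) (gz_index n) UNIV"
  using labelling by (simp add: gz_labelling_def gz_index_def)

lemma n_ge_2: "2 \<le> n"
proof -
  have "gz_index n \<noteq> {}" using bij by (auto simp: bij_betw_def)
  then show ?thesis by (auto simp: gz_index_def)
qed

lemma c_inj: "(i, j) \<in> gz_index n \<Longrightarrow> (k, l) \<in> gz_index n \<Longrightarrow> c i j = c k l \<longleftrightarrow> i = k \<and> j = l"
  using bij by (auto simp: bij_betw_def inj_on_def)

lemma gz_unit_orthonormal:
  assumes "i \<noteq> 0 \<Longrightarrow> (i, j) \<in> gz_index n" "(k, l) \<in> gz_index n"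
  shows "gz_unit c i j \<bullet> gz_unit c k l = (if i = k \<and> j = l then 1 else 0)"
  unfolding gz_unit_inner using assms c_inj[of i j k l] by (auto simp: gz_unit_def axis_def gz_index_def)

text \<open>This is where the four terms of the relation come from: an entry occurs in the
  inequalities towards the next row with one sign and in those towards the previous row with the
  other. The subtraction in \<open>k - 1\<close> is genuine, since \<open>k\<close> is at least
  1.\<close>

lemma gz_normal_unit:
  assumes "s \<in> gz_symbols n" "(k, l) \<in> gz_index n"
  shows "gz_normal c s \<bullet> gz_unit c k l = (if s = GZ k l then 1 else 0) - (if s = GZm k l then 1 else 0)
    - (if s = GZ (k - 1) l then 1 else 0) + (if s = GZm (k - 1) (l + 1) then 1 else 0)"
proof (cases s)
  case (GZ i j)
  then have "i \<noteq> 0 \<Longrightarrow> (i, j) \<in> gz_index n" "(i + 1, j) \<in> gz_index n"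
    using assms(1) by (auto simp: gz_symbols_def gz_index_def)
  then show ?thesis using GZ assms(2) gz_unit_orthonormal[of i j k l] gz_unit_orthonormal[of "i + 1" j k l]
    by (auto simp: inner_diff_left gz_index_def simp del: gz_unit_inner)
next
  case (GZm i j)
  then have "i \<noteq> 0 \<Longrightarrow> (i, j) \<in> gz_index n" "(i + 1, j - 1) \<in> gz_index n" "j \<ge> 2"
    using assms(1) by (auto simp: gz_symbols_def gz_index_def)
  then show ?thesis using GZm assms(2) gz_unit_orthonormal[of i j k l] gz_unit_orthonormal[of "i + 1" "j - 1" k l]
    by (auto simp: inner_diff_left gz_index_def simp del: gz_unit_inner)
qed

text \<open>The product with the unit vector of the entry in row \<open>i + 1\<close> leaves two
  candidates for \<open>t\<close>; the wrong one also involves an entry in row \<open>i + 2\<close>,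
  which \<open>s\<close> does not.\<close>

lemma gz_normal_inj:
  assumes "s \<in> gz_symbols n" "t \<in> gz_symbols n" "gz_normal c s = gz_normal c t"
  shows "s = t"
proof -
  have eq: "gz_normal c s \<bullet> gz_unit c k l = gz_normal c t \<bullet> gz_unit c k l" for k l using assms(3) by simp
  show ?thesis
  proof (cases s)
    case (GZ i j)
    then have m: "(i + 1, j) \<in> gz_index n" using assms(1) by (auto simp: gz_symbols_def gz_index_def)
    have "t = GZ i j \<or> t = GZm (i + 1) j"
      using eq[of "i + 1" j] GZ unfolding gz_normal_unit[OF assms(1) m] gz_normal_unit[OF assms(2) m] by (auto split: if_splits)
    moreover have False if t: "t = GZm (i + 1) j"
    proof -
      have m: "(i + 2, j - 1) \<in> gz_index n" using assms(2) t by (auto simp: gz_symbols_def gz_index_def)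
      have "2 \<le> j" using assms(2) t by (auto simp: gz_symbols_def)
      then show False
        using eq[of "i + 2" "j - 1"] GZ t unfolding gz_normal_unit[OF assms(1) m] gz_normal_unit[OF assms(2) m]
        by (auto split: if_splits)
    qed
    ultimately show ?thesis using GZ by blast
  next
    case (GZm i j)
    then have m: "(i + 1, j - 1) \<in> gz_index n" and j: "2 \<le> j" using assms(1) by (auto simp: gz_symbols_def gz_index_def)
    have "t = GZm i j \<or> t = GZ (i + 1) (j - 1)"
      using eq[of "i + 1" "j - 1"] GZm j unfolding gz_normal_unit[OF assms(1) m] gz_normal_unit[OF assms(2) m]
      by (auto split: if_splits)
    moreover have False if t: "t = GZ (i + 1) (j - 1)"
    proof -
      have m: "(i + 2, j - 1) \<in> gz_index n" using assms(2) t by (auto simp: gz_symbols_def gz_index_def)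
      show False
        using eq[of "i + 2" "j - 1"] GZm t unfolding gz_normal_unit[OF assms(1) m] gz_normal_unit[OF assms(2) m]
        by (auto split: if_splits)
    qed
    ultimately show ?thesis using GZm by blast
  qed
qed

lemma primitive_gz_normal:
  assumes "s \<in> gz_symbols n" shows "primitive_vector (gz_normal c s)"
proof -
  have int: "integral_vector (gz_normal c s)"
    by (cases s) (auto simp: integral_vector_def gz_unit_def axis_def)
  have "\<exists>k. \<bar>gz_normal c s $ k\<bar> = 1"
  proof (cases s)
    case (GZ i j)
    then have m: "(i + 1, j) \<in> gz_index n" using assms by (auto simp: gz_symbols_def gz_index_def)
    have "gz_normal c s \<bullet> gz_unit c (i + 1) j = - 1" unfolding gz_normal_unit[OF assms m] using GZ by simp
    then have "gz_normal c s $ c (i + 1) j = - 1" by (simp add: gz_unit_def inner_axis)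
    then show ?thesis by (intro exI[of _ "c (i + 1) j"]) simp
  next
    case (GZm i j)
    then have m: "(i + 1, j - 1) \<in> gz_index n" and j: "2 \<le> j" using assms by (auto simp: gz_symbols_def gz_index_def)
    have "gz_normal c s \<bullet> gz_unit c (i + 1) (j - 1) = 1" unfolding gz_normal_unit[OF assms m] using GZm j by simp
    then have "gz_normal c s $ c (i + 1) (j - 1) = 1" by (simp add: gz_unit_def inner_axis)
    then show ?thesis by (intro exI[of _ "c (i + 1) (j - 1)"]) simp
  qed
  then obtain k where k: "\<bar>gz_normal c s $ k\<bar> = 1" by blast
  have "m = 1" if w: "integral_vector w" "gz_normal c s = real m *\<^sub>R w" for w and m :: nat
  proof -
    have "w $ k \<in> \<int>" using w(1) by (auto simp: integral_vector_def)
    then obtain z :: int where z: "w $ k = of_int z" by (rule Ints_cases)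
    have "real_of_int \<bar>int m * z\<bar> = 1" using k w(2) z by (simp add: abs_mult)
    then have "\<bar>int m * z\<bar> = 1" by linarith
    then show ?thesis by (simp add: abs_mult zmult_eq_1_iff)
  qed
  moreover have "gz_normal c s \<noteq> 0" using k by auto
  ultimately show ?thesis using int unfolding primitive_vector_def by blast
qed

text \<open>\<open>gz_array\<close> with the weights of \<open>s\<close> supplies the point: its
  rows are strictly increasing, so a slack is zero only where a weight is 0 or 1. Hence no
  inequality is redundant, and each symbol yields a ray of the normal fan.\<close>

lemma gz_facet_point:
  assumes s: "s \<in> gz_symbols n"
  obtains x where "x \<in> P" "\<And>t. t \<in> gz_symbols n \<Longrightarrow> gz_normal c t \<bullet> x = gz_bound lam t \<longleftrightarrow> t = s"
proof -
  define X where "X = gz_array (gz_weight s) lam"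
  define x where "x = (\<chi> k. case inv_into (gz_index n) (\<lambda>(i, j). c i j) k of (i, j) \<Rightarrow> X i j)"
  have xc: "x $ c i j = X i j" if "(i, j) \<in> gz_index n" for i j
  proof -
    have "inv_into (gz_index n) (\<lambda>(i, j). c i j) (c i j) = (i, j)"
      using inv_into_f_f[OF bij_betw_imp_inj_on[OF bij] that] by simp
    then show ?thesis by (simp add: x_def)
  qed
  have e: "gz_entry c lam x i j = X i j" if "i \<noteq> 0 \<Longrightarrow> (i, j) \<in> gz_index n" for i j
    using xc[of i j] that by (cases "i = 0") (auto simp: gz_entry_def X_def)
  have sl: "0 \<le> gz_slack (gz_entry c lam x) t \<and> (gz_slack (gz_entry c lam x) t = 0 \<longleftrightarrow> t = s)"
    if t: "t \<in> gz_symbols n" for t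
  proof (cases t)
    case (GZ i j)
    then have m: "i \<noteq> 0 \<Longrightarrow> (i, j) \<in> gz_index n" "(i + 1, j) \<in> gz_index n" "1 \<le> j" "j + 1 \<le> n - i"
      using t n_ge_2 by (auto simp: gz_symbols_def gz_index_def)
    have "X i j < X i (j + 1)" unfolding X_def using gz_array_strict[OF strictly_dominant m(3,4)] .
    moreover have "gz_slack (gz_entry c lam x) t = gz_weight s i j * (X i (j + 1) - X i j)"
      using GZ e[OF m(1)] e[of "i + 1" j] m(2) by (simp add: X_def)
    moreover have "gz_weight s i j = 0 \<longleftrightarrow> t = s" using GZ by (cases s) auto
    ultimately show ?thesis using gz_weight_bounds(1)[of s i j] by simp
  next
    case (GZm i j)
    then have m: "i \<noteq> 0 \<Longrightarrow> (i, j) \<in> gz_index n" "(i + 1, j - 1) \<in> gz_index n" "1 \<le> j - 1" "j - 1 + 1 \<le> n - i" "j - 1 + 1 = j"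
      using t n_ge_2 by (auto simp: gz_symbols_def gz_index_def)
    have "X i (j - 1) < X i j" using gz_array_strict[OF strictly_dominant m(3,4)] unfolding X_def m(5) .
    moreover have "X (i + 1) (j - 1) = X i (j - 1) + gz_weight s i (j - 1) * (X i j - X i (j - 1))"
      using m(5) by (simp add: X_def)
    then have "gz_slack (gz_entry c lam x) t = (1 - gz_weight s i (j - 1)) * (X i j - X i (j - 1))"
      using GZm e[OF m(1)] e[of "i + 1" "j - 1"] m(2) by (simp add: algebra_simps)
    moreover have "gz_weight s i (j - 1) = 1 \<longleftrightarrow> t = s" using GZm m(5) by (cases s) auto
    ultimately show ?thesis using gz_weight_bounds(2)[of s i "j - 1"] by simp
  qed
  have "x \<in> P" unfolding gz_polytope_eq using sl by (simp add: gz_normal_inner[of c _ x lam])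
  moreover have "gz_normal c t \<bullet> x = gz_bound lam t \<longleftrightarrow> t = s" if "t \<in> gz_symbols n" for t
    using sl[OF that] by (simp add: gz_normal_inner[of c _ x lam])
  ultimately show ?thesis using that by blast
qed

lemma convex_P: "convex P"
proof -
  have "P = (\<Inter>s\<in>gz_symbols n. {x. gz_normal c s \<bullet> x \<le> gz_bound lam s})" by (auto simp: gz_polytope_eq)
  then show ?thesis by (simp add: convex_INT convex_halfspace_le)
qed

lemma active_normal_in_cone:
  assumes "x \<in> P" "s \<in> gz_symbols n" "gz_normal c s \<bullet> x = gz_bound lam s"
  shows "gz_normal c s \<in> normal_cone P {x}"
  using assms by (auto simp: normal_cone_def gz_polytope_eq)

lemma small_step_in_P:
  assumes "x \<in> P" "\<And>s. s \<in> gz_symbols n \<Longrightarrow> gz_normal c s \<bullet> x = gz_bound lam s \<Longrightarrow> gz_normal c s \<bullet> w \<le> 0"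
    and v: "v \<in> normal_cone P {x}"
  shows "v \<bullet> w \<le> 0"
proof -
  have "\<exists>e>0. \<forall>t. 0 \<le> t \<and> t \<le> e \<longrightarrow> (\<forall>s\<in>gz_symbols n. gz_normal c s \<bullet> (x + t *\<^sub>R w) \<le> gz_bound lam s)"
    using assms(1,2) by (intro small_step_in_halfspaces finite_gz_symbols) (auto simp: gz_polytope_eq)
  then obtain e where e: "e > 0" "\<forall>t. 0 \<le> t \<and> t \<le> e \<longrightarrow> (\<forall>s\<in>gz_symbols n. gz_normal c s \<bullet> (x + t *\<^sub>R w) \<le> gz_bound lam s)"
    by blast
  then have "x + e *\<^sub>R w \<in> P" by (simp add: gz_polytope_eq)
  then have "v \<bullet> (x + e *\<^sub>R w) \<le> v \<bullet> x" using v by (auto simp: normal_cone_def)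
  then show ?thesis using e(1) by (simp add: inner_right_distrib mult_le_0_iff)
qed

lemma gz_normal_nonzero: "s \<in> gz_symbols n \<Longrightarrow> gz_normal c s \<noteq> 0"
  using primitive_gz_normal by (auto simp: primitive_vector_def)

lemma normal_cone_gz_facet_point:
  assumes s: "s \<in> gz_symbols n" and x: "x \<in> P"
    "\<And>t. t \<in> gz_symbols n \<Longrightarrow> gz_normal c t \<bullet> x = gz_bound lam t \<longleftrightarrow> t = s"
  shows "normal_cone P {x} = ray_of (gz_normal c s)"
proof (intro equalityI subsetI)
  fix v assume v: "v \<in> normal_cone P {x}"
  have "\<exists>k. (\<forall>t\<in>{s}. 0 \<le> k t) \<and> v = (\<Sum>t\<in>{s}. k t *\<^sub>R gz_normal c t)"
  proof (rule farkas_independent)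
    show "\<exists>w. \<forall>t\<in>{s}. gz_normal c t \<bullet> w = f t" for f
      using gz_normal_nonzero[OF s]
      by (intro exI[of _ "(f s / (gz_normal c s \<bullet> gz_normal c s)) *\<^sub>R gz_normal c s"]) simp
    show "v \<bullet> w \<le> 0" if "\<And>t. t \<in> {s} \<Longrightarrow> gz_normal c t \<bullet> w \<le> 0" for w
      using that x(2) by (intro small_step_in_P[OF x(1) _ v]) auto
  qed simp
  then show "v \<in> ray_of (gz_normal c s)" by (auto simp: ray_of_def)
next
  fix v assume "v \<in> ray_of (gz_normal c s)"
  then obtain t where "0 \<le> t" "v = t *\<^sub>R gz_normal c s" by (auto simp: ray_of_def)
  then show "v \<in> normal_cone P {x}"
    using active_normal_in_cone[OF x(1) s] x(2)[OF s] by (auto simp: normal_cone_def intro: mult_left_mono)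
qed

lemma outer_normal_gz_facet:
  assumes s: "s \<in> gz_symbols n"
  shows "outer_normal P (gz_facet n c lam s) = gz_normal c s"
proof -
  obtain x where x: "x \<in> P" "\<And>t. t \<in> gz_symbols n \<Longrightarrow> gz_normal c t \<bullet> x = gz_bound lam t \<longleftrightarrow> t = s"
    using gz_facet_point[OF s] by blast
  have xF: "x \<in> gz_facet n c lam s" using x(1) x(2)[OF s] by (simp add: gz_facet_eq)
  have "gz_facet n c lam s = {y \<in> P. \<forall>z\<in>P. gz_normal c s \<bullet> z \<le> gz_normal c s \<bullet> y}"
  proof (intro equalityI subsetI)
    fix y assume "y \<in> {y \<in> P. \<forall>z\<in>P. gz_normal c s \<bullet> z \<le> gz_normal c s \<bullet> y}"
    then have "y \<in> P" "gz_normal c s \<bullet> x \<le> gz_normal c s \<bullet> y" using x(1) by auto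
    moreover have "gz_normal c s \<bullet> y \<le> gz_bound lam s" using \<open>y \<in> P\<close> s by (simp add: gz_polytope_eq)
    ultimately show "y \<in> gz_facet n c lam s" using x(2)[OF s] by (auto simp: gz_facet_eq)
  qed (use s in \<open>auto simp: gz_facet_eq gz_polytope_eq\<close>)
  then show ?thesis
    using normal_cone_gz_facet_point[OF s x] by (intro outer_normal_eqI[OF primitive_gz_normal[OF s] _ xF]) auto
qed

lemma gz_ray: "s \<in> gz_symbols n \<Longrightarrow> ray_of (gz_normal c s) \<in> fan_rays (normal_fan P)"
proof -
  assume s: "s \<in> gz_symbols n"
  obtain x where x: "x \<in> P" "\<And>t. t \<in> gz_symbols n \<Longrightarrow> gz_normal c t \<bullet> x = gz_bound lam t \<longleftrightarrow> t = s"
    using gz_facet_point[OF s] by blast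
  have "ray_of (gz_normal c s) \<in> normal_fan P"
    using normal_cone_gz_facet_point[OF s x] x(1) normal_fan_points[OF convex_P] by blast
  then show ?thesis using dim_ray_of[OF gz_normal_nonzero[OF s]] by (simp add: fan_rays_def)
qed

text \<open>Some inequality must be tight at \<open>x\<close>, as otherwise a small step along
  \<open>a\<close> would stay in \<open>P\<close> and increase \<open>a\<close>. Its normal lies in
  the normal cone of \<open>x\<close>, which is the ray of \<open>a\<close>.\<close>

lemma ray_of_normal_fan_P:
  assumes "ray_of a \<in> normal_fan P" "a \<noteq> 0"
  shows "\<exists>s\<in>gz_symbols n. ray_of a = ray_of (gz_normal c s)"
proof -
  obtain x where x: "x \<in> P" "ray_of a = normal_cone P {x}" using assms(1) normal_fan_points[OF convex_P] by blast
  have "\<exists>s\<in>gz_symbols n. gz_normal c s \<bullet> x = gz_bound lam s"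
  proof (rule ccontr)
    assume none: "\<not> ?thesis"
    have "a \<in> normal_cone P {x}" unfolding x(2)[symmetric] by simp
    then have "a \<bullet> a \<le> 0" by (rule small_step_in_P[OF x(1), rotated]) (use none in blast)
    moreover have "0 < a \<bullet> a" using assms(2) by simp
    ultimately show False by linarith
  qed
  then obtain s where s: "s \<in> gz_symbols n" "gz_normal c s \<bullet> x = gz_bound lam s" by blast
  then have "gz_normal c s \<in> ray_of a" unfolding x(2) by (rule active_normal_in_cone[OF x(1)])
  then show ?thesis using ray_of_eqI gz_normal_nonzero s(1) by metis
qed

text \<open>The normals are, up to sign, the edge vectors of a graph (with an additional vertex for the fixed entries),
  hence form a totally unimodular system: if \<open>w\<close> is not integral, then the coordinates congruent
  modulo 1 to a non-integral one define a vector orthogonal to all normals that are integral on \<open>w\<close>.\<close>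

lemma gz_normals_unimodular:
  assumes U: "\<And>s. s \<in> U \<Longrightarrow> gz_normal c s \<bullet> w \<in> \<int>"
    and span: "\<And>z. (\<And>s. s \<in> U \<Longrightarrow> gz_normal c s \<bullet> z = 0) \<Longrightarrow> z = 0"
  shows "integral_vector w"
proof (rule ccontr)
  assume "\<not> integral_vector w"
  then obtain a where a: "w $ a \<notin> \<int>" by (auto simp: integral_vector_def)
  define f where "f y = (if y - w $ a \<in> \<int> then 1 else 0 :: real)" for y
  define z where "z = (\<chi> k. f (w $ k))"
  have f0: "f 0 = 0" using a by (simp add: f_def)
  have feq: "f x = f y" if "x - y \<in> \<int>" for x y
  proof -
    have "x - w $ a \<in> \<int> \<longleftrightarrow> y - w $ a \<in> \<int>"
      using Ints_add[OF that, of "y - w $ a"] Ints_diff[of "x - w $ a", OF _ that] by auto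
    then show ?thesis by (simp add: f_def)
  qed
  have unit: "gz_unit c i j \<bullet> z = f (gz_unit c i j \<bullet> w)" for i j by (simp add: z_def f0)
  have "z = 0"
  proof (rule span)
    fix s assume s: "s \<in> U"
    show "gz_normal c s \<bullet> z = 0"
    proof (cases s)
      case (GZ i j)
      have "f (gz_unit c i j \<bullet> w) = f (gz_unit c (i + 1) j \<bullet> w)"
        using U[OF s] GZ by (intro feq) (simp add: inner_diff_left del: gz_unit_inner)
      then show ?thesis using GZ unit[of i j] unit[of "i + 1" j] by (simp add: inner_diff_left del: gz_unit_inner)
    next
      case (GZm i j)
      have "f (gz_unit c (i + 1) (j - 1) \<bullet> w) = f (gz_unit c i j \<bullet> w)"
        using U[OF s] GZm by (intro feq) (simp add: inner_diff_left del: gz_unit_inner)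
      then show ?thesis using GZm unit[of i j] unit[of "i + 1" "j - 1"] by (simp add: inner_diff_left del: gz_unit_inner)
    qed
  qed
  then have "z $ a = 0" by simp
  then show False by (simp add: z_def f_def)
qed

end

subsection \<open>Resolutions of Gelfand--Zetlin polytopes\<close>

locale gz_resolution = gz n c lam for n and c :: "nat \<Rightarrow> nat \<Rightarrow> 'd::finite" and lam +
  fixes Q :: "(real^'d) set"
  assumes resolution: "resolution_of Q (gz_polytope n c lam)"
begin

lemma rays: "fan_rays (normal_fan Q) = fan_rays (normal_fan P)"
  and simple: "simple_polytope Q" and integer: "integer_polytope Q"
  using resolution by (auto simp: resolution_of_def)

lemma polytope_Q: "polytope Q"
  using simple by (simp add: simple_polytope_def)

lemma convex_Q: "convex Q"
  using polytope_Q by (rule polytope_imp_convex)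

lemma nonempty_Q: "Q \<noteq> {}"
proof
  assume "Q = {}"
  then have "normal_fan Q = {}" by (simp add: normal_fan_points)
  then have "fan_rays (normal_fan P) = {}" unfolding rays[symmetric] by (simp add: fan_rays_def)
  moreover have "GZ 0 1 \<in> gz_symbols n" using n_ge_2 by (auto simp: gz_symbols_def)
  ultimately show False using gz_ray by blast
qed

lemma full_Q: "aff_dim Q = DIM(real^'d)"
  using resolution convex_Q nonempty_Q by (intro simplicial_fan_full_dim) (auto simp: resolution_of_def)

text \<open>The equality of the rays of both fans enters here: the normal cone of a facet of
  \<open>Q\<close> is a ray of the fan of \<open>P\<close>, and these are spanned by the known
  normals.\<close>

lemma facet_ray:
  assumes "F facet_of Q"
  shows "\<exists>s\<in>gz_symbols n. normal_cone Q F = ray_of (gz_normal c s)"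
proof -
  obtain a where a: "a \<noteq> 0" "normal_cone Q F = ray_of a"
    using facet_normal_cone[OF polytope_imp_polyhedron[OF polytope_Q] full_Q assms] by metis
  have "normal_cone Q F \<in> normal_fan Q"
    using assms by (auto simp: normal_fan_def facet_of_def)
  then have "ray_of a \<in> fan_rays (normal_fan Q)" using a dim_ray_of[OF a(1)] by (simp add: fan_rays_def)
  then have "ray_of a \<in> normal_fan P" unfolding rays by (simp add: fan_rays_def)
  then show ?thesis using ray_of_normal_fan_P[OF _ a(1)] a(2) by simp
qed

lemma facet_argmax:
  assumes F: "F facet_of Q" and s: "s \<in> gz_symbols n" "normal_cone Q F = ray_of (gz_normal c s)"
  shows "F = {z \<in> Q. \<forall>y\<in>Q. gz_normal c s \<bullet> y \<le> gz_normal c s \<bullet> z}"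
proof -
  obtain x where x: "x \<in> F" using F by (auto simp: facet_of_def)
  obtain a where a: "a \<noteq> 0" "normal_cone Q F = ray_of a" "\<And>x. x \<in> F \<Longrightarrow> F = {y \<in> Q. a \<bullet> y = a \<bullet> x}"
    using facet_normal_cone[OF polytope_imp_polyhedron[OF polytope_Q] full_Q F] by blast
  have xQ: "x \<in> Q" using x facet_of_imp_subset[OF F] by blast
  have max: "gz_normal c s \<bullet> y \<le> gz_normal c s \<bullet> z" if "z \<in> F" "y \<in> Q" for y z
  proof -
    have "gz_normal c s \<in> normal_cone Q F" using s(2) by simp
    then show ?thesis using that by (simp add: normal_cone_def)
  qed
  have "gz_normal c s \<in> ray_of a" unfolding a(2)[symmetric] s(2) by simp
  then obtain t where t: "t > 0" "gz_normal c s = t *\<^sub>R a"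
    using gz_normal_nonzero[OF s(1)] by (rule ray_of_memE)
  show ?thesis
  proof (intro equalityI subsetI)
    fix z assume "z \<in> F"
    then show "z \<in> {z \<in> Q. \<forall>y\<in>Q. gz_normal c s \<bullet> y \<le> gz_normal c s \<bullet> z}"
      using max facet_of_imp_subset[OF F] by blast
  next
    fix z assume z: "z \<in> {z \<in> Q. \<forall>y\<in>Q. gz_normal c s \<bullet> y \<le> gz_normal c s \<bullet> z}"
    then have "gz_normal c s \<bullet> z = gz_normal c s \<bullet> x" using max[OF x] xQ by (intro antisym) auto
    then have "a \<bullet> z = a \<bullet> x" using t by simp
    then have "z \<in> {y \<in> Q. a \<bullet> y = a \<bullet> x}" using z by blast
    then show "z \<in> F" using a(3)[OF x] by blast
  qed
qed

lemma outer_normal_facet: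
  assumes F: "F facet_of Q" and s: "s \<in> gz_symbols n" "normal_cone Q F = ray_of (gz_normal c s)"
  shows "outer_normal Q F = gz_normal c s"
proof -
  obtain x where x: "x \<in> F" using F by (auto simp: facet_of_def)
  show ?thesis
    by (rule outer_normal_eqI[OF primitive_gz_normal[OF s(1)] facet_argmax[OF F s] x]) (simp add: s(2))
qed

lemma outer_normal_facet_symbol:
  assumes F: "F facet_of Q"
  obtains s where "s \<in> gz_symbols n" "outer_normal Q F = gz_normal c s" "normal_cone Q F = ray_of (gz_normal c s)"
  using facet_ray[OF F] outer_normal_facet[OF F] by blast

text \<open>The ray of \<open>s\<close> is the normal cone of some point of \<open>Q\<close>. This
  point is not interior, and the normal of a facet through it lies in the same ray.\<close>

lemma symbol_facet:
  assumes s: "s \<in> gz_symbols n"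
  shows "\<exists>F. F facet_of Q \<and> outer_normal Q F = gz_normal c s"
proof -
  have "ray_of (gz_normal c s) \<in> normal_fan Q"
    using gz_ray[OF s] unfolding rays[symmetric] by (simp add: fan_rays_def)
  then obtain x where x: "x \<in> Q" "ray_of (gz_normal c s) = normal_cone Q {x}"
    using normal_fan_points[OF convex_Q] by blast
  have "gz_normal c s \<in> normal_cone Q {x}" unfolding x(2)[symmetric] by simp
  then have "x \<notin> interior Q" using interior_normal_cone gz_normal_nonzero[OF s] by blast
  then obtain F where F: "F facet_of Q" "x \<in> F"
    using rel_interior_of_polyhedron[OF polytope_imp_polyhedron[OF polytope_Q]] interior_rel_interior[OF full_Q] x(1) by blast
  obtain t where t: "t \<in> gz_symbols n" "outer_normal Q F = gz_normal c t" "normal_cone Q F = ray_of (gz_normal c t)"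
    using outer_normal_facet_symbol[OF F(1)] .
  have "normal_cone Q F \<subseteq> normal_cone Q {x}" using F(2) by (auto simp: normal_cone_def)
  moreover have "gz_normal c t \<in> normal_cone Q F" unfolding t(3) by simp
  ultimately have "gz_normal c t \<in> ray_of (gz_normal c s)" unfolding x(2) by blast
  then have "ray_of (gz_normal c t) = ray_of (gz_normal c s)" using gz_normal_nonzero[OF t(1)] by (rule ray_of_eqI)
  then show ?thesis using outer_normal_facet[OF F(1) s] t(3) F(1) by auto
qed

lemma outer_normal_inj:
  assumes "F facet_of Q" "G facet_of Q" "outer_normal Q F = outer_normal Q G" shows "F = G"
proof -
  have argmax: "F = {x \<in> Q. \<forall>y\<in>Q. outer_normal Q F \<bullet> y \<le> outer_normal Q F \<bullet> x}" if F: "F facet_of Q" for F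
  proof -
    obtain s where s: "s \<in> gz_symbols n" "outer_normal Q F = gz_normal c s" "normal_cone Q F = ray_of (gz_normal c s)"
      using outer_normal_facet_symbol[OF F] .
    show ?thesis unfolding s(2) by (rule facet_argmax[OF F s(1,3)])
  qed
  have "F = {x \<in> Q. \<forall>y\<in>Q. outer_normal Q G \<bullet> y \<le> outer_normal Q G \<bullet> x}"
    using argmax[OF assms(1)] unfolding assms(3) .
  also have "\<dots> = G" by (rule argmax[OF assms(2), symmetric])
  finally show ?thesis .
qed

lemma res_facet:
  assumes s: "s \<in> gz_symbols n"
  shows "res_facet n c lam Q s facet_of Q" "outer_normal Q (res_facet n c lam Q s) = gz_normal c s"
proof -
  have "\<exists>!F. F facet_of Q \<and> outer_normal Q F = gz_normal c s"
    using symbol_facet[OF s] outer_normal_inj by metis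
  from theI'[OF this] show "res_facet n c lam Q s facet_of Q" "outer_normal Q (res_facet n c lam Q s) = gz_normal c s"
    by (simp_all add: res_facet_def parallel_facet_def outer_normal_gz_facet[OF s])
qed

lemma gz_indicator_eq:
  assumes F: "F facet_of Q" and t: "t \<in> gz_symbols n" "outer_normal Q F = gz_normal c t"
  shows "gz_indicator n c lam Q s F = (if t = s then 1 else 0)"
proof -
  have "F = res_facet n c lam Q s \<longleftrightarrow> t = s" if s: "s \<in> gz_symbols n"
  proof
    assume "F = res_facet n c lam Q s"
    then show "t = s" using t(2) res_facet(2)[OF s] gz_normal_inj[OF t(1) s] by simp
  next
    assume "t = s"
    then show "F = res_facet n c lam Q s"
      using t(2) res_facet[OF s] by (intro outer_normal_inj[OF F]) simp_all
  qed
  then show ?thesis using t(1) by (auto simp: gz_indicator_def)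
qed

text \<open>Facets and symbols correspond one to one, so the indicators reduce to the pattern of
  \<open>gz_normal_unit\<close>. The coefficients of the relation are thus the changes of the
  support numbers under the translation by the unit vector of the entry.\<close>

lemma gz_relation_eq:
  assumes F: "F facet_of Q" and ij: "(i, j) \<in> gz_index n"
  shows "of_int (gz_relation n c lam Q i j F) = outer_normal Q F \<bullet> gz_unit c i j"
proof -
  obtain t where t: "t \<in> gz_symbols n" "outer_normal Q F = gz_normal c t"
    using outer_normal_facet_symbol[OF F] by blast
  show ?thesis
    unfolding gz_relation_def gz_indicator_eq[OF F t] t(2) gz_normal_unit[OF t(1) ij] by simp
qed

sublocale simple_full_polytope Q "outer_normal Q"
proof
  fix F assume "F facet_of Q"
  then obtain s where "s \<in> gz_symbols n" "outer_normal Q F = gz_normal c s" "normal_cone Q F = ray_of (gz_normal c s)"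
    by (rule outer_normal_facet_symbol)
  then show "outer_normal Q F \<noteq> 0 \<and> normal_cone Q F = ray_of (outer_normal Q F)"
    using gz_normal_nonzero by simp
qed (rule simple full_Q)+

text \<open>The support number is attained at an extreme point, which is integral, and the normal is
  integral as well.\<close>

lemma heights_integral: assumes F: "F facet_of Q" shows "heights F \<in> \<int>"
proof -
  obtain x where "x \<in> F" using F by (auto simp: facet_of_def)
  then have x: "x \<in> Q" "F \<in> tight x" using facet_of_imp_subset[OF F] F by (auto simp: tight_def)
  obtain v where v: "v extreme_point_of Q" "tight x \<subseteq> tight v" by (rule tight_subset_extreme[OF x(1)])
  have "v \<in> Q" using v(1) by (simp add: extreme_point_of_def)
  then have hv: "outer_normal Q F \<bullet> v = heights F" using tight_eq[of v] v(2) x(2) by blast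
  obtain s where s: "s \<in> gz_symbols n" "outer_normal Q F = gz_normal c s" using outer_normal_facet_symbol[OF F] by blast
  have "integral_vector v" using integer v(1) by (simp add: integer_polytope_def)
  moreover have "integral_vector (outer_normal Q F)"
    using primitive_gz_normal[OF s(1)] unfolding s(2) by (simp add: primitive_vector_def)
  ultimately have "outer_normal Q F \<bullet> v \<in> \<int>" 
    by (auto simp: integral_vector_def inner_vec_def intro!: Ints_sum Ints_mult)
  then show ?thesis using hv by simp
qed

lemma vertex_cones_unimodular:
  assumes r: "r \<in> vertex_cones" and int: "\<And>F. F \<in> r \<Longrightarrow> outer_normal Q F \<bullet> w \<in> \<int>"
  shows "integral_vector w"
proof (rule gz_normals_unimodular[where U = "{s. \<exists>F\<in>r. outer_normal Q F = gz_normal c s}"])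
  fix z assume z: "\<And>s. s \<in> {s. \<exists>F\<in>r. outer_normal Q F = gz_normal c s} \<Longrightarrow> gz_normal c s \<bullet> z = 0"
  show "z = 0"
  proof (rule vertex_cone_orthogonal[OF r])
    fix F assume F: "F \<in> r"
    then have "F facet_of Q" using r cone_subset by (auto simp: vertex_cones_def)
    then obtain s where "outer_normal Q F = gz_normal c s" using outer_normal_facet_symbol by blast
    then show "outer_normal Q F \<bullet> z = 0" using z F by auto
  qed
qed (use int in force)

sublocale smooth_polytope Q "tight ` Q" "\<lambda>F. heights F"
  by (rule smooth_polytope.intro[OF simplicial_complete_fan smooth_polytope_axioms.intro])
    (rule heights_in_type_cone hpoly_heights heights_integral vertex_cones_unimodular, assumption?)+

text \<open>The left-hand side acts as the derivative along the virtual polytope of the unit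
  translation in \<open>\<lambda>\<close> number \<open>(i, j)\<close>, under which the volume is
  constant.\<close>

lemma gz_relation_holds:
  assumes ij: "(i, j) \<in> gz_index n"
  shows "gz_class n c lam Q (GZ i j) \<ominus>\<^bsub>polytope_ring Q\<^esub> gz_class n c lam Q (GZm i j)
      \<ominus>\<^bsub>polytope_ring Q\<^esub> gz_class n c lam Q (GZ (i - 1) j)
      \<oplus>\<^bsub>polytope_ring Q\<^esub> gz_class n c lam Q (GZm (i - 1) (j + 1)) = \<zero>\<^bsub>polytope_ring Q\<^esub>"
proof -
  let ?R = "int_poly_ring (virtual_lattice Q)"
  interpret hom: ring_hom_cring ?R "polytope_ring Q" op_class by (rule op_class_hom)
  \<comment> \<open>Symbols out of range get the zero vector, in agreement with the zero class in
    \<open>gz_class\<close> and the value 0 of \<open>gz_indicator\<close>.\<close>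
  define v where "v s = (if s \<in> gz_symbols n then coordinate_vector Q (res_facet n c lam Q s) else 0)" for s
  define q where "q s = (if s \<in> gz_symbols n then poly_var (v s) else 0)" for s
  have ops: "\<And>x y. x \<oplus>\<^bsub>?R\<^esub> y = x + y" "\<zero>\<^bsub>?R\<^esub> = 0" by (simp_all add: int_poly_ring_def)
  have car: "q s \<in> carrier ?R" for s
  proof (cases "s \<in> gz_symbols n")
    case True
    then show ?thesis using poly_var_closed[OF coordinate_vector_in_lattice] by (simp add: q_def v_def)
  next
    case False
    then show ?thesis using hom.R.zero_closed by (simp add: q_def ops)
  qed
  have cls: "gz_class n c lam Q s = op_class (q s)" for s
    using hom.hom_zero by (simp add: gz_class_def q_def v_def facet_class_eq ops)
  have neg: "\<ominus>\<^bsub>?R\<^esub> p = - p" if p: "p \<in> carrier ?R" for p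
    using p hom.R.a_inv_closed[OF p] hom.R.r_neg[OF p] unfolding ops by (simp add: eq_neg_iff_add_eq_0 add.commute)
  have minus: "op_class p \<ominus>\<^bsub>polytope_ring Q\<^esub> op_class r = op_class (p - r)" "p - r \<in> carrier ?R"
    if p: "p \<in> carrier ?R" and r: "r \<in> carrier ?R" for p r
  proof -
    have "p \<oplus>\<^bsub>?R\<^esub> (\<ominus>\<^bsub>?R\<^esub> r) = p - r" unfolding ops neg[OF r] by simp
    then show "op_class p \<ominus>\<^bsub>polytope_ring Q\<^esub> op_class r = op_class (p - r)" "p - r \<in> carrier ?R"
      using hom.hom_add[OF p hom.R.a_inv_closed[OF r]] hom.hom_a_inv[OF r] hom.R.a_closed[OF p hom.R.a_inv_closed[OF r]]
      by (simp_all add: a_minus_def)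
  qed
  have plus: "op_class p \<oplus>\<^bsub>polytope_ring Q\<^esub> op_class r = op_class (p + r)" "p + r \<in> carrier ?R"
    if p: "p \<in> carrier ?R" and r: "r \<in> carrier ?R" for p r
    using hom.hom_add[OF p r] hom.R.a_closed[OF p r] unfolding ops by simp_all
  define e where "e = v (GZ i j) - v (GZm i j) - v (GZ (i - 1) j) + v (GZm (i - 1) (j + 1))"
  have num: "support_number Q F (v s) = of_int (gz_indicator n c lam Q s F)" if F: "F facet_of Q" for F s
    using coordinate_vector(2)[OF F] F by (auto simp: v_def gz_indicator_def linear_0[OF linear_support_number])
  have "support_number Q F e = outer_normal Q F \<bullet> gz_unit c i j" if F: "F facet_of Q" for F
    unfolding gz_relation_eq[OF F ij, symmetric] gz_relation_def e_def
      linear_add[OF linear_support_number] linear_diff[OF linear_support_number] num[OF F] by simp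
  then have zero: "dir_deriv e (volume_polynomial Q) x = 0" for x
    using dir_deriv_volume_eq_zero_iff[of e] by blast
  have dq: "diff_op (q s) (volume_polynomial Q) x = dir_deriv (v s) (volume_polynomial Q) x" for s x
    using linear_0[OF dir_deriv_linear[OF volume_polynomial_closed]]
    by (simp add: q_def v_def diff_op_poly_var volume_polynomial_closed)
  have "diff_op (q (GZ i j) - q (GZm i j) - q (GZ (i - 1) j) + q (GZm (i - 1) (j + 1))) (volume_polynomial Q) x
      = dir_deriv e (volume_polynomial Q) x" for x
    unfolding e_def diff_op_add diff_op_diff dq linear_add[OF dir_deriv_linear[OF volume_polynomial_closed]]
      linear_diff[OF dir_deriv_linear[OF volume_polynomial_closed]] ..
  then show ?thesis
    using zero op_class_eq_zero_iff[OF plus(2)[OF minus(2)[OF minus(2)[OF car car] car] car]]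
    unfolding cls minus(1)[OF car car] minus(1)[OF minus(2)[OF car car] car]
      plus(1)[OF minus(2)[OF minus(2)[OF car car] car] car] by simp
qed

text \<open>The coefficients \<open>a F\<close> are the products of the normals with one vector
  \<open>w\<close>, which is integral already by unimodularity at a single vertex. Its coordinates
  are the multipliers \<open>b i j\<close>.\<close>

lemma gz_relations_complete:
  assumes "(\<Oplus>\<^bsub>polytope_ring Q\<^esub> F \<in> {F. F facet_of Q}. [a F] \<cdot>\<^bsub>polytope_ring Q\<^esub> facet_class Q F)
      = \<zero>\<^bsub>polytope_ring Q\<^esub>"
  shows "\<exists>b. \<forall>F. F facet_of Q \<longrightarrow> a F = (\<Sum>i = 1..n - 1. \<Sum>j = 1..n - i. b i j * gz_relation n c lam Q i j F)"
proof -
  obtain w where w: "\<And>F. F facet_of Q \<Longrightarrow> of_int (a F) = outer_normal Q F \<bullet> w"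
    using assms facet_relation_iff[of a] by auto
  have "{} \<in> tight ` Q" using down complete[of 0] by blast
  then obtain r where r: "r \<in> vertex_cones" using extend_to_vertex_cone[OF ne] by blast
  have "integral_vector w"
  proof (rule unimodular[OF r])
    fix F assume "F \<in> r"
    then have "F facet_of Q" using r cone_subset by (auto simp: vertex_cones_def)
    then show "outer_normal Q F \<bullet> w \<in> \<int>" using w[of F] by (metis Ints_of_int)
  qed
  then have "\<forall>k. \<exists>z::int. w $ k = of_int z" unfolding integral_vector_def by (meson Ints_cases)
  then obtain z :: "'d \<Rightarrow> int" where z: "\<And>k. w $ k = of_int (z k)" by metis
  have "a F = (\<Sum>i = 1..n - 1. \<Sum>j = 1..n - i. z (c i j) * gz_relation n c lam Q i j F)" if F: "F facet_of Q" for F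
  proof -
    have index: "gz_index n = Sigma {1..n - 1} (\<lambda>i. {1..n - i})" by (auto simp: gz_index_def)
    have "real_of_int (a F) = (\<Sum>k\<in>UNIV. outer_normal Q F $ k * w $ k)" by (simp add: w[OF F] inner_vec_def)
    also have "\<dots> = (\<Sum>p\<in>gz_index n. outer_normal Q F $ (case p of (i, j) \<Rightarrow> c i j) * w $ (case p of (i, j) \<Rightarrow> c i j))"
      by (rule sum.reindex_bij_betw[OF bij, symmetric])
    also have "\<dots> = (\<Sum>(i, j)\<in>gz_index n. of_int (z (c i j) * gz_relation n c lam Q i j F))"
    proof (rule sum.cong[OF refl])
      fix p assume p: "p \<in> gz_index n"
      obtain i j where ij: "p = (i, j)" by (cases p)
      have "outer_normal Q F $ c i j = of_int (gz_relation n c lam Q i j F)"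
        using gz_relation_eq[OF F, of i j] p ij by (simp add: inner_commute[of "outer_normal Q F"] gz_index_def)
      then show "outer_normal Q F $ (case p of (i, j) \<Rightarrow> c i j) * w $ (case p of (i, j) \<Rightarrow> c i j)
        = (case p of (i, j) \<Rightarrow> of_int (z (c i j) * gz_relation n c lam Q i j F))" by (simp add: ij z)
    qed
    also have "\<dots> = of_int (\<Sum>i = 1..n - 1. \<Sum>j = 1..n - i. z (c i j) * gz_relation n c lam Q i j F)"
      unfolding index by (subst sum.Sigma[symmetric]) auto
    finally show ?thesis by (simp only: of_int_eq_iff)
  qed
  then show ?thesis by (intro exI[of _ "\<lambda>i j. z (c i j)"]) blast
qed

end

theorem proposition3p2:
  fixes n :: nat and c :: "nat \<Rightarrow> nat \<Rightarrow> 'd::finite" and lam :: "nat \<Rightarrow> int"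
    and P Q :: "(real^'d) set"
  defines "P \<equiv> gz_polytope n c lam"
  assumes labelling: "gz_labelling n c"
    and strictly_dominant: "strict_mono_on {1..n} lam"
    and resolution: "resolution_of Q P"
  shows "(\<forall>i j. 1 \<le> i \<and> i \<le> n - 1 \<and> 1 \<le> j \<and> j \<le> n - i \<longrightarrow>
      gz_class n c lam Q (GZ i j)
        \<ominus>\<^bsub>polytope_ring Q\<^esub> gz_class n c lam Q (GZm i j)
        \<ominus>\<^bsub>polytope_ring Q\<^esub> gz_class n c lam Q (GZ (i - 1) j)
        \<oplus>\<^bsub>polytope_ring Q\<^esub> gz_class n c lam Q (GZm (i - 1) (j + 1))
      = \<zero>\<^bsub>polytope_ring Q\<^esub>) \<and>
    (\<forall>a :: (real^'d) set \<Rightarrow> int.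
      (\<Oplus>\<^bsub>polytope_ring Q\<^esub> F \<in> {F. F facet_of Q}. [a F] \<cdot>\<^bsub>polytope_ring Q\<^esub> facet_class Q F)
        = \<zero>\<^bsub>polytope_ring Q\<^esub> \<longrightarrow>
      (\<exists>b :: nat \<Rightarrow> nat \<Rightarrow> int. \<forall>F. F facet_of Q \<longrightarrow>
        a F = (\<Sum>i = 1..n - 1. \<Sum>j = 1..n - i. b i j * gz_relation n c lam Q i j F)))"
proof -
  interpret gz_resolution n c lam Q
    using labelling strictly_dominant resolution by unfold_locales (simp_all add: P_def)
  show ?thesis
    using gz_relation_holds gz_relations_complete by (auto simp: gz_index_def)
qed

end
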